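(* Consider a discounted infinite-horizon problem with finite state set $\mathcal{S}$, finite action set $\mathcal{A}$, known normalized reward function $R$, discount factor $\gamma<1$ and unknown transition model, with a Flat-Dirichlet-Multinomial (FDM) prior over transition models. Let $\epsilon>0$ and $\delta\in[0,1)$. Let $A_t$ denote the policy followed by the BOLT algorithm at time $t$ with optimism parameter $\eta=H$, where $H$ is BOLT's planning horizon (which depends on $\epsilon$ and $\gamma$; see the context). Let also $s_t$ and $b_t$ be the corresponding state and belief at that time. Then, with probability at least $1-\delta$, BOLT is $\epsilon$-close to the optimal Bayesian policy, that is, $$\mathbb{V}^{A_t}(s_t,b_t)\ \ge\ \mathbb{V}^*(s_t,b_t)-\epsilon,$$ for all but $$\tilde O\!\left(\frac{|\mathcal{S}||\mathcal{A}|\eta^2}{\epsilon^2(1-\gamma)^2}\right)=\tilde O\!\left(\frac{|\mathcal{S}||\mathcal{A}|H^2}{\epsilon^2(1-\gamma)^2}\right)$$ time steps.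
   Context: **Unknown MDP and values.** The MDP has finite state set $\mathcal{S}$, finite action set $\mathcal{A}$, known reward function $R(s,a,s')$ normalized to $[0,1]$, discount factor $\gamma$, and an unknown transition model $\mu$, where $\mu_{s,a}(s')=\Pr(s'\mid s,a)$. For a policy $\pi$, $V^\pi_\mu(s)=E_\pi\big[\sum_{t\ge0}\gamma^tR(s_t,a_t,s_{t+1})\mid s_0=s,\ \text{model }\mu\big]$. **FDM beliefs.** A belief $b$ is a probability distribution over transition models. A Flat-Dirichlet-Multinomial (FDM) belief is a product of independent Dirichlet distributions, with density $b=\prod_{s,a}D(\mu_{s,a};\theta_{s,a})$, where the parameters $\theta_{s,a}=(\theta_{s,a}(s'))_{s'\in\mathcal{S}}$ act as counters of observed transitions. Then $$T(s,a,s',b):=E[\Pr(s'\mid s,a)\mid b]=\frac{\theta_{s,a}(s')}{\sum_{s''}\theta_{s,a}(s'')}.$$ The Bayes update after observing a transition $(s,a,s')$ replaces $\theta_{s,a}(s')$ by $\theta_{s,a}(s')+1$ and leaves the other parameters unchanged. The belief $b_t$ is obtained from the prior $b_0$ by Bayes updates along the observed history $s_0,a_0,\dots,s_{t-1},a_{t-1},s_t$. **Bayesian values.** The Bayesian evaluation of a policy $\pi$ is $\mathbb{V}^\pi(s,b)=E_\mu[V^\pi_\mu(s)\mid b]=\int V^\pi_\mu(s)\Pr(\mu\mid b)\,d\mu$. The optimal Bayesian value is $\mathbb{V}^*(s,b)=\max_\pi\mathbb{V}^\pi(s,b)$, and it satisfies $$\mathbb{V}^*(s,b)=\max_a\sum_{s'}T(s,a,s',b)\big(R(s,a,s')+\gamma\mathbb{V}^*(s',b')\big),$$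 where $b'$ is the Bayes update of $b$ with $(s,a,s')$. A policy attaining it is called an optimal Bayesian policy. **BOLT (Bayesian Optimistic Local Transitions)** with horizon $H$ and parameter $\eta$. At each time $t$, given the belief $b_t$ with Dirichlet parameters $\theta$, BOLT uses augmented actions $\alpha=(a,\sigma)\in\mathcal{A}\times\mathcal{S}$ and the transition model expected under $b_t$ updated with $\eta$ artificial observations of the transition $(s,a,\sigma)$; for an FDM belief this is $$\hat T(s,\alpha,s',b_t)=\frac{\theta_{s,a}(s')+\eta\,\mathbf{1}[s'=\sigma]}{\sum_{s''}\theta_{s,a}(s'')+\eta}.$$ With $b_t$ kept fixed, it performs $H$ iterations of value iteration, starting from $V^{\mathrm{BOLT}}_0=0$: $$V^{\mathrm{BOLT}}_i(s,b_t)=\max_{\alpha=(a,\sigma)}\sum_{s'}\hat T(s,\alpha,s',b_t)\big[R(s,a,s')+\gamma V^{\mathrm{BOLT}}_{i-1}(s',b_t)\big].$$ The policy $A_t$ generated at time $t$ is the maximizing policy of this $H$-step problem, i.e. $A_t=\arg\max_\pi V^{\mathrm{BOLT},\pi}_H(s_t)$, where $V^{\mathrm{BOLT},\pi}_H$ is the value of $\pi$ in the $H$-step problem with transitions $\hat T$. BOLT acts at time $t$ by following $A_t$, observes $s_{t+1}$, performs the Bayes update to get $b_{t+1}$, and replans. **Horizon and asymptotic notation.** $H$ depends on $\epsilon$ and $\gamma$ (it is taken so that $\gamma^H/(1-\gamma)=\epsilon/2$), so that $\eta$ and the bound depend only on $\epsilon,\delta,\gamma,|\mathcal{S}|,|\mathcal{A}|$.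 $\tilde O(\cdot)$ neglects logarithmic factors (here $\log(|\mathcal{S}||\mathcal{A}|/\delta)$).
   Formalization: A_t is read as the policy BOLT follows from time t on, replanning at every step, instead of the fixed H-step maximizing plan made at time t, for which the claim fails; the soft-O factor is log(2+g)·log(|S||A|/δ), where g is the stated order. *)

theory Defs
  imports "HOL-Probability.Probability"
begin

section \<open>Models, policies and trajectories\<close>

text \<open>
  The finite state set \<open>S\<close> and action set \<open>A\<close> are finite subsets of arbitrary types rather than
  finite types, so that a constant quantified outside \<open>S\<close> and \<open>A\<close> is uniform in their cardinalities
  (take both types to be \<^typ>\<open>nat\<close>).
\<close>

type_synonym ('s, 'a) model = "'s \<times> 'a \<Rightarrow> 's \<Rightarrow> real"

type_synonym ('s, 'a) params = "'s \<times> 'a \<Rightarrow> 's \<Rightarrow> real"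

text \<open>
  A policy sees the nonempty list of states visited so far, oldest first.  As it is deterministic, the
  past actions are determined by that list, so these are all deterministic history-dependent
  policies; policies reading the current state and belief are among them.
\<close>

type_synonym ('s, 'a) policy = "'s list \<Rightarrow> 'a"

definition policies :: "'s set \<Rightarrow> 'a set \<Rightarrow> ('s, 'a) policy set" where
  "policies S A = {\<pi>. \<forall>h. set h \<subseteq> S \<longrightarrow> \<pi> h \<in> A}"

abbreviation history :: "(nat \<Rightarrow> 's) \<Rightarrow> nat \<Rightarrow> 's list" where
  "history \<omega> t \<equiv> map \<omega> [0..<Suc t]"

definition next_state ::
  "'s set \<Rightarrow> ('s, 'a) model \<Rightarrow> ('s, 'a) policy \<Rightarrow> 's \<Rightarrow> nat \<Rightarrow> (nat \<Rightarrow> 's) \<Rightarrow> 's measure"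
where
  "next_state S \<mu> \<pi> s n \<omega> =
     (case n of
        0 \<Rightarrow> return (count_space S) s
      | Suc t \<Rightarrow> point_measure S (\<lambda>s'. ennreal (\<mu> (\<omega> t, \<pi> (history \<omega> t)) s')))"

text \<open>The law of the state sequence, given by the theorem of Ionescu Tulcea.\<close>

definition trajectories ::
  "'s set \<Rightarrow> ('s, 'a) model \<Rightarrow> ('s, 'a) policy \<Rightarrow> 's \<Rightarrow> (nat \<Rightarrow> 's) measure"
where
  "trajectories S \<mu> \<pi> s =
     projective_family.lim UNIV
       (Ionescu_Tulcea.CI (next_state S \<mu> \<pi> s) (\<lambda>_. count_space S)) (\<lambda>_. count_space S)"

definition model_value ::
  "'s set \<Rightarrow> ('s \<Rightarrow> 'a \<Rightarrow> 's \<Rightarrow> real) \<Rightarrow> real \<Rightarrow> ('s, 'a) model \<Rightarrow> ('s, 'a) policy \<Rightarrow> 's \<Rightarrow> real"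
where
  "model_value S R \<gamma> \<mu> \<pi> s =
     (\<integral>\<omega>. (\<Sum>t. \<gamma> ^ t * R (\<omega> t) (\<pi> (history \<omega> t)) (\<omega> (Suc t))) \<partial>trajectories S \<mu> \<pi> s)"


section \<open>Flat-Dirichlet-Multinomial beliefs\<close>

definition prob_simplex :: "'s set \<Rightarrow> ('s \<Rightarrow> real) set" where
  "prob_simplex S = {p \<in> S \<rightarrow>\<^sub>E UNIV. (\<forall>s\<in>S. 0 \<le> p s) \<and> (\<Sum>s\<in>S. p s) = 1}"

definition dirichlet_density :: "'s set \<Rightarrow> ('s \<Rightarrow> real) \<Rightarrow> ('s \<Rightarrow> real) \<Rightarrow> real" where
  "dirichlet_density S \<theta> p =
     (if p \<in> prob_simplex S
      then Gamma (\<Sum>s\<in>S. \<theta> s) / (\<Prod>s\<in>S. Gamma (\<theta> s)) * (\<Prod>s\<in>S. p s powr (\<theta> s - 1))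
      else 0)"

text \<open>
  Lebesgue measure on the simplex is taken in the coordinates other than a distinguished one
  \<open>z \<in> S\<close>, the remaining coordinate being \<open>1\<close> minus the sum of the others.  The choice of \<open>z\<close> is
  immaterial, the change of coordinates having determinant of modulus one.  The space of the
  resulting measure is the simplex itself, so that each point of it is a genuine distribution.
\<close>

definition fill_simplex :: "'s set \<Rightarrow> 's \<Rightarrow> ('s \<Rightarrow> real) \<Rightarrow> 's \<Rightarrow> real" where
  "fill_simplex S z x = (\<lambda>s\<in>S. if s = z then 1 - (\<Sum>s'\<in>S - {z}. x s') else x s)"

definition dirichlet :: "'s set \<Rightarrow> ('s \<Rightarrow> real) \<Rightarrow> ('s \<Rightarrow> real) measure" where
  "dirichlet S \<theta> =
     (let z = (SOME z. z \<in> S) in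
      restrict_space
        (distr
          (density (PiM (S - {z}) (\<lambda>_. lborel))
             (\<lambda>x. ennreal (dirichlet_density S \<theta> (fill_simplex S z x))))
          (PiM S (\<lambda>_. borel))
          (fill_simplex S z))
        (prob_simplex S))"

definition fdm :: "'s set \<Rightarrow> 'a set \<Rightarrow> ('s, 'a) params \<Rightarrow> ('s, 'a) model measure" where
  "fdm S A \<theta> = PiM (S \<times> A) (\<lambda>sa. dirichlet S (\<theta> sa))"

definition bayes_update :: "('s, 'a) params \<Rightarrow> 's \<Rightarrow> 'a \<Rightarrow> 's \<Rightarrow> ('s, 'a) params" where
  "bayes_update \<theta> s a s' = \<theta>((s, a) := (\<theta> (s, a))(s' := \<theta> (s, a) s' + 1))"

definition posterior :: "('s, 'a) params \<Rightarrow> ('s, 'a) policy \<Rightarrow> 's list \<Rightarrow> ('s, 'a) params" where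
  "posterior \<theta> \<pi> h =
     fold (\<lambda>i \<theta>'. bayes_update \<theta>' (h ! i) (\<pi> (take (Suc i) h)) (h ! Suc i))
       [0..<length h - 1] \<theta>"

text \<open>
  In the Bayesian setting the unknown model is drawn from the prior; this is the resulting law of
  the state sequence.
\<close>

definition bayes_law ::
  "'s set \<Rightarrow> 'a set \<Rightarrow> ('s, 'a) params \<Rightarrow> ('s, 'a) policy \<Rightarrow> 's \<Rightarrow> (nat \<Rightarrow> 's) measure"
where
  "bayes_law S A \<theta> \<pi> s = fdm S A \<theta> \<bind> (\<lambda>\<mu>. trajectories S \<mu> \<pi> s)"

definition bayes_value ::
  "'s set \<Rightarrow> 'a set \<Rightarrow> ('s \<Rightarrow> 'a \<Rightarrow> 's \<Rightarrow> real) \<Rightarrow> real \<Rightarrow> ('s, 'a) policy \<Rightarrow> 's \<Rightarrow>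
   ('s, 'a) params \<Rightarrow> real"
where
  "bayes_value S A R \<gamma> \<pi> s \<theta> = (\<integral>\<mu>. model_value S R \<gamma> \<mu> \<pi> s \<partial>fdm S A \<theta>)"

definition opt_bayes_value ::
  "'s set \<Rightarrow> 'a set \<Rightarrow> ('s \<Rightarrow> 'a \<Rightarrow> 's \<Rightarrow> real) \<Rightarrow> real \<Rightarrow> 's \<Rightarrow> ('s, 'a) params \<Rightarrow> real"
where
  "opt_bayes_value S A R \<gamma> s \<theta> = (SUP \<pi>\<in>policies S A. bayes_value S A R \<gamma> \<pi> s \<theta>)"


section \<open>BOLT\<close>

definition bolt_trans :: "'s set \<Rightarrow> real \<Rightarrow> ('s, 'a) params \<Rightarrow> 's \<Rightarrow> 'a \<times> 's \<Rightarrow> 's \<Rightarrow> real" where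
  "bolt_trans S \<eta> \<theta> s \<alpha> s' =
     (\<theta> (s, fst \<alpha>) s' + \<eta> * of_bool (s' = snd \<alpha>)) / ((\<Sum>s''\<in>S. \<theta> (s, fst \<alpha>) s'') + \<eta>)"

primrec bolt_value ::
  "'s set \<Rightarrow> 'a set \<Rightarrow> ('s \<Rightarrow> 'a \<Rightarrow> 's \<Rightarrow> real) \<Rightarrow> real \<Rightarrow> real \<Rightarrow> ('s, 'a) params \<Rightarrow> nat \<Rightarrow> 's \<Rightarrow> real"
where
  "bolt_value S A R \<gamma> \<eta> \<theta> 0 s = 0"
| "bolt_value S A R \<gamma> \<eta> \<theta> (Suc i) s =
     Max ((\<lambda>\<alpha>. \<Sum>s'\<in>S. bolt_trans S \<eta> \<theta> s \<alpha> s' *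
                   (R s (fst \<alpha>) s' + \<gamma> * bolt_value S A R \<gamma> \<eta> \<theta> i s')) ` (A \<times> S))"

text \<open>
  Plans for the finite-horizon problem are indexed by the number of steps to go: with \<open>i\<close> steps to
  go in state \<open>s\<close>, the plan \<open>p\<close> takes the augmented action \<open>p i s\<close>.
\<close>

type_synonym ('s, 'a) plan = "nat \<Rightarrow> 's \<Rightarrow> 'a \<times> 's"

definition plans :: "'s set \<Rightarrow> 'a set \<Rightarrow> ('s, 'a) plan set" where
  "plans S A = {p. \<forall>i. \<forall>s\<in>S. p i s \<in> A \<times> S}"

primrec plan_value ::
  "'s set \<Rightarrow> ('s \<Rightarrow> 'a \<Rightarrow> 's \<Rightarrow> real) \<Rightarrow> real \<Rightarrow> real \<Rightarrow> ('s, 'a) params \<Rightarrow> ('s, 'a) plan \<Rightarrow> nat \<Rightarrow> 's \<Rightarrow> real"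
where
  "plan_value S R \<gamma> \<eta> \<theta> p 0 s = 0"
| "plan_value S R \<gamma> \<eta> \<theta> p (Suc i) s =
     (\<Sum>s'\<in>S. bolt_trans S \<eta> \<theta> s (p (Suc i) s) s' *
        (R s (fst (p (Suc i) s)) s' + \<gamma> * plan_value S R \<gamma> \<eta> \<theta> p i s'))"

definition bolt_plan ::
  "'s set \<Rightarrow> 'a set \<Rightarrow> ('s \<Rightarrow> 'a \<Rightarrow> 's \<Rightarrow> real) \<Rightarrow> real \<Rightarrow> real \<Rightarrow> nat \<Rightarrow> 's \<Rightarrow> ('s, 'a) params \<Rightarrow>
   ('s, 'a) plan \<Rightarrow> bool"
where
  "bolt_plan S A R \<gamma> \<eta> H s \<theta> p \<longleftrightarrow>
     is_arg_max (\<lambda>p. plan_value S R \<gamma> \<eta> \<theta> p H s) (\<lambda>p. p \<in> plans S A) p"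

text \<open>
  A run of BOLT computes a plan at every history; \<open>pl\<close> fixes how ties between optimal plans are
  broken, possibly depending on the history.  BOLT executes the first action of the current
  plan and then replans.
\<close>

definition bolt_policy :: "nat \<Rightarrow> ('s list \<Rightarrow> ('s, 'a) plan) \<Rightarrow> ('s, 'a) policy" where
  "bolt_policy H pl h = fst (pl h H (last h))"

definition bolt_planner ::
  "'s set \<Rightarrow> 'a set \<Rightarrow> ('s \<Rightarrow> 'a \<Rightarrow> 's \<Rightarrow> real) \<Rightarrow> real \<Rightarrow> real \<Rightarrow> nat \<Rightarrow> ('s, 'a) params \<Rightarrow>
   ('s list \<Rightarrow> ('s, 'a) plan) \<Rightarrow> bool"
where
  "bolt_planner S A R \<gamma> \<eta> H \<theta> pl \<longleftrightarrow>
     (\<forall>h. h \<noteq> [] \<and> set h \<subseteq> S \<longrightarrow>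
        bolt_plan S A R \<gamma> \<eta> H (last h) (posterior \<theta> (bolt_policy H pl) h) (pl h))"

text \<open>
  The policy followed from time \<open>t\<close> on, given the history \<open>h\<close> up to time \<open>t\<close>.  Its argument is a
  history starting with the state at time \<open>t\<close>, which is also the last element of \<open>h\<close>.  For BOLT this
  policy goes on replanning; it does not execute the plan made at time \<open>t\<close> beyond its first action.
\<close>

definition policy_after :: "('s, 'a) policy \<Rightarrow> 's list \<Rightarrow> ('s, 'a) policy" where
  "policy_after \<pi> h = (\<lambda>h'. \<pi> (butlast h @ h'))"

text \<open>
  The horizon solves \<open>\<gamma> ^ H / (1 - \<gamma>) = \<epsilon> / 2\<close>, rounded up to a natural number.
\<close>

definition horizon :: "real \<Rightarrow> real \<Rightarrow> nat" where
  "horizon \<gamma> \<epsilon> = (LEAST n. \<gamma> ^ n / (1 - \<gamma>) \<le> \<epsilon> / 2)"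


section \<open>Bounds up to logarithmic factors\<close>

text \<open>
  \<open>ln (m / \<delta>)\<close>, with the value \<open>\<infinity>\<close> at \<open>\<delta> = 0\<close> (where \<open>m / 0 = 0\<close> would give \<open>0\<close>).
\<close>

definition confidence_log :: "real \<Rightarrow> real \<Rightarrow> ennreal" where
  "confidence_log m \<delta> = (if \<delta> = 0 then top else ennreal (ln (m / \<delta>)))"

text \<open>
  An upper bound of soft order \<open>g\<close> with constant \<open>C\<close>: the order \<open>g\<close>, times one logarithm of \<open>g\<close>
  as in the usual definition of soft-O, times the confidence logarithm \<open>ln (m / \<delta>)\<close>.
\<close>

definition soft_bound :: "real \<Rightarrow> real \<Rightarrow> real \<Rightarrow> real \<Rightarrow> ennreal" where
  "soft_bound C g m \<delta> = ennreal (C * g * ln (2 + g)) * confidence_log m \<delta>"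


section \<open>Value iteration computes the optimal plan value\<close>

lemma bolt_trans_nonneg:
  assumes "\<And>s'. s' \<in> S \<Longrightarrow> 0 \<le> \<theta> (s, fst \<alpha>) s'" and "0 \<le> \<eta>" and "s' \<in> S"
  shows "0 \<le> bolt_trans S \<eta> \<theta> s \<alpha> s'"
  using assms unfolding bolt_trans_def by (intro divide_nonneg_nonneg add_nonneg_nonneg sum_nonneg) auto

lemma plan_value_le_bolt_value:
  assumes "finite S" and "finite A" and "0 \<le> \<gamma>" and "0 \<le> \<eta>"
    and \<theta>: "\<And>s a s'. s \<in> S \<Longrightarrow> a \<in> A \<Longrightarrow> s' \<in> S \<Longrightarrow> 0 \<le> \<theta> (s, a) s'"
    and p: "p \<in> plans S A"
  shows "s \<in> S \<Longrightarrow> plan_value S R \<gamma> \<eta> \<theta> p i s \<le> bolt_value S A R \<gamma> \<eta> \<theta> i s"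
proof (induction i arbitrary: s)
  case (Suc i)
  let ?\<alpha> = "p (Suc i) s"
  have \<alpha>: "?\<alpha> \<in> A \<times> S"
    using p Suc.prems by (auto simp: plans_def)
  have "plan_value S R \<gamma> \<eta> \<theta> p (Suc i) s \<le>
    (\<Sum>s'\<in>S. bolt_trans S \<eta> \<theta> s ?\<alpha> s' * (R s (fst ?\<alpha>) s' + \<gamma> * bolt_value S A R \<gamma> \<eta> \<theta> i s'))"
    unfolding plan_value.simps
    using \<alpha> \<theta> Suc assms(3,4)
    by (intro sum_mono mult_left_mono add_left_mono bolt_trans_nonneg) auto
  also have "\<dots> \<le> bolt_value S A R \<gamma> \<eta> \<theta> (Suc i) s"
    unfolding bolt_value.simps using \<alpha> assms(1,2) by (intro Max_ge) auto
  finally show ?case .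
qed simp

lemma plan_attains_bolt_value:
  assumes "finite S" and "S \<noteq> {}" and "finite A" and "A \<noteq> {}"
  obtains p where "p \<in> plans S A"
    and "\<And>i s. s \<in> S \<Longrightarrow> plan_value S R \<gamma> \<eta> \<theta> p i s = bolt_value S A R \<gamma> \<eta> \<theta> i s"
proof -
  let ?q = "\<lambda>i s \<alpha>. \<Sum>s'\<in>S. bolt_trans S \<eta> \<theta> s \<alpha> s' *
               (R s (fst \<alpha>) s' + \<gamma> * bolt_value S A R \<gamma> \<eta> \<theta> i s')"
  define p where "p = (\<lambda>i s. SOME \<alpha>. \<alpha> \<in> A \<times> S \<and> Max (?q (i - 1) s ` (A \<times> S)) = ?q (i - 1) s \<alpha>)"
  have p: "p i s \<in> A \<times> S \<and> Max (?q (i - 1) s ` (A \<times> S)) = ?q (i - 1) s (p i s)" for i s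
  proof -
    have "Max (?q (i - 1) s ` (A \<times> S)) \<in> ?q (i - 1) s ` (A \<times> S)"
      using assms by (intro Max_in) auto
    then have "\<exists>\<alpha>. \<alpha> \<in> A \<times> S \<and> Max (?q (i - 1) s ` (A \<times> S)) = ?q (i - 1) s \<alpha>"
      by (elim imageE) blast
    then show ?thesis
      unfolding p_def by (rule someI_ex)
  qed
  have "plan_value S R \<gamma> \<eta> \<theta> p i s = bolt_value S A R \<gamma> \<eta> \<theta> i s" if "s \<in> S" for i s
    using that
  proof (induction i arbitrary: s)
    case (Suc i)
    show ?case
      using p[of "Suc i" s] Suc by simp
  qed simp
  moreover have "p \<in> plans S A"
    using p by (auto simp: plans_def)
  ultimately show ?thesis
    by (rule that[rotated])
qed

lemma bolt_plan_iff:
  assumes "finite S" and "finite A" and "A \<noteq> {}" and "0 \<le> \<gamma>" and "0 \<le> \<eta>"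
    and "\<And>s a s'. s \<in> S \<Longrightarrow> a \<in> A \<Longrightarrow> s' \<in> S \<Longrightarrow> 0 \<le> \<theta> (s, a) s'" and "s \<in> S"
  shows "bolt_plan S A R \<gamma> \<eta> H s \<theta> p \<longleftrightarrow>
    p \<in> plans S A \<and> plan_value S R \<gamma> \<eta> \<theta> p H s = bolt_value S A R \<gamma> \<eta> \<theta> H s"
proof -
  have "S \<noteq> {}"
    using assms by auto
  then obtain q where q: "q \<in> plans S A"
    "plan_value S R \<gamma> \<eta> \<theta> q H s = bolt_value S A R \<gamma> \<eta> \<theta> H s"
    using plan_attains_bolt_value[of S A R \<gamma> \<eta> \<theta>] assms by metis
  have le: "plan_value S R \<gamma> \<eta> \<theta> p H s \<le> bolt_value S A R \<gamma> \<eta> \<theta> H s" if "p \<in> plans S A" for p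
    by (rule plan_value_le_bolt_value) (use assms that in auto)
  show ?thesis
    unfolding bolt_plan_def is_arg_max_linorder
    using q le by (metis order_antisym)
qed

end

theory Submission
  imports Defs
begin

text \<open>
  Let \<open>V t\<close> be the BOLT value and \<open>W t\<close> the Bayesian value of continuing to run BOLT at time \<open>t\<close>.  With
  \<open>\<eta> = H\<close> the BOLT value is optimistic up to the horizon truncation \<open>\<epsilon> / 2\<close>, so a bad step has
  \<open>V t - W t > \<epsilon> / 2\<close>.  Comparing the two Bellman equations under the predictive distribution gives
  \<open>V t - W t \<le> e t + \<gamma> * E [V (t + 1) - W (t + 1)]\<close> with \<open>e t = 2 * H / ((1 - \<gamma>) * (N + H))\<close>, where
  \<open>N\<close> is the total count of the current state-action pair; this covers both the artificial
  observations and the replanning with the updated belief.  Subtracting \<open>\<epsilon> / 4\<close> makes the error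
  vanish once \<open>N\<close> is large, so that its sum along a run is bounded by a logarithmic potential.  This
  yields a potential \<open>\<Psi>\<close> with values in \<open>[0, M]\<close> that drops by \<open>1\<close> in expectation at each bad step.
  Hence the number of bad steps has exponential tails at scale \<open>M\<close>, and a bound of order
  \<open>M * ln (2 / \<delta>)\<close> fails with probability at most \<open>\<delta>\<close>.
\<close>

section \<open>The Dirichlet distribution\<close>

text \<open>The obstacle is that BOLT never carries out its plan: it replans with a new belief at
  every step, so plan values and true values cannot be compared over a whole horizon. They are
  compared over one step only, and two facts pay for replanning: an observation lowers an i-stage
  value by a small amount at most, and an added stage never lowers it.

  Why the potential works: let Z be the positive part of V - W - \<epsilon> / 4 and P the
  logarithmic potential, which falls by at least the truncated error e in each step. From Z \<le> e
  + \<gamma> * E Z' it follows that E (P' - \<gamma> * Z') \<le> P - Z = (P - \<gamma> * Z) - (1 -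
  \<gamma>) * Z. So P - \<gamma> * Z falls by at least (1 - \<gamma>) * \<epsilon> / 4 at a bad
  step, and scaling this to 1 costs the factor 4 / ((1 - \<gamma>) * \<epsilon>). No blocks of H
  steps and no event of leaving the known state-action pairs appear.

  Measure theory enters through Dirichlet conjugacy: with the model integrated out, finite histories
  follow the predictive probabilities of the current posterior, and nearly all later estimates
  concern finite weighted sums.\<close>

lemma nn_integral_beta_scaled:
  fixes a b r :: real
  assumes "0 < a" "0 < b" "0 \<le> r"
  shows "(\<integral>\<^sup>+x. ennreal (x powr (a - 1) * (r - x) powr (b - 1) * indicator {0..r} x) \<partial>lborel) =
    ennreal (Beta a b * r powr (a + b - 1))"
\<comment> \<open>\<open>0 powr x\<close> is 0 in Isabelle, so at r = 0 both sides vanish whatever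
  the exponents are; the substitution x = r * t needs r > 0.\<close>
proof (cases "r = 0")
  case True
  have "x powr (a - 1) * (0 - x) powr (b - 1) * indicator {0..0} x = 0" for x :: real
    by (auto simp: indicator_def)
  then show ?thesis
    using True by (simp del: diff_0)
next
  case False
  with assms have r: "0 < r" by simp
  have unit: "(\<integral>\<^sup>+t. ennreal (t powr (a - 1) * (1 - t) powr (b - 1) * indicator {0..1} t) \<partial>lborel) =
      ennreal (Beta a b)"
    using nn_integral_has_integral_lebesgue[OF _ has_integral_Beta_real[OF assms(1,2)]]
    by (simp add: mult_ac ennreal_mult' ennreal_indicator)
  have "(\<integral>\<^sup>+x. ennreal (x powr (a - 1) * (r - x) powr (b - 1) * indicator {0..r} x) \<partial>lborel) =
     ennreal r * (\<integral>\<^sup>+t. ennreal ((0 + r * t) powr (a - 1) * (r - (0 + r * t)) powr (b - 1) *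
       indicator {0..r} (0 + r * t)) \<partial>lborel)"
    using r by (subst nn_integral_real_affine[where c = r and t = 0]) auto
  also have "(\<lambda>t. ennreal ((0 + r * t) powr (a - 1) * (r - (0 + r * t)) powr (b - 1) *
       indicator {0..r} (0 + r * t))) =
      (\<lambda>t. ennreal (r powr (a + b - 2)) *
         ennreal (t powr (a - 1) * (1 - t) powr (b - 1) * indicator {0..1} t))"
  proof
    fix t :: real
    show "ennreal ((0 + r * t) powr (a - 1) * (r - (0 + r * t)) powr (b - 1) *
       indicator {0..r} (0 + r * t)) = ennreal (r powr (a + b - 2)) *
         ennreal (t powr (a - 1) * (1 - t) powr (b - 1) * indicator {0..1} t)"
    proof (cases "0 \<le> t \<and> t \<le> 1")
      case True
      have "r - r * t = r * (1 - t)" by (simp add: algebra_simps)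
      moreover have "r powr (a - 1) * r powr (b - 1) = r powr (a + b - 2)"
        by (simp add: powr_add[symmetric])
      ultimately show ?thesis
        using True r by (simp add: ennreal_mult[symmetric] powr_mult mult_ac)
    next
      case False
      then have "0 + r * t \<notin> {0..r}"
        using r by (auto simp: zero_le_mult_iff mult_le_cancel_left1)
      moreover have "t \<notin> {0..1}" using False by auto
      ultimately show ?thesis by (simp del: add_0)
    qed
  qed
  also have "ennreal r * (\<integral>\<^sup>+t. ennreal (r powr (a + b - 2)) *
       ennreal (t powr (a - 1) * (1 - t) powr (b - 1) * indicator {0..1} t) \<partial>lborel) =
     ennreal r * (ennreal (r powr (a + b - 2)) * ennreal (Beta a b))"
    by (subst nn_integral_cmult) (auto simp: unit)
  also have "\<dots> = ennreal (Beta a b * r powr (a + b - 1))"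
  proof -
    have "r * r powr (a + b - 2) = r powr (a + b - 1)"
      using r powr_add[of r 1 "a + b - 2"] by simp
    then have "r * (r powr (a + b - 2) * Beta a b) = Beta a b * r powr (a + b - 1)"
      by (simp add: mult.assoc[symmetric] mult.commute[of "Beta a b"])
    moreover have "ennreal r * (ennreal (r powr (a + b - 2)) * ennreal (Beta a b)) =
        ennreal (r * (r powr (a + b - 2) * Beta a b))"
      using r by (simp add: ennreal_mult'[symmetric])
    ultimately show ?thesis
      by (simp only:)
  qed
  finally show ?thesis .
qed

text \<open>Liouville's form of the Dirichlet integral; b is the exponent of the dependent
  coordinate. The total r is kept general because integrating with one coordinate y held fixed
  leaves the same integral with total r - y. What remains is a one-dimensional Beta integral whose
  second parameter c collects b and all earlier parameters.\<close>

lemma nn_integral_dirichlet_liouville: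
  fixes \<theta> :: "'i \<Rightarrow> real"
  assumes "finite I" "\<And>i. i \<in> I \<Longrightarrow> 0 < \<theta> i" "0 < b" "0 \<le> r"
  shows "(\<integral>\<^sup>+x. ennreal ((\<Prod>i\<in>I. x i powr (\<theta> i - 1)) * (r - (\<Sum>i\<in>I. x i)) powr (b - 1) *
      of_bool ((\<forall>i\<in>I. 0 \<le> x i) \<and> (\<Sum>i\<in>I. x i) \<le> r)) \<partial>PiM I (\<lambda>_. lborel)) =
    ennreal ((\<Prod>i\<in>I. Gamma (\<theta> i)) * Gamma b / Gamma ((\<Sum>i\<in>I. \<theta> i) + b) *
      r powr ((\<Sum>i\<in>I. \<theta> i) + b - 1))"
  using assms
proof (induction I arbitrary: r rule: finite_induct)
  case empty
  interpret product_sigma_finite "\<lambda>_::'i. lborel :: real measure" by standard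
  show ?case
    using empty less_imp_neq[OF Gamma_real_pos[of b]] by (simp add: PiM_empty nn_integral_count_space_finite)
next
  case (insert j I)
  interpret product_sigma_finite "\<lambda>_::'i. lborel :: real measure" by standard
  define c where "c = (\<Sum>i\<in>I. \<theta> i) + b"
  define K where "K = (\<Prod>i\<in>I. Gamma (\<theta> i)) * Gamma b / Gamma c"
  have c: "0 < c"
    unfolding c_def using insert.prems by (intro add_nonneg_pos sum_nonneg) (auto intro: less_imp_le)
  have K: "0 \<le> K"
    unfolding K_def using insert.prems c
    by (intro divide_nonneg_nonneg mult_nonneg_nonneg prod_nonneg) (auto intro!: less_imp_le Gamma_real_pos)
  define F where "F = (\<lambda>J r (x :: 'i \<Rightarrow> real). (\<Prod>i\<in>J. x i powr (\<theta> i - 1)) * (r - (\<Sum>i\<in>J. x i)) powr (b - 1) *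
      of_bool ((\<forall>i\<in>J. 0 \<le> x i) \<and> (\<Sum>i\<in>J. x i) \<le> r) :: real)"
  have IH: "(\<integral>\<^sup>+x. ennreal (F I s x) \<partial>PiM I (\<lambda>_. lborel)) = ennreal (K * s powr (c - 1))" if "0 \<le> s" for s
    using insert.IH[of s] insert.prems that unfolding F_def K_def c_def by auto
  have F_insert: "F (insert j I) r (x(j := y)) =
      y powr (\<theta> j - 1) * indicator {0..r} y * F I (r - y) x" for x y
  proof -
    have *: "(\<Sum>i\<in>I. if i = j then y else x i) = (\<Sum>i\<in>I. x i)"
       "(\<Prod>i\<in>I. (if i = j then y else x i) powr (\<theta> i - 1)) = (\<Prod>i\<in>I. x i powr (\<theta> i - 1))"
      using insert.hyps by (auto intro!: sum.cong prod.cong)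
    have "(\<forall>i\<in>insert j I. 0 \<le> (x(j := y)) i) \<and> (\<Sum>i\<in>insert j I. (x(j := y)) i) \<le> r \<longleftrightarrow>
      0 \<le> y \<and> y \<le> r \<and> (\<forall>i\<in>I. 0 \<le> x i) \<and> (\<Sum>i\<in>I. x i) \<le> r - y"
    proof -
      \<comment> \<open>Nonnegativity of the partial sum is what yields y \<le> r from the
        constraint on the remaining coordinates.\<close>
      have "0 \<le> sum x I" if "\<forall>i\<in>I. i \<noteq> j \<longrightarrow> 0 \<le> x i"
        using that insert.hyps by (intro sum_nonneg) auto
      moreover have "\<forall>i\<in>I. i \<noteq> j"
        using insert.hyps by auto
      ultimately show ?thesis
        using insert.hyps by (auto simp: *)
    qed
    then show ?thesis
      unfolding F_def using insert.hyps by (auto simp: * indicator_def algebra_simps)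
  qed
  have [measurable]: "(\<lambda>x. ennreal (F J r x)) \<in> borel_measurable (PiM J (\<lambda>_. lborel))" if "finite J" for J r
    unfolding F_def using that by measurable
  have "(\<integral>\<^sup>+x. ennreal (F (insert j I) r x) \<partial>PiM (insert j I) (\<lambda>_. lborel)) =
    (\<integral>\<^sup>+y. (\<integral>\<^sup>+x. ennreal (F (insert j I) r (x(j := y))) \<partial>PiM I (\<lambda>_. lborel)) \<partial>lborel)"
    using insert.hyps by (subst product_nn_integral_insert_rev) auto
  also have "\<dots> = (\<integral>\<^sup>+y. ennreal K * ennreal (y powr (\<theta> j - 1) * (r - y) powr (c - 1) * indicator {0..r} y) \<partial>lborel)"
  proof (rule nn_integral_cong)
    fix y :: real
    have "(\<integral>\<^sup>+x. ennreal (F (insert j I) r (x(j := y))) \<partial>PiM I (\<lambda>_. lborel)) =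
      (\<integral>\<^sup>+x. ennreal (y powr (\<theta> j - 1) * indicator {0..r} y) * ennreal (F I (r - y) x) \<partial>PiM I (\<lambda>_. lborel))"
      unfolding F_insert by (intro nn_integral_cong ennreal_mult) (auto simp: F_def prod_nonneg)
    also have "\<dots> = ennreal (y powr (\<theta> j - 1) * indicator {0..r} y) * (\<integral>\<^sup>+x. ennreal (F I (r - y) x) \<partial>PiM I (\<lambda>_. lborel))"
      using insert.hyps by (intro nn_integral_cmult) auto
    also have "\<dots> = ennreal K * ennreal (y powr (\<theta> j - 1) * (r - y) powr (c - 1) * indicator {0..r} y)"
    proof (cases "y \<in> {0..r}")
      case True
      then show ?thesis using K by (subst IH) (auto simp: ennreal_mult[symmetric] mult_ac)
    qed simp
    finally show "(\<integral>\<^sup>+x. ennreal (F (insert j I) r (x(j := y))) \<partial>PiM I (\<lambda>_. lborel)) =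
      ennreal K * ennreal (y powr (\<theta> j - 1) * (r - y) powr (c - 1) * indicator {0..r} y)" .
  qed
  also have "\<dots> = ennreal K * ennreal (Beta (\<theta> j) c * r powr (\<theta> j + c - 1))"
    using insert.prems c by (subst nn_integral_cmult) (auto simp: nn_integral_beta_scaled)
  also have "\<dots> = ennreal (K * Beta (\<theta> j) c * r powr (\<theta> j + c - 1))"
    using K by (simp add: ennreal_mult'[symmetric] mult_ac)
  also have "K * Beta (\<theta> j) c = (\<Prod>i\<in>insert j I. Gamma (\<theta> i)) * Gamma b / Gamma ((\<Sum>i\<in>insert j I. \<theta> i) + b)"
    using insert.hyps Gamma_real_pos[OF c] unfolding K_def Beta_def
    by (simp add: c_def add_ac mult_ac)
  also have "\<theta> j + c = (\<Sum>i\<in>insert j I. \<theta> i) + b"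
    using insert.hyps by (simp add: c_def)
  finally show ?case
    unfolding F_def .
qed

lemma prob_simplex_sets [measurable]:
  assumes "finite S" shows "prob_simplex S \<in> sets (PiM S (\<lambda>_. borel))"
proof -
  have "prob_simplex S = {p \<in> space (PiM S (\<lambda>_. borel :: real measure)). (\<forall>s\<in>S. 0 \<le> p s) \<and> (\<Sum>s\<in>S. p s) = 1}"
    by (auto simp: prob_simplex_def space_PiM)
  also have "\<dots> \<in> sets (PiM S (\<lambda>_. borel))"
    using assms by measurable
  finally show ?thesis .
qed

lemma measurable_fill_simplex [measurable]:
  assumes "finite S"
  shows "fill_simplex S z \<in> PiM (S - {z}) (\<lambda>_. lborel) \<rightarrow>\<^sub>M PiM S (\<lambda>_. borel)"
  unfolding fill_simplex_def
proof (rule measurable_restrict)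
  fix s assume "s \<in> S"
  then show "(\<lambda>x. if s = z then 1 - (\<Sum>s'\<in>S - {z}. x s') else x s) \<in> PiM (S - {z}) (\<lambda>_. lborel) \<rightarrow>\<^sub>M borel"
    using assms by (cases "s = z") (auto intro!: borel_measurable_diff borel_measurable_sum)
qed

lemma measurable_dirichlet_density [measurable]:
  assumes "finite S"
  shows "dirichlet_density S \<theta> \<in> borel_measurable (PiM S (\<lambda>_. borel))"
  unfolding dirichlet_density_def using assms by measurable

lemma dirichlet_density_nonneg:
  assumes "\<And>s. s \<in> S \<Longrightarrow> 0 < \<theta> s" "S \<noteq> {}" "finite S"
  shows "0 \<le> dirichlet_density S \<theta> p"
  unfolding dirichlet_density_def using assms
  by (auto intro!: divide_nonneg_nonneg mult_nonneg_nonneg prod_nonneg less_imp_le[OF Gamma_real_pos] sum_pos)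

lemma space_dirichlet [simp]: "space (dirichlet S \<theta>) = prob_simplex S"
  by (auto simp: dirichlet_def Let_def space_restrict_space prob_simplex_def space_PiM)

lemma sets_dirichlet [measurable_cong]:
  "sets (dirichlet S \<theta>) = sets (restrict_space (PiM S (\<lambda>_. borel)) (prob_simplex S))"
  unfolding dirichlet_def Let_def by (rule sets_restrict_space_cong) simp

lemma nn_integral_dirichlet:
  assumes S: "finite S" "S \<noteq> {}"
    and f: "f \<in> borel_measurable (restrict_space (PiM S (\<lambda>_. borel)) (prob_simplex S))"
  shows "(\<integral>\<^sup>+p. f p \<partial>dirichlet S \<theta>) =
    (\<integral>\<^sup>+x. ennreal (dirichlet_density S \<theta> (fill_simplex S (SOME z. z \<in> S) x)) *
       (f (fill_simplex S (SOME z. z \<in> S) x) * indicator (prob_simplex S) (fill_simplex S (SOME z. z \<in> S) x))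
      \<partial>PiM (S - {SOME z. z \<in> S}) (\<lambda>_. lborel))"
proof -
  let ?z = "SOME z. z \<in> S"
  have [measurable]: "(\<lambda>p. f p * indicator (prob_simplex S) p) \<in> borel_measurable (PiM S (\<lambda>_. borel))"
    using f by (subst (asm) borel_measurable_restrict_space_iff_ennreal) (use S in auto)
  note [measurable] = measurable_fill_simplex[OF S(1)] measurable_dirichlet_density[OF S(1)]
  show ?thesis
    unfolding dirichlet_def Let_def
    using S by (subst nn_integral_restrict_space) (auto simp: nn_integral_distr nn_integral_density)
qed

text \<open>In the free coordinates the density is the normalising constant times the Liouville
  integrand with r = 1 and b the parameter of the distinguished coordinate; the Gamma factors then
  cancel.\<close>

lemma prob_space_dirichlet:
  assumes S: "finite S" "S \<noteq> {}" and \<theta>: "\<And>s. s \<in> S \<Longrightarrow> 0 < \<theta> s"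
  shows "prob_space (dirichlet S \<theta>)"
proof
  let ?z = "SOME z. z \<in> S"
  let ?I = "S - {?z}"
  have z: "?z \<in> S" using S(2) by (simp add: some_in_eq)
  have sum: "sum g S = sum g ?I + g ?z" and prod: "prod g S = prod g ?I * g ?z" for g :: "'a \<Rightarrow> real"
    using S(1) z by (simp_all add: sum.remove prod.remove)
  let ?G = "Gamma (\<Sum>s\<in>S. \<theta> s) / (\<Prod>s\<in>S. Gamma (\<theta> s))"
  have G: "0 < ?G"
    using S \<theta> by (intro divide_pos_pos prod_pos Gamma_real_pos sum_pos) auto
  have eq: "ennreal (dirichlet_density S \<theta> (fill_simplex S ?z x)) * indicator (prob_simplex S) (fill_simplex S ?z x) =
     ennreal ?G * ennreal ((\<Prod>i\<in>?I. x i powr (\<theta> i - 1)) * (1 - (\<Sum>i\<in>?I. x i)) powr (\<theta> ?z - 1) *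
      of_bool ((\<forall>i\<in>?I. 0 \<le> x i) \<and> (\<Sum>i\<in>?I. x i) \<le> 1))" for x
  proof -
    have 1: "(\<Sum>s\<in>?I. fill_simplex S ?z x s) = (\<Sum>i\<in>?I. x i)"
      "(\<Prod>s\<in>?I. fill_simplex S ?z x s powr (\<theta> s - 1)) = (\<Prod>i\<in>?I. x i powr (\<theta> i - 1))"
      "fill_simplex S ?z x ?z = 1 - (\<Sum>i\<in>?I. x i)"
      using z by (auto simp: fill_simplex_def intro!: sum.cong prod.cong)
    have "fill_simplex S ?z x \<in> prob_simplex S \<longleftrightarrow> (\<forall>i\<in>?I. 0 \<le> x i) \<and> (\<Sum>i\<in>?I. x i) \<le> 1"
    proof -
      have "(\<forall>s\<in>S. 0 \<le> fill_simplex S ?z x s) \<longleftrightarrow> (\<forall>i\<in>?I. 0 \<le> x i) \<and> (\<Sum>i\<in>?I. x i) \<le> 1"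
        proof -
        have "(\<forall>s\<in>S. 0 \<le> fill_simplex S ?z x s) \<longleftrightarrow>
            (\<forall>s\<in>?I. 0 \<le> fill_simplex S ?z x s) \<and> 0 \<le> fill_simplex S ?z x ?z"
          using z by blast
        then show ?thesis
          unfolding 1(3) by (auto simp: fill_simplex_def)
      qed
      moreover have "(\<Sum>s\<in>S. fill_simplex S ?z x s) = 1"
        by (simp only: sum 1)
      ultimately show ?thesis by (simp add: prob_simplex_def fill_simplex_def)
    qed
    then show ?thesis
      unfolding dirichlet_density_def by (cases "fill_simplex S ?z x \<in> prob_simplex S")
         (use G in \<open>auto simp add: prod[of "\<lambda>s. _ s powr _ s"] 1 ennreal_mult'[symmetric]\<close>)
  qed
  have pos: "0 < \<theta> ?z" using \<theta> z by auto
  have "emeasure (dirichlet S \<theta>) (space (dirichlet S \<theta>)) = (\<integral>\<^sup>+p. 1 \<partial>dirichlet S \<theta>)"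
    by simp
  also have "\<dots> = (\<integral>\<^sup>+x. ennreal ?G * ennreal ((\<Prod>i\<in>?I. x i powr (\<theta> i - 1)) * (1 - (\<Sum>i\<in>?I. x i)) powr (\<theta> ?z - 1) *
      of_bool ((\<forall>i\<in>?I. 0 \<le> x i) \<and> (\<Sum>i\<in>?I. x i) \<le> 1)) \<partial>PiM ?I (\<lambda>_. lborel))"
    using S by (subst nn_integral_dirichlet) (auto simp: eq)
  also have "\<dots> = ennreal ?G * (\<integral>\<^sup>+x. ennreal ((\<Prod>i\<in>?I. x i powr (\<theta> i - 1)) * (1 - (\<Sum>i\<in>?I. x i)) powr (\<theta> ?z - 1) *
      of_bool ((\<forall>i\<in>?I. 0 \<le> x i) \<and> (\<Sum>i\<in>?I. x i) \<le> 1)) \<partial>PiM ?I (\<lambda>_. lborel))"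
    using S(1) by (intro nn_integral_cmult) measurable
  also have "\<dots> = ennreal ?G * ennreal ((\<Prod>i\<in>?I. Gamma (\<theta> i)) * Gamma (\<theta> ?z) / Gamma ((\<Sum>i\<in>?I. \<theta> i) + \<theta> ?z))"
    using S \<theta> pos by (subst nn_integral_dirichlet_liouville) auto
  also have "\<dots> = ennreal (?G * (1 / ?G))"
    using G by (subst sum, subst prod) (simp add: ennreal_mult'[symmetric] flip: sum prod)
  also have "\<dots> = 1"
    by (simp only: times_divide_eq_right mult_1_right divide_self[OF less_imp_neq[OF G, symmetric]] ennreal_1)
  finally show "emeasure (dirichlet S \<theta>) (space (dirichlet S \<theta>)) = 1" .
qed

text \<open>Bayes' rule for one multinomial observation, as a pointwise identity of densities: the
  factor p s' raises one exponent by 1, and Gamma (x + 1) = x * Gamma x, used for the parameter of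
  s' and for the total, turns the quotient of the normalising constants into the predictive
  probability.\<close>

lemma dirichlet_conjugate:
  assumes S: "finite S" "S \<noteq> {}" and \<theta>: "\<And>s. s \<in> S \<Longrightarrow> 0 < \<theta> s" and s': "s' \<in> S"
    and f: "f \<in> borel_measurable (restrict_space (PiM S (\<lambda>_. borel)) (prob_simplex S))"
  shows "(\<integral>\<^sup>+p. ennreal (p s') * f p \<partial>dirichlet S \<theta>) =
    ennreal (\<theta> s' / (\<Sum>s\<in>S. \<theta> s)) * (\<integral>\<^sup>+p. f p \<partial>dirichlet S (\<theta>(s' := \<theta> s' + 1)))"
proof -
  let ?\<theta>' = "\<theta>(s' := \<theta> s' + 1)"
  let ?z = "SOME z. z \<in> S"
  have m[measurable]: "(\<lambda>p. ennreal (p s')) \<in> borel_measurable (restrict_space (PiM S (\<lambda>_. borel)) (prob_simplex S))"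
    by (rule measurable_restrict_space1) (use s' in measurable)
  note f[measurable]
  define \<Theta> where "\<Theta> = (\<Sum>s\<in>S. \<theta> s)"
  have \<Theta>: "0 < \<Theta>" unfolding \<Theta>_def using S \<theta> by (intro sum_pos) auto
  have \<Theta>': "(\<Sum>s\<in>S. ?\<theta>' s) = \<Theta> + 1"
    unfolding \<Theta>_def using S s' by (subst (1 2) sum.remove[of _ s']) (auto intro!: sum.cong)
  have dens: "p s' * dirichlet_density S \<theta> p = \<theta> s' / \<Theta> * dirichlet_density S ?\<theta>' p" for p
  proof (cases "p \<in> prob_simplex S")
    case True
    then have p: "0 \<le> p s'" using s' by (auto simp: prob_simplex_def)
    have th: "0 < \<theta> s'" using \<theta> s' .
    let ?P = "\<Prod>s\<in>S - {s'}. p s powr (\<theta> s - 1)" and ?Q = "\<Prod>s\<in>S - {s'}. Gamma (\<theta> s)"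
    have Q: "0 < ?Q" using \<theta> by (intro prod_pos Gamma_real_pos) auto
    have P': "(\<Prod>s\<in>S. p s powr (?\<theta>' s - 1)) = p s' * p s' powr (\<theta> s' - 1) * ?P"
    proof -
      \<comment> \<open>At p s' = 0 both sides are 0 by the convention for \<open>powr\<close>, so
        the identity holds on the boundary of the simplex too and no null set has to be
        removed.\<close>
      have "p s' * p s' powr (\<theta> s' - 1) = p s' powr (\<theta> s')"
        using p th powr_add[of "p s'" 1 "\<theta> s' - 1"] by (cases "p s' = 0") auto
      then show ?thesis
        using S s' by (subst prod.remove[of _ s']) (auto intro!: prod.cong)
    qed
    have Q': "(\<Prod>s\<in>S. Gamma (?\<theta>' s)) = \<theta> s' * Gamma (\<theta> s') * ?Q"
    proof -
      have "Gamma (\<theta> s' + 1) = \<theta> s' * Gamma (\<theta> s')"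
        using th by (intro Gamma_plus1) (auto elim!: nonpos_Ints_cases)
      then show ?thesis
        using S s' by (subst prod.remove[of _ s']) (auto intro!: prod.cong)
    qed
    have P: "(\<Prod>s\<in>S. p s powr (\<theta> s - 1)) = p s' powr (\<theta> s' - 1) * ?P" "(\<Prod>s\<in>S. Gamma (\<theta> s)) = Gamma (\<theta> s') * ?Q"
      using S s' by (simp_all add: prod.remove[of _ s'])
    have "Gamma (\<Theta> + 1) = \<Theta> * Gamma \<Theta>" using \<Theta> by (intro Gamma_plus1) (auto elim!: nonpos_Ints_cases)
    then show ?thesis
      unfolding dirichlet_density_def \<Theta>' P' Q' using True \<Theta> th Q Gamma_real_pos[OF th]
      by (simp add: P \<Theta>_def[symmetric] divide_simps)
  qed (simp add: dirichlet_density_def)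
  have nn: "0 \<le> dirichlet_density S ?\<theta>' p" for p
    using S \<theta> s' by (intro dirichlet_density_nonneg) (auto simp: add_pos_pos)
  have "(\<integral>\<^sup>+p. ennreal (p s') * f p \<partial>dirichlet S \<theta>) =
    (\<integral>\<^sup>+x. ennreal (\<theta> s' / \<Theta>) * (ennreal (dirichlet_density S ?\<theta>' (fill_simplex S ?z x)) *
       (f (fill_simplex S ?z x) * indicator (prob_simplex S) (fill_simplex S ?z x)))
      \<partial>PiM (S - {?z}) (\<lambda>_. lborel))"
  proof (subst nn_integral_dirichlet[OF S], measurable, rule nn_integral_cong)
    fix x
    let ?p = "fill_simplex S ?z x"
    have "ennreal (dirichlet_density S \<theta> ?p) * (ennreal (?p s') * indicator (prob_simplex S) ?p) =
        ennreal (?p s' * dirichlet_density S \<theta> ?p) * indicator (prob_simplex S) ?p"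
      using s' by (cases "?p \<in> prob_simplex S") (auto simp: ennreal_mult' prob_simplex_def mult_ac)
    also have "\<dots> = ennreal (\<theta> s' / \<Theta>) * ennreal (dirichlet_density S ?\<theta>' ?p) * indicator (prob_simplex S) ?p"
      unfolding dens using nn \<theta>[OF s'] \<Theta> by (subst ennreal_mult) auto
    finally have *: "ennreal (dirichlet_density S \<theta> ?p) * (ennreal (?p s') * indicator (prob_simplex S) ?p) =
        ennreal (\<theta> s' / \<Theta>) * ennreal (dirichlet_density S ?\<theta>' ?p) * indicator (prob_simplex S) ?p" .
    have "ennreal (dirichlet_density S \<theta> ?p) * (ennreal (?p s') * f ?p * indicator (prob_simplex S) ?p) =
        ennreal (dirichlet_density S \<theta> ?p) * (ennreal (?p s') * indicator (prob_simplex S) ?p) * f ?p"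
      by (simp only: mult_ac)
    also note *
    finally show "ennreal (dirichlet_density S \<theta> ?p) * (ennreal (?p s') * f ?p * indicator (prob_simplex S) ?p) =
       ennreal (\<theta> s' / \<Theta>) * (ennreal (dirichlet_density S ?\<theta>' ?p) * (f ?p * indicator (prob_simplex S) ?p))"
      by (simp only: mult_ac)
  qed
  also have "\<dots> = ennreal (\<theta> s' / \<Theta>) * (\<integral>\<^sup>+p. f p \<partial>dirichlet S ?\<theta>')"
  proof -
    have g: "(\<lambda>p. f p * indicator (prob_simplex S) p) \<in> borel_measurable (PiM S (\<lambda>_. borel))"
      using f by (subst (asm) borel_measurable_restrict_space_iff_ennreal) (use S in auto)
    note [measurable] = measurable_fill_simplex[OF S(1)] measurable_dirichlet_density[OF S(1)] g
      measurable_compose[OF measurable_fill_simplex[OF S(1)] g]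
    show ?thesis
      by (subst nn_integral_dirichlet[OF S f], rule nn_integral_cmult) measurable
  qed
  finally show ?thesis by (simp add: \<Theta>_def)
qed

section \<open>Beliefs and their conjugacy\<close>

definition model_space :: "'s set \<Rightarrow> 'a set \<Rightarrow> ('s, 'a) model measure" where
  "model_space S A = PiM (S \<times> A) (\<lambda>_. restrict_space (PiM S (\<lambda>_. borel)) (prob_simplex S))"

definition predictive :: "'s set \<Rightarrow> ('s, 'a) params \<Rightarrow> 's \<Rightarrow> 'a \<Rightarrow> 's \<Rightarrow> real" where
  "predictive S \<theta> s a s' = \<theta> (s, a) s' / (\<Sum>s''\<in>S. \<theta> (s, a) s'')"

lemma sets_fdm [measurable_cong]: "sets (fdm S A \<theta>) = sets (model_space S A)"
  unfolding fdm_def model_space_def by (intro sets_PiM_cong refl sets_dirichlet)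

lemma space_fdm: "space (fdm S A \<theta>) = space (model_space S A)"
  by (rule sets_eq_imp_space_eq[OF sets_fdm])

lemma space_model_space: "space (model_space S A) = S \<times> A \<rightarrow>\<^sub>E prob_simplex S"
  by (auto simp: model_space_def space_PiM space_restrict_space prob_simplex_def PiE_iff extensional_def)

lemma measurable_model_entry:
  assumes "s \<in> S" "a \<in> A" "s' \<in> S"
  shows "(\<lambda>\<mu>. \<mu> (s, a) s') \<in> borel_measurable (model_space S A)"
proof -
  have "(\<lambda>\<mu>. \<mu> (s, a)) \<in> model_space S A \<rightarrow>\<^sub>M restrict_space (PiM S (\<lambda>_. borel :: real measure)) (prob_simplex S)"
    unfolding model_space_def using assms by (intro measurable_component_singleton) auto
  from measurable_compose[OF this measurable_restrict_space1[OF measurable_component_singleton[OF assms(3)]]]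
  show ?thesis .
qed

definition positive_params :: "'s set \<Rightarrow> 'a set \<Rightarrow> ('s, 'a) params \<Rightarrow> bool" where
  "positive_params S A \<theta> \<longleftrightarrow> (\<forall>s\<in>S. \<forall>a\<in>A. \<forall>s'\<in>S. 0 < \<theta> (s, a) s')"

locale finite_decision_problem =
  fixes S :: "'s set" and A :: "'a set"
  assumes finite_S: "finite S" and S_nonempty: "S \<noteq> {}"
    and finite_A: "finite A" and A_nonempty: "A \<noteq> {}"
begin

lemma positive_params_bayes_update:
  "positive_params S A \<theta> \<Longrightarrow> positive_params S A (bayes_update \<theta> s a s')"
  by (auto simp: positive_params_def bayes_update_def add_pos_pos)

lemma sum_params_pos:
  "positive_params S A \<theta> \<Longrightarrow> s \<in> S \<Longrightarrow> a \<in> A \<Longrightarrow> 0 < (\<Sum>s'\<in>S. \<theta> (s, a) s')"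
  using finite_S S_nonempty by (intro sum_pos) (auto simp: positive_params_def)

lemma predictive_nonneg:
  "positive_params S A \<theta> \<Longrightarrow> s \<in> S \<Longrightarrow> a \<in> A \<Longrightarrow> s' \<in> S \<Longrightarrow> 0 \<le> predictive S \<theta> s a s'"
  unfolding predictive_def using sum_params_pos[of \<theta> s a]
  by (intro divide_nonneg_nonneg) (auto simp: positive_params_def intro: less_imp_le)

lemma sum_predictive:
  "positive_params S A \<theta> \<Longrightarrow> s \<in> S \<Longrightarrow> a \<in> A \<Longrightarrow> (\<Sum>s'\<in>S. predictive S \<theta> s a s') = 1"
  unfolding predictive_def using sum_params_pos[of \<theta> s a]
  by (simp add: sum_divide_distrib[symmetric])

text \<open>
  Off \<open>S \<times> A\<close> the parameters are unconstrained; replacing them there by \<open>1\<close> makes every factor of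
  the product a probability space.
\<close>

lemma fdm_product:
  assumes "positive_params S A \<theta>"
  obtains D where "\<And>i. prob_space (D i)"
    "\<And>i. i \<in> S \<times> A \<Longrightarrow> D i = dirichlet S (\<theta> i)" "fdm S A \<theta> = PiM (S \<times> A) D"
proof
  let ?D = "\<lambda>i. dirichlet S (if i \<in> S \<times> A then \<theta> i else (\<lambda>_. 1))"
  show "prob_space (?D i)" for i
    by (rule prob_space_dirichlet) (use assms finite_S S_nonempty in \<open>auto simp: positive_params_def\<close>)
  show "fdm S A \<theta> = PiM (S \<times> A) ?D"
    unfolding fdm_def by (rule PiM_cong) auto
qed simp

lemma prob_space_fdm:
  assumes "positive_params S A \<theta>"
  shows "prob_space (fdm S A \<theta>)"
proof -
  obtain D where "\<And>i. prob_space (D i)" "fdm S A \<theta> = PiM (S \<times> A) D"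
    using fdm_product[OF assms] by metis
  then show ?thesis
    by (metis prob_space_PiM)
qed

text \<open>Bayes' rule for the whole belief: likelihood times prior is predictive probability times
  posterior. A transition involves a single factor of the product, so Fubini isolates that factor
  and \<open>dirichlet_conjugate\<close> replaces it; all other factors are the same in both
  products.\<close>

lemma nn_integral_fdm_conjugate:
  assumes \<theta>: "positive_params S A \<theta>" and s: "s \<in> S" "a \<in> A" "s' \<in> S"
    and f: "f \<in> borel_measurable (model_space S A)"
  shows "(\<integral>\<^sup>+\<mu>. ennreal (\<mu> (s, a) s') * f \<mu> \<partial>fdm S A \<theta>) =
    ennreal (predictive S \<theta> s a s') * (\<integral>\<^sup>+\<mu>. f \<mu> \<partial>fdm S A (bayes_update \<theta> s a s'))"
proof -
  let ?I = "S \<times> A - {(s, a)}" and ?\<theta>' = "bayes_update \<theta> s a s'"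
  have I: "S \<times> A = insert (s, a) ?I" and fin: "finite ?I"
    using s finite_S finite_A by auto
  obtain D where D: "\<And>i. prob_space (D i)" "\<And>i. i \<in> S \<times> A \<Longrightarrow> D i = dirichlet S (\<theta> i)"
      "fdm S A \<theta> = PiM (S \<times> A) D"
    using fdm_product[OF \<theta>] by metis
  obtain D' where D': "\<And>i. prob_space (D' i)" "\<And>i. i \<in> S \<times> A \<Longrightarrow> D' i = dirichlet S (?\<theta>' i)"
      "fdm S A ?\<theta>' = PiM (S \<times> A) D'"
    using fdm_product[OF positive_params_bayes_update[OF \<theta>]] by metis
  interpret D: product_sigma_finite D
    by (rule product_sigma_finite.intro) (rule prob_space_imp_sigma_finite[OF D(1)])
  interpret D': product_sigma_finite D'
    by (rule product_sigma_finite.intro) (rule prob_space_imp_sigma_finite[OF D'(1)])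
  have m[measurable]: "(\<lambda>\<mu>. ennreal (\<mu> (s, a) s')) \<in> borel_measurable (model_space S A)"
    using measurable_model_entry[OF s] by measurable
  note f[measurable]
  have mf: "(\<lambda>\<mu>. ennreal (\<mu> (s, a) s') * f \<mu>) \<in> borel_measurable (model_space S A)"
    by measurable
  have sets_D: "sets (PiM (S \<times> A) D) = sets (model_space S A)"
    using sets_fdm[of S A \<theta>] D(3) by simp
  have sets_D': "sets (PiM (S \<times> A) D') = sets (model_space S A)"
    using sets_fdm[of S A ?\<theta>'] D'(3) by simp
  have eqI: "PiM ?I D = PiM ?I D'"
    by (rule PiM_cong) (auto simp: D D' bayes_update_def)
  have upd: "?\<theta>' (s, a) = (\<theta> (s, a))(s' := \<theta> (s, a) s' + 1)"
    by (simp add: bayes_update_def)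
  have fm: "(\<lambda>p. f (\<mu>((s, a) := p))) \<in> borel_measurable (restrict_space (PiM S (\<lambda>_. borel)) (prob_simplex S))"
    if "\<mu> \<in> space (PiM ?I D)" for \<mu>
  proof -
    have "(\<lambda>p. f (\<mu>((s, a) := p))) \<in> borel_measurable (D (s, a))"
      using that
      by (intro measurable_compose[OF measurable_component_update[of \<mu> ?I D "(s, a)"]])
         (use s in \<open>auto simp: insert_absorb measurable_cong_sets[OF sets_D refl] f\<close>)
    then show ?thesis
      using s by (simp add: D measurable_cong_sets[OF sets_dirichlet refl])
  qed
  have "(\<integral>\<^sup>+\<mu>. ennreal (\<mu> (s, a) s') * f \<mu> \<partial>fdm S A \<theta>) =
      (\<integral>\<^sup>+\<mu>. (\<integral>\<^sup>+p. ennreal (p s') * f (\<mu>((s, a) := p)) \<partial>dirichlet S (\<theta> (s, a))) \<partial>PiM ?I D)"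
    unfolding D(3) using s
    by (subst I, subst D.product_nn_integral_insert[OF fin])
       (auto simp: insert_absorb measurable_cong_sets[OF sets_D refl] D mf)
  also have "\<dots> = (\<integral>\<^sup>+\<mu>. ennreal (predictive S \<theta> s a s') *
      (\<integral>\<^sup>+p. f (\<mu>((s, a) := p)) \<partial>dirichlet S (?\<theta>' (s, a))) \<partial>PiM ?I D)"
    unfolding predictive_def upd using s \<theta> finite_S S_nonempty
    by (intro nn_integral_cong dirichlet_conjugate fm) (auto simp: positive_params_def)
  also have "\<dots> = ennreal (predictive S \<theta> s a s') *
      (\<integral>\<^sup>+\<mu>. (\<integral>\<^sup>+p. f (\<mu>((s, a) := p)) \<partial>dirichlet S (?\<theta>' (s, a))) \<partial>PiM ?I D)"
  proof (rule nn_integral_cmult)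
    have "(\<lambda>(\<mu>, p). f (\<mu>((s, a) := p))) \<in> borel_measurable (PiM ?I D' \<Otimes>\<^sub>M D' (s, a))"
      using measurable_compose[OF measurable_add_dim[of "(s, a)" ?I D'], of f borel] f
      s by (simp add: insert_absorb measurable_cong_sets[OF sets_D' refl] split_beta')
    from sigma_finite_measure.borel_measurable_nn_integral[OF prob_space_imp_sigma_finite[OF D'(1)] this]
    show "(\<lambda>\<mu>. \<integral>\<^sup>+p. f (\<mu>((s, a) := p)) \<partial>dirichlet S (?\<theta>' (s, a))) \<in> borel_measurable (PiM ?I D)"
      unfolding eqI using s by (simp add: D')
  qed
  also have "(\<integral>\<^sup>+\<mu>. (\<integral>\<^sup>+p. f (\<mu>((s, a) := p)) \<partial>dirichlet S (?\<theta>' (s, a))) \<partial>PiM ?I D) =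
      (\<integral>\<^sup>+\<mu>. f \<mu> \<partial>fdm S A ?\<theta>')"
    unfolding D'(3) eqI using s
    by (subst (2) I, subst D'.product_nn_integral_insert[OF fin])
       (auto simp: insert_absorb measurable_cong_sets[OF sets_D' refl] D' f)
  finally show ?thesis .
qed

lemma integral_fdm_conjugate:
  fixes f :: "('s, 'a) model \<Rightarrow> real"
  assumes \<theta>: "positive_params S A \<theta>" and s: "s \<in> S" "a \<in> A" "s' \<in> S"
    and f: "f \<in> borel_measurable (model_space S A)"
  shows "(\<integral>\<mu>. \<mu> (s, a) s' * f \<mu> \<partial>fdm S A \<theta>) =
    predictive S \<theta> s a s' * (\<integral>\<mu>. f \<mu> \<partial>fdm S A (bayes_update \<theta> s a s'))"
proof -
  let ?\<theta>' = "bayes_update \<theta> s a s'"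
  note [measurable] = measurable_model_entry[OF s] f
  \<comment> \<open>Applied to indicators, the nonnegative version is an equality of two measures.
    It transfers to Bochner integrals of either sign without any integrability assumption on
    f.\<close>
  have "density (fdm S A \<theta>) (\<lambda>\<mu>. ennreal (\<mu> (s, a) s')) =
      density (fdm S A ?\<theta>') (\<lambda>_. ennreal (predictive S \<theta> s a s'))"
  proof (rule measure_eqI)
    fix X assume "X \<in> sets (density (fdm S A \<theta>) (\<lambda>\<mu>. ennreal (\<mu> (s, a) s')))"
    then have [measurable]: "X \<in> sets (model_space S A)"
      by (simp add: sets_fdm)
    show "emeasure (density (fdm S A \<theta>) (\<lambda>\<mu>. ennreal (\<mu> (s, a) s'))) X =
      emeasure (density (fdm S A ?\<theta>') (\<lambda>_. ennreal (predictive S \<theta> s a s'))) X"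
      by (subst (1 2) emeasure_density)
         (auto simp: nn_integral_fdm_conjugate[OF \<theta> s] nn_integral_cmult sets_fdm)
  qed (simp add: sets_fdm)
  then have "(\<integral>\<mu>. f \<mu> \<partial>density (fdm S A \<theta>) (\<lambda>\<mu>. ennreal (\<mu> (s, a) s'))) =
     (\<integral>\<mu>. f \<mu> \<partial>density (fdm S A ?\<theta>') (\<lambda>_. ennreal (predictive S \<theta> s a s')))"
    by simp
  also have "(\<integral>\<mu>. f \<mu> \<partial>density (fdm S A \<theta>) (\<lambda>\<mu>. ennreal (\<mu> (s, a) s'))) =
     (\<integral>\<mu>. \<mu> (s, a) s' * f \<mu> \<partial>fdm S A \<theta>)"
    using s by (subst integral_density) (auto simp: space_fdm space_model_space prob_simplex_def PiE_iff)
  also have "(\<integral>\<mu>. f \<mu> \<partial>density (fdm S A ?\<theta>') (\<lambda>_. ennreal (predictive S \<theta> s a s'))) =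
     predictive S \<theta> s a s' * (\<integral>\<mu>. f \<mu> \<partial>fdm S A ?\<theta>')"
    using predictive_nonneg[OF \<theta> s] by (subst integral_density) auto
  finally show ?thesis .
qed

end

section \<open>Expectations along trajectories\<close>

text \<open>Unrolled from the first step, with policy and functional shifted by the state left
  behind, because conjugacy and the Bellman equation act on the first transition.\<close>

primrec model_expect ::
  "'s set \<Rightarrow> nat \<Rightarrow> ('s, 'a) model \<Rightarrow> ('s, 'a) policy \<Rightarrow> 's \<Rightarrow> ('s list \<Rightarrow> real) \<Rightarrow> real"
where
  "model_expect S 0 \<mu> \<pi> s f = f [s]"
| "model_expect S (Suc n) \<mu> \<pi> s f =
     (\<Sum>s'\<in>S. \<mu> (s, \<pi> [s]) s' * model_expect S n \<mu> (\<lambda>h. \<pi> (s # h)) s' (\<lambda>h. f (s # h)))"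

lemma model_expect_cong:
  assumes "s \<in> S" "\<And>h. set h \<subseteq> S \<Longrightarrow> h \<noteq> [] \<Longrightarrow> f h = g h"
  shows "model_expect S n \<mu> \<pi> s f = model_expect S n \<mu> \<pi> s g"
  using assms
proof (induction n arbitrary: \<pi> s f g)
  case (Suc n)
  show ?case
    unfolding model_expect.simps using Suc.prems(1)
    by (intro sum.cong refl arg_cong[where f = "\<lambda>x. _ * x"] Suc.IH Suc.prems(2)) auto
qed simp

text \<open>Unrolling at the last step instead matches the kernels of Ionescu Tulcea, which extend a
  history by one state.\<close>

lemma model_expect_Suc_end:
  "model_expect S (Suc n) \<mu> \<pi> s f =
     model_expect S n \<mu> \<pi> s (\<lambda>h. \<Sum>s'\<in>S. \<mu> (last h, \<pi> h) s' * f (h @ [s']))"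
proof (induction n arbitrary: \<pi> s f)
  case (Suc n)
  have "model_expect S (Suc (Suc n)) \<mu> \<pi> s f =
     (\<Sum>s'\<in>S. \<mu> (s, \<pi> [s]) s' * model_expect S n \<mu> (\<lambda>h. \<pi> (s # h)) s'
        (\<lambda>h. \<Sum>s''\<in>S. \<mu> (last h, \<pi> (s # h)) s'' * f (s # h @ [s''])))"
    unfolding model_expect.simps(2)[of S "Suc n"] Suc.IH ..
  also have "\<dots> = (\<Sum>s'\<in>S. \<mu> (s, \<pi> [s]) s' * model_expect S n \<mu> (\<lambda>h. \<pi> (s # h)) s'
        (\<lambda>h. \<Sum>s''\<in>S. \<mu> (last (s # h), \<pi> (s # h)) s'' * f (s # h @ [s''])))"
    by (intro sum.cong refl arg_cong[where f = "\<lambda>x. _ * x"] model_expect_cong) auto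
  finally show ?case by simp
qed simp

text \<open>Unlike in \<open>policies\<close>, nothing is required at the empty history, where a
  BOLT policy depends on \<open>last []\<close>. Shifted and continued policies stay in this
  class.\<close>

definition admissible :: "'s set \<Rightarrow> 'a set \<Rightarrow> ('s, 'a) policy \<Rightarrow> bool" where
  "admissible S A \<pi> \<longleftrightarrow> (\<forall>h. h \<noteq> [] \<longrightarrow> set h \<subseteq> S \<longrightarrow> \<pi> h \<in> A)"

lemma admissible_policies: "\<pi> \<in> policies S A \<Longrightarrow> admissible S A \<pi>"
  by (auto simp: policies_def admissible_def)

lemma admissible_shift: "admissible S A \<pi> \<Longrightarrow> s \<in> S \<Longrightarrow> admissible S A (\<lambda>h. \<pi> (s # h))"
  by (auto simp: admissible_def)

lemma admissibleD: "admissible S A \<pi> \<Longrightarrow> h \<noteq> [] \<Longrightarrow> set h \<subseteq> S \<Longrightarrow> \<pi> h \<in> A"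
  by (auto simp: admissible_def)

locale model_policy = finite_decision_problem S A
  for S :: "'s set" and A :: "'a set" +
  fixes \<mu> :: "('s, 'a) model" and \<pi> :: "('s, 'a) policy" and s :: 's
  assumes model: "\<mu> \<in> space (model_space S A)" and policy: "admissible S A \<pi>" and state: "s \<in> S"
begin

lemma model_nonneg: "x \<in> S \<Longrightarrow> a \<in> A \<Longrightarrow> y \<in> S \<Longrightarrow> 0 \<le> \<mu> (x, a) y"
  and sum_model: "x \<in> S \<Longrightarrow> a \<in> A \<Longrightarrow> (\<Sum>y\<in>S. \<mu> (x, a) y) = 1"
  using model by (auto simp: space_model_space PiE_iff prob_simplex_def)

text \<open>Finite products of the finite discrete state space are again discrete, which disposes of
  measurability in all finite-dimensional steps.\<close>

lemma PiM_states: "finite J \<Longrightarrow> PiM J (\<lambda>_. count_space S) = count_space (J \<rightarrow>\<^sub>E S)"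
  using finite_S by (intro count_space_PiM_finite) (auto intro: countable_finite)

lemma history_states: "\<omega> \<in> {0..<Suc n} \<rightarrow>\<^sub>E S \<Longrightarrow> set (history \<omega> n) \<subseteq> S"
  by (auto simp: PiE_iff simp del: upt_Suc)

lemma prob_space_next_state:
  assumes "\<omega> \<in> {0..<n} \<rightarrow>\<^sub>E S"
  shows "prob_space (next_state S \<mu> \<pi> s n \<omega>)"
proof (cases n)
  case 0
  then show ?thesis
    using state by (auto simp: next_state_def intro: prob_space_return)
next
  case (Suc t)
  have a: "\<omega> t \<in> S" "\<pi> (history \<omega> t) \<in> A"
    using assms Suc history_states[of \<omega> t] admissibleD[OF policy, of "history \<omega> t"] by (auto simp: PiE_iff)
  have "emeasure (point_measure S (\<lambda>s'. ennreal (\<mu> (\<omega> t, \<pi> (history \<omega> t)) s'))) S =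
      (\<Sum>s'\<in>S. ennreal (\<mu> (\<omega> t, \<pi> (history \<omega> t)) s'))"
    using finite_S by (simp add: emeasure_point_measure_finite)
  also have "\<dots> = 1"
    using a by (subst sum_ennreal) (auto simp: model_nonneg sum_model)
  finally show ?thesis
    unfolding Suc next_state_def by (intro prob_spaceI) (simp add: space_point_measure)
qed

sublocale IT: Ionescu_Tulcea "next_state S \<mu> \<pi> s" "\<lambda>_. count_space S"
proof (rule Ionescu_Tulcea.intro)
  have prob: "prob_space (next_state S \<mu> \<pi> s n \<omega>)"
    if "\<omega> \<in> space (PiM {0..<n} (\<lambda>_. count_space S))" for n \<omega>
    using that by (intro prob_space_next_state) (simp add: PiM_states)
  then show "\<And>n \<omega>. \<omega> \<in> space (PiM {0..<n} (\<lambda>_. count_space S)) \<Longrightarrow> prob_space (next_state S \<mu> \<pi> s n \<omega>)" .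
  fix n
  have "sets (next_state S \<mu> \<pi> s n \<omega>) = sets (count_space S)" for \<omega>
    by (cases n) (simp_all add: next_state_def sets_point_measure)
  then show "next_state S \<mu> \<pi> s n \<in> PiM {0..<n} (\<lambda>_. count_space S) \<rightarrow>\<^sub>M subprob_algebra (count_space S)"
    using prob by (auto simp: PiM_states space_subprob_algebra prob_space_imp_subprob_space)
qed

lemma trajectories_eq: "trajectories S \<mu> \<pi> s = IT.PF.lim"
  by (simp add: trajectories_def)

lemma prob_space_trajectories: "prob_space (trajectories S \<mu> \<pi> s)"
  unfolding trajectories_eq
proof
  \<comment> \<open>The whole space is the cylinder over the empty index set, so its mass is that of
    the trivial marginal.\<close>
  have "emeasure IT.PF.lim (space IT.PF.lim) = emeasure IT.PF.lim (IT.PF.emb UNIV {} {\<lambda>_. undefined})"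
    by (auto simp: prod_emb_def space_PiM restrict_def intro!: arg_cong2[where f = emeasure])
  also have "\<dots> = emeasure (IT.CI {}) {\<lambda>_. undefined}"
    by (rule IT.lim) (auto simp: PiM_empty)
  also have "\<dots> = emeasure (IT.CI {}) (space (IT.CI {}))"
    by (simp add: IT.CI_def space_PiM)
  also have "\<dots> = 1"
    using IT.PF.prob_space_P[of "{}"] by (simp add: prob_space.emeasure_space_1)
  finally show "emeasure IT.PF.lim (space IT.PF.lim) = 1" .
qed

lemma nn_integral_finite_trajectory:
  assumes "\<And>h. h \<noteq> [] \<Longrightarrow> set h \<subseteq> S \<Longrightarrow> 0 \<le> f h"
  shows "(\<integral>\<^sup>+\<omega>. ennreal (f (history \<omega> n)) \<partial>IT.C 0 (Suc n) (\<lambda>_. undefined)) = ennreal (model_expect S n \<mu> \<pi> s f)"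
  using assms
proof (induction n arbitrary: f)
  case 0
  have u: "(\<lambda>_. undefined) \<in> space (PiM {0..<0::nat} (\<lambda>_. count_space S))"
    by (auto simp: space_PiM)
  have m: "(\<lambda>\<omega>. ennreal (f (history \<omega> 0))) \<in> borel_measurable (PiM {0..<Suc 0} (\<lambda>_. count_space S))"
    by (subst PiM_states) auto
  have "(\<integral>\<^sup>+\<omega>. ennreal (f (history \<omega> 0)) \<partial>IT.C 0 (Suc 0) (\<lambda>_. undefined)) =
    (\<integral>\<^sup>+\<omega>. ennreal (f (history \<omega> 0)) \<partial>IT.eP 0 (\<lambda>_. undefined))"
    using u IT.measurable_eP[of 0] by (simp add: bind_return[where N = "PiM {0..<Suc 0} (\<lambda>_. count_space S)"])
  also have "\<dots> = ennreal (f [s])"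
    using u m state by (subst IT.nn_integral_eP) (auto simp: next_state_def nn_integral_return)
  finally show ?case by simp
next
  case (Suc n)
  let ?M = "\<lambda>n. PiM {0..<n::nat} (\<lambda>_. count_space S)"
  have u: "(\<lambda>_. undefined) \<in> space (?M 0)"
    by (auto simp: space_PiM)
  have m: "g \<in> borel_measurable (?M k)" for g :: "_ \<Rightarrow> ennreal" and k
    by (subst PiM_states) auto
  let ?f' = "\<lambda>h. \<Sum>s'\<in>S. \<mu> (last h, \<pi> h) s' * f (h @ [s'])"
  have "(\<integral>\<^sup>+\<omega>. ennreal (f (history \<omega> (Suc n))) \<partial>IT.C 0 (Suc (Suc n)) (\<lambda>_. undefined)) =
    (\<integral>\<^sup>+\<omega>. (\<integral>\<^sup>+\<omega>'. ennreal (f (history \<omega>' (Suc n))) \<partial>IT.eP (Suc n) \<omega>) \<partial>IT.C 0 (Suc n) (\<lambda>_. undefined))"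
    using IT.measurable_eP[of "Suc n"] IT.sets_C[OF u, of "Suc n"] m[of _ "Suc (Suc n)"]
    by (subst IT.C.simps(2), subst nn_integral_bind[where B = "?M (Suc (Suc n))"])
       (auto simp: measurable_cong_sets[OF IT.sets_C[OF u, of "Suc n"] refl] simp del: upt_Suc IT.C.simps)
  also have "\<dots> = (\<integral>\<^sup>+\<omega>. ennreal (?f' (history \<omega> n)) \<partial>IT.C 0 (Suc n) (\<lambda>_. undefined))"
  proof (rule nn_integral_cong)
    fix \<omega> assume "\<omega> \<in> space (IT.C 0 (Suc n) (\<lambda>_. undefined))"
    then have \<omega>: "\<omega> \<in> space (?M (Suc n))" and \<omega>': "\<omega> \<in> {0..<Suc n} \<rightarrow>\<^sub>E S"
      using IT.space_C[OF u, of "Suc n"] PiM_states[of "{0..<Suc n}"] by (auto simp del: IT.C.simps)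
    have h: "set (history \<omega> n) \<subseteq> S" "\<omega> n \<in> S" "\<pi> (history \<omega> n) \<in> A"
      using \<omega>' history_states[OF \<omega>'] admissibleD[OF policy, of "history \<omega> n"] by (auto simp: PiE_iff)
    have upd: "history (fun_upd \<omega> (Suc n) x) (Suc n) = history \<omega> n @ [x]" for x
      by (auto intro!: map_cong)
    have "(\<integral>\<^sup>+\<omega>'. ennreal (f (history \<omega>' (Suc n))) \<partial>IT.eP (Suc n) \<omega>) =
      (\<integral>\<^sup>+x. ennreal (f (history \<omega> n @ [x])) \<partial>next_state S \<mu> \<pi> s (Suc n) \<omega>)"
      using m by (subst IT.nn_integral_eP[OF \<omega>]) (auto simp only: upd)
    also have "\<dots> = (\<Sum>x\<in>S. ennreal (\<mu> (\<omega> n, \<pi> (history \<omega> n)) x) * ennreal (f (history \<omega> n @ [x])))"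
      using finite_S by (simp add: next_state_def nn_integral_point_measure_finite mult.commute del: upt_Suc)
    also have "\<dots> = (\<Sum>x\<in>S. ennreal (\<mu> (\<omega> n, \<pi> (history \<omega> n)) x * f (history \<omega> n @ [x])))"
      using h Suc.prems by (intro sum.cong refl ennreal_mult[symmetric] model_nonneg) auto
    also have "\<dots> = ennreal (?f' (history \<omega> n))"
      using h Suc.prems by (subst sum_ennreal) (auto intro!: mult_nonneg_nonneg model_nonneg)
    finally show "(\<integral>\<^sup>+\<omega>'. ennreal (f (history \<omega>' (Suc n))) \<partial>IT.eP (Suc n) \<omega>) = ennreal (?f' (history \<omega> n))" .
  qed
  also have "\<dots> = ennreal (model_expect S n \<mu> \<pi> s ?f')"
    using Suc.prems
    by (intro Suc.IH sum_nonneg mult_nonneg_nonneg model_nonneg)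
       (auto intro: admissibleD[OF policy] last_in_set subsetD)
  finally show ?case
    by (simp add: model_expect_Suc_end del: model_expect.simps)
qed

lemma space_trajectories: "space (trajectories S \<mu> \<pi> s) = UNIV \<rightarrow>\<^sub>E S"
  by (simp add: trajectories_eq space_PiM)

lemma sets_trajectories: "sets (trajectories S \<mu> \<pi> s) = sets (PiM UNIV (\<lambda>_. count_space S))"
  by (simp add: trajectories_eq)

text \<open>A history up to time n depends only on the first \<open>Suc n\<close> coordinates, and
  the marginal of the limit measure on that initial segment is the composed kernel, for which the
  expectation is known.\<close>

lemma nn_integral_trajectories:
  assumes "\<And>h. h \<noteq> [] \<Longrightarrow> set h \<subseteq> S \<Longrightarrow> 0 \<le> f h"
  shows "(\<integral>\<^sup>+\<omega>. ennreal (f (history \<omega> n)) \<partial>trajectories S \<mu> \<pi> s) = ennreal (model_expect S n \<mu> \<pi> s f)"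
proof -
  let ?J = "{0..<Suc n}"
  have u: "(\<lambda>_. undefined) \<in> space (PiM {0..<0::nat} (\<lambda>_. count_space S))"
    by (auto simp: space_PiM)
  have m: "g \<in> borel_measurable (PiM ?J (\<lambda>_. count_space S))" for g :: "_ \<Rightarrow> ennreal"
    by (subst PiM_states) auto
  have CI: "IT.CI ?J = IT.C 0 (Suc n) (\<lambda>_. undefined)"
  proof (rule measure_eqI)
    fix X assume "X \<in> sets (IT.CI ?J)"
    then have X: "X \<in> sets (PiM ?J (\<lambda>_. count_space S))" by (simp add: IT.CI_def)
    show "emeasure (IT.CI ?J) X = emeasure (IT.C 0 (Suc n) (\<lambda>_. undefined)) X"
      using X sets.sets_into_space[OF X]
      by (subst IT.emeasure_CI[of _ "Suc n"])
         (auto simp: prod_emb_id space_PiM simp del: IT.C.simps)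
  qed (use IT.sets_C[OF u, of "Suc n"] in \<open>simp add: IT.CI_def del: IT.C.simps\<close>)
  have hist: "history (restrict \<omega> ?J) n = history \<omega> n" for \<omega> :: "nat \<Rightarrow> 's"
    by auto
  have "ennreal (model_expect S n \<mu> \<pi> s f) =
      (\<integral>\<^sup>+\<omega>. ennreal (f (history \<omega> n)) \<partial>distr IT.PF.lim (PiM ?J (\<lambda>_. count_space S)) (\<lambda>\<omega>. restrict \<omega> ?J))"
    by (subst IT.distr_lim, simp, subst CI, subst nn_integral_finite_trajectory[OF assms]) auto
  also have "\<dots> = (\<integral>\<^sup>+\<omega>. ennreal (f (history (restrict \<omega> ?J) n)) \<partial>IT.PF.lim)"
    by (rule nn_integral_distr)
       (auto simp: measurable_cong_sets[OF IT.PF.sets_lim refl] simp del: upt_Suc intro!: measurable_restrict m)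
  finally show ?thesis
    by (simp only: hist trajectories_eq)
qed

end

section \<open>Dependence on the model and integration over the prior\<close>

context finite_decision_problem
begin

lemma model_policyI:
  "\<mu> \<in> space (model_space S A) \<Longrightarrow> admissible S A \<pi> \<Longrightarrow> s \<in> S \<Longrightarrow> model_policy S A \<mu> \<pi> s"
  by unfold_locales

lemma measurable_model_expect:
  assumes "admissible S A \<pi>" "s \<in> S"
  shows "(\<lambda>\<mu>. model_expect S n \<mu> \<pi> s f) \<in> borel_measurable (model_space S A)"
  using assms
proof (induction n arbitrary: \<pi> s f)
  case (Suc n)
  then show ?case
    using admissibleD[OF Suc.prems(1), of "[s]"]
    by (auto intro!: borel_measurable_sum borel_measurable_times measurable_model_entry Suc.IH admissible_shift)
qed simp

lemma model_entry_bounds: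
  assumes "\<mu> \<in> space (model_space S A)" "x \<in> S" "a \<in> A" "y \<in> S"
  shows "0 \<le> \<mu> (x, a) y" "\<mu> (x, a) y \<le> 1"
proof -
  have p: "\<mu> (x, a) \<in> prob_simplex S"
    using assms by (auto simp: space_model_space)
  then show "0 \<le> \<mu> (x, a) y"
    using assms by (auto simp: prob_simplex_def)
  have "\<mu> (x, a) y \<le> (\<Sum>y\<in>S. \<mu> (x, a) y)"
    using p assms finite_S by (intro member_le_sum) (auto simp: prob_simplex_def)
  then show "\<mu> (x, a) y \<le> 1"
    using p by (simp add: prob_simplex_def)
qed

lemma model_expect_nonneg:
  assumes "\<mu> \<in> space (model_space S A)" "admissible S A \<pi>" "s \<in> S"
    and "\<And>h. h \<noteq> [] \<Longrightarrow> set h \<subseteq> S \<Longrightarrow> 0 \<le> f h"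
  shows "0 \<le> model_expect S n \<mu> \<pi> s f"
  using assms
proof (induction n arbitrary: \<pi> s f)
  case (Suc n)
  have a: "\<pi> [s] \<in> A"
    using admissibleD[OF Suc.prems(2), of "[s]"] Suc.prems(3) by simp
  have "0 \<le> model_expect S n \<mu> (\<lambda>h. \<pi> (s # h)) s' (\<lambda>h. f (s # h))" if "s' \<in> S" for s'
    using Suc.prems that by (intro Suc.IH admissible_shift) auto
  then show ?case
    using a Suc.prems by (auto intro!: sum_nonneg mult_nonneg_nonneg simp: model_entry_bounds)
qed auto

text \<open>The bound is uniform in the model, which gives integrability over any belief for an
  arbitrary functional f: only finitely many histories are involved.\<close>

lemma model_expect_bounded:
  assumes "admissible S A \<pi>" "s \<in> S"
  shows "\<exists>B. \<forall>\<mu>\<in>space (model_space S A). \<bar>model_expect S n \<mu> \<pi> s f\<bar> \<le> B"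
  using assms
proof (induction n arbitrary: \<pi> s f)
  case (Suc n)
  let ?F = "\<lambda>\<mu> s'. model_expect S n \<mu> (\<lambda>h. \<pi> (s # h)) s' (\<lambda>h. f (s # h))"
  have "\<forall>s'\<in>S. \<exists>B. \<forall>\<mu>\<in>space (model_space S A). \<bar>?F \<mu> s'\<bar> \<le> B"
    using Suc.prems by (intro ballI Suc.IH admissible_shift)
  then obtain B where B: "\<And>s' \<mu>. s' \<in> S \<Longrightarrow> \<mu> \<in> space (model_space S A) \<Longrightarrow> \<bar>?F \<mu> s'\<bar> \<le> B s'"
    by metis
  have a: "\<pi> [s] \<in> A"
    using admissibleD[OF Suc.prems(1), of "[s]"] Suc.prems(2) by simp
  have "\<bar>model_expect S (Suc n) \<mu> \<pi> s f\<bar> \<le> (\<Sum>s'\<in>S. B s')" if \<mu>: "\<mu> \<in> space (model_space S A)" for \<mu>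
  proof -
    have "\<bar>model_expect S (Suc n) \<mu> \<pi> s f\<bar> \<le> (\<Sum>s'\<in>S. \<bar>\<mu> (s, \<pi> [s]) s' * ?F \<mu> s'\<bar>)"
      by (simp add: sum_abs)
    also have "\<dots> \<le> (\<Sum>s'\<in>S. B s')"
    proof (rule sum_mono)
      fix s' assume s': "s' \<in> S"
      have "\<bar>\<mu> (s, \<pi> [s]) s'\<bar> * \<bar>?F \<mu> s'\<bar> \<le> 1 * B s'"
        using model_entry_bounds[OF \<mu> Suc.prems(2) a s'] B[OF s' \<mu>] by (intro mult_mono) auto
      then show "\<bar>\<mu> (s, \<pi> [s]) s' * ?F \<mu> s'\<bar> \<le> B s'" by (simp add: abs_mult)
    qed
    finally show ?thesis .
  qed
  then show ?case by blast
qed auto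

text \<open>The state process with the model integrated out, in the manner of a Polya urn: each
  transition is drawn from the predictive probabilities and then counted.\<close>

primrec bayes_expect ::
  "nat \<Rightarrow> ('s, 'a) params \<Rightarrow> ('s, 'a) policy \<Rightarrow> 's \<Rightarrow> ('s list \<Rightarrow> real) \<Rightarrow> real"
where
  "bayes_expect 0 \<theta> \<pi> s f = f [s]"
| "bayes_expect (Suc n) \<theta> \<pi> s f =
     (\<Sum>s'\<in>S. predictive S \<theta> s (\<pi> [s]) s' *
        bayes_expect n (bayes_update \<theta> s (\<pi> [s]) s') (\<lambda>h. \<pi> (s # h)) s' (\<lambda>h. f (s # h)))"

text \<open>Conjugacy moves the entry of the first transition out of the integral, and what is left
  is the same problem for the updated belief.\<close>

lemma integral_model_expect:
  assumes "positive_params S A \<theta>" "admissible S A \<pi>" "s \<in> S"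
  shows "(\<integral>\<mu>. model_expect S n \<mu> \<pi> s f \<partial>fdm S A \<theta>) = bayes_expect n \<theta> \<pi> s f"
  using assms
proof (induction n arbitrary: \<theta> \<pi> s f)
  case 0
  interpret prob_space "fdm S A \<theta>" by (rule prob_space_fdm[OF 0(1)])
  show ?case by (simp add: prob_space)
next
  case (Suc n)
  interpret prob_space "fdm S A \<theta>" by (rule prob_space_fdm[OF Suc.prems(1)])
  let ?F = "\<lambda>s' \<mu>. model_expect S n \<mu> (\<lambda>h. \<pi> (s # h)) s' (\<lambda>h. f (s # h))"
  have a: "\<pi> [s] \<in> A"
    using admissibleD[OF Suc.prems(2), of "[s]"] Suc.prems(3) by simp
  have F: "?F s' \<in> borel_measurable (model_space S A)" if "s' \<in> S" for s'
    using that Suc.prems by (intro measurable_model_expect admissible_shift)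
  have "integrable (fdm S A \<theta>) (\<lambda>\<mu>. \<mu> (s, \<pi> [s]) s' * ?F s' \<mu>)" if s': "s' \<in> S" for s'
  proof -
    obtain B where B: "\<And>\<mu>. \<mu> \<in> space (model_space S A) \<Longrightarrow> \<bar>?F s' \<mu>\<bar> \<le> B"
      using model_expect_bounded[OF admissible_shift[OF Suc.prems(2,3)] s'] by metis
    show ?thesis
    proof (rule integrable_const_bound[where B = B])
      show "AE \<mu> in fdm S A \<theta>. norm (\<mu> (s, \<pi> [s]) s' * ?F s' \<mu>) \<le> B"
      proof (rule AE_I2)
        fix \<mu> assume "\<mu> \<in> space (fdm S A \<theta>)"
        then have \<mu>: "\<mu> \<in> space (model_space S A)" by (simp add: space_fdm)
        have "\<bar>\<mu> (s, \<pi> [s]) s'\<bar> * \<bar>?F s' \<mu>\<bar> \<le> 1 * B"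
          using model_entry_bounds[OF \<mu> Suc.prems(3) a s'] B[OF \<mu>] by (intro mult_mono) auto
        then show "norm (\<mu> (s, \<pi> [s]) s' * ?F s' \<mu>) \<le> B" by (simp add: abs_mult)
      qed
      show "(\<lambda>\<mu>. \<mu> (s, \<pi> [s]) s' * ?F s' \<mu>) \<in> borel_measurable (fdm S A \<theta>)"
        unfolding measurable_cong_sets[OF sets_fdm refl]
        using Suc.prems a s' by (intro borel_measurable_times measurable_model_entry F)
    qed
  qed
  then have "(\<integral>\<mu>. model_expect S (Suc n) \<mu> \<pi> s f \<partial>fdm S A \<theta>) =
      (\<Sum>s'\<in>S. \<integral>\<mu>. \<mu> (s, \<pi> [s]) s' * ?F s' \<mu> \<partial>fdm S A \<theta>)"
    by (simp add: Bochner_Integration.integral_sum)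
  also have "\<dots> = bayes_expect (Suc n) \<theta> \<pi> s f"
    using Suc.prems a
    by (auto intro!: sum.cong simp: integral_fdm_conjugate F Suc.IH admissible_shift positive_params_bayes_update)
  finally show ?case .
qed

section \<open>The law of the state sequence under a random model\<close>

lemma sets_states: "f \<in> borel_measurable (PiM {0..<n::nat} (\<lambda>_. count_space S))"
  by (subst count_space_PiM_finite) (auto intro: countable_finite[OF finite_S])

lemma measurable_history:
  "(\<lambda>\<omega>. f (history \<omega> n)) \<in> borel_measurable (PiM UNIV (\<lambda>_. count_space S))"
proof -
  have "(\<lambda>\<omega>. f (history (restrict \<omega> {0..<Suc n}) n)) \<in> borel_measurable (PiM UNIV (\<lambda>_. count_space S))"
    by (rule measurable_compose[OF measurable_restrict_subset[of "{0..<Suc n}" UNIV] sets_states]) simp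
  moreover have "history (restrict \<omega> {0..<Suc n}) n = history \<omega> n" for \<omega> :: "nat \<Rightarrow> 's"
    by auto
  ultimately show ?thesis by (simp only:)
qed

text \<open>Cylinders generate the product sigma-algebra, and the probability of a cylinder is a
  finite expectation, hence a polynomial in the entries of the model. This makes the bind in
  \<open>bayes_law\<close> meaningful.\<close>

lemma measurable_trajectories:
  assumes \<pi>: "admissible S A \<pi>" and s: "s \<in> S"
  shows "(\<lambda>\<mu>. trajectories S \<mu> \<pi> s) \<in> model_space S A \<rightarrow>\<^sub>M prob_algebra (PiM UNIV (\<lambda>_. count_space S))"
proof (rule measurable_prob_algebra_generated[OF sets_PiM Int_stable_prod_algebra prod_algebra_sets_into_space])
  fix X assume "X \<in> prod_algebra UNIV (\<lambda>_::nat. count_space S)"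
  then obtain J E where X: "X = prod_emb UNIV (\<lambda>_. count_space S) J (Pi\<^sub>E J E)" "finite J"
      "\<And>i. i \<in> J \<Longrightarrow> E i \<in> sets (count_space S)"
    by (rule prod_algebraE) blast
  obtain n where n: "\<And>j. j \<in> J \<Longrightarrow> j \<le> n"
    using X(2) by (meson finite_nat_set_iff_bounded_le)
  let ?f = "\<lambda>h. of_bool (\<forall>j\<in>J. h ! j \<in> E j) :: real"
  have XS: "X \<in> sets (PiM UNIV (\<lambda>_. count_space S))"
    unfolding X(1) using X by (intro sets_PiM_I) auto
  have ind: "indicator X \<omega> = ennreal (?f (history \<omega> n))" if "\<omega> \<in> UNIV \<rightarrow>\<^sub>E S" for \<omega>
  proof -
    have "\<omega> \<in> X \<longleftrightarrow> (\<forall>j\<in>J. \<omega> j \<in> E j)"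
      using that unfolding X(1) by (auto simp: prod_emb_def PiE_iff)
    moreover have "history \<omega> n ! j = \<omega> j" if "j \<in> J" for j
      using n[OF that] by (subst nth_map) (auto simp del: upt_Suc)
    ultimately show ?thesis
      by (simp add: indicator_def del: upt_Suc)
  qed
  have "emeasure (trajectories S \<mu> \<pi> s) X = ennreal (model_expect S n \<mu> \<pi> s ?f)"
    if "\<mu> \<in> space (model_space S A)" for \<mu>
  proof -
    interpret model_policy S A \<mu> \<pi> s by (rule model_policyI[OF that \<pi> s])
    have "emeasure (trajectories S \<mu> \<pi> s) X = (\<integral>\<^sup>+\<omega>. indicator X \<omega> \<partial>trajectories S \<mu> \<pi> s)"
      using XS sets_trajectories by (simp add: nn_integral_indicator)
    also have "\<dots> = (\<integral>\<^sup>+\<omega>. ennreal (?f (history \<omega> n)) \<partial>trajectories S \<mu> \<pi> s)"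
      by (intro nn_integral_cong ind) (simp add: space_trajectories)
    also have "\<dots> = ennreal (model_expect S n \<mu> \<pi> s ?f)"
      by (rule nn_integral_trajectories) simp
    finally show ?thesis .
  qed
  then show "(\<lambda>\<mu>. emeasure (trajectories S \<mu> \<pi> s) X) \<in> borel_measurable (model_space S A)"
    by (subst measurable_cong) (auto intro!: measurable_compose[OF measurable_model_expect[OF \<pi> s]])
next
  fix \<mu> assume "\<mu> \<in> space (model_space S A)"
  then interpret model_policy S A \<mu> \<pi> s by (rule model_policyI[OF _ \<pi> s])
  show "prob_space (trajectories S \<mu> \<pi> s)" "sets (trajectories S \<mu> \<pi> s) = sets (PiM UNIV (\<lambda>_. count_space S))"
    by (rule prob_space_trajectories sets_trajectories)+
qed

lemma trajectories_kernel:
  assumes "admissible S A \<pi>" "s \<in> S"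
  shows "(\<lambda>\<mu>. trajectories S \<mu> \<pi> s) \<in> fdm S A \<theta> \<rightarrow>\<^sub>M subprob_algebra (PiM UNIV (\<lambda>_. count_space S))"
  unfolding measurable_cong_sets[OF sets_fdm refl]
  using measurable_trajectories[OF assms] by (rule measurable_prob_algebraD)

lemma space_fdm_nonempty:
  assumes "positive_params S A \<theta>" shows "space (fdm S A \<theta>) \<noteq> {}"
  using prob_space_fdm[OF assms] by (rule prob_space.not_empty)

lemma sets_bayes_law:
  assumes "positive_params S A \<theta>" "admissible S A \<pi>" "s \<in> S"
  shows "sets (bayes_law S A \<theta> \<pi> s) = sets (PiM UNIV (\<lambda>_. count_space S))"
  unfolding bayes_law_def
  by (rule sets_bind[OF sets_kernel[OF trajectories_kernel[OF assms(2,3)]]])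
     (use space_fdm_nonempty[OF assms(1)] in auto)

lemma space_bayes_law:
  assumes "positive_params S A \<theta>" "admissible S A \<pi>" "s \<in> S"
  shows "space (bayes_law S A \<theta> \<pi> s) = UNIV \<rightarrow>\<^sub>E S"
  using sets_eq_imp_space_eq[OF sets_bayes_law[OF assms]] by (simp add: space_PiM)

lemma prob_space_bayes_law:
  assumes "positive_params S A \<theta>" "admissible S A \<pi>" "s \<in> S"
  shows "prob_space (bayes_law S A \<theta> \<pi> s)"
proof -
  interpret prob_space "fdm S A \<theta>" by (rule prob_space_fdm[OF assms(1)])
  show ?thesis
    unfolding bayes_law_def
  proof (rule prob_space_bind[OF _ trajectories_kernel[OF assms(2,3)]])
    show "AE \<mu> in fdm S A \<theta>. prob_space (trajectories S \<mu> \<pi> s)"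
      using assms(2,3) by (intro AE_I2 model_policy.prob_space_trajectories[of S A] model_policyI) (auto simp: space_fdm)
  qed
qed

text \<open>The bridge from the law in the theorem to the finite recursion; the later probability
  estimate goes through it.\<close>

lemma nn_integral_bayes_law:
  assumes "positive_params S A \<theta>" "admissible S A \<pi>" "s \<in> S"
    and f: "\<And>h. h \<noteq> [] \<Longrightarrow> set h \<subseteq> S \<Longrightarrow> 0 \<le> f h"
  shows "(\<integral>\<^sup>+\<omega>. ennreal (f (history \<omega> n)) \<partial>bayes_law S A \<theta> \<pi> s) = ennreal (bayes_expect n \<theta> \<pi> s f)"
proof -
  have eq: "(\<integral>\<^sup>+\<omega>. ennreal (f (history \<omega> n)) \<partial>trajectories S \<mu> \<pi> s) = ennreal (model_expect S n \<mu> \<pi> s f)"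
    if "\<mu> \<in> space (model_space S A)" for \<mu>
    by (rule model_policy.nn_integral_trajectories[OF model_policyI[OF that assms(2,3)] f])
  have nonneg: "0 \<le> model_expect S n \<mu> \<pi> s f" if "\<mu> \<in> space (model_space S A)" for \<mu>
    by (rule model_expect_nonneg[OF that assms(2,3) f])
  interpret prob_space "fdm S A \<theta>" by (rule prob_space_fdm[OF assms(1)])
  obtain B where "\<And>\<mu>. \<mu> \<in> space (model_space S A) \<Longrightarrow> \<bar>model_expect S n \<mu> \<pi> s f\<bar> \<le> B"
    using model_expect_bounded[OF assms(2,3)] by metis
  then have int: "integrable (fdm S A \<theta>) (\<lambda>\<mu>. model_expect S n \<mu> \<pi> s f)"
    using measurable_model_expect[OF assms(2,3)]
    by (intro integrable_const_bound[where B = B] AE_I2)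
       (auto simp: space_fdm measurable_cong_sets[OF sets_fdm refl])
  have "(\<integral>\<^sup>+\<omega>. ennreal (f (history \<omega> n)) \<partial>bayes_law S A \<theta> \<pi> s) =
     (\<integral>\<^sup>+\<mu>. (\<integral>\<^sup>+\<omega>. ennreal (f (history \<omega> n)) \<partial>trajectories S \<mu> \<pi> s) \<partial>fdm S A \<theta>)"
    unfolding bayes_law_def
    by (rule nn_integral_bind[OF measurable_history trajectories_kernel[OF assms(2,3)]])
  also have "\<dots> = (\<integral>\<^sup>+\<mu>. ennreal (model_expect S n \<mu> \<pi> s f) \<partial>fdm S A \<theta>)"
    by (intro nn_integral_cong eq) (simp add: space_fdm)
  also have "\<dots> = ennreal (\<integral>\<mu>. model_expect S n \<mu> \<pi> s f \<partial>fdm S A \<theta>)"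
    using int nonneg by (intro nn_integral_eq_integral) (auto simp: space_fdm)
  finally show ?thesis
    using integral_model_expect[OF assms(1-3)] by simp
qed

end

section \<open>Bayesian values\<close>

lemma posterior_singleton [simp]: "posterior \<theta> \<pi> [s] = \<theta>"
  by (simp add: posterior_def)

lemma posterior_snoc:
  assumes "h \<noteq> []"
  shows "posterior \<theta> \<pi> (h @ [s']) = bayes_update (posterior \<theta> \<pi> h) (last h) (\<pi> h) s'"
proof -
  obtain k where k: "length h = Suc k"
    using assms by (cases h) auto
  have "posterior \<theta> \<pi> (h @ [s']) =
    bayes_update (fold (\<lambda>i \<theta>'. bayes_update \<theta>' ((h @ [s']) ! i) (\<pi> (take (Suc i) (h @ [s']))) ((h @ [s']) ! Suc i))
       [0..<k] \<theta>) (h ! k) (\<pi> h) s'"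
    by (simp add: posterior_def k nth_append)
  also have "fold (\<lambda>i \<theta>'. bayes_update \<theta>' ((h @ [s']) ! i) (\<pi> (take (Suc i) (h @ [s']))) ((h @ [s']) ! Suc i))
       [0..<k] \<theta> = posterior \<theta> \<pi> h"
    unfolding posterior_def k by (rule fold_cong) (auto simp: k nth_append)
  also have "h ! k = last h"
    using assms k by (simp add: last_conv_nth)
  finally show ?thesis .
qed

lemma posterior_Cons:
  assumes "h \<noteq> []"
  shows "posterior \<theta> \<pi> (s # h) = posterior (bayes_update \<theta> s (\<pi> [s]) (hd h)) (\<lambda>h. \<pi> (s # h)) h"
proof -
  obtain k where k: "length h = Suc k"
    using assms by (cases h) auto
  have "[0..<Suc k] = 0 # map Suc [0..<k]"
    by (simp add: upt_conv_Cons map_Suc_upt del: upt_Suc)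
  then show ?thesis
    using assms unfolding posterior_def by (simp add: k fold_map comp_def hd_conv_nth del: upt_Suc)
qed

definition discounted_return ::
  "('s \<Rightarrow> 'a \<Rightarrow> 's \<Rightarrow> real) \<Rightarrow> real \<Rightarrow> ('s, 'a) policy \<Rightarrow> 's list \<Rightarrow> real"
where
  "discounted_return R \<gamma> \<pi> h =
     (\<Sum>t<length h - 1. \<gamma> ^ t * R (h ! t) (\<pi> (take (Suc t) h)) (h ! Suc t))"

lemma discounted_return_singleton [simp]: "discounted_return R \<gamma> \<pi> [s] = 0"
  by (simp add: discounted_return_def)

lemma discounted_return_Cons:
  assumes "h \<noteq> []"
  shows "discounted_return R \<gamma> \<pi> (s # h) =
    R s (\<pi> [s]) (hd h) + \<gamma> * discounted_return R \<gamma> (\<lambda>h. \<pi> (s # h)) h"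
proof -
  obtain k where k: "length h = Suc k"
    using assms by (cases h) auto
  show ?thesis
    using assms unfolding discounted_return_def
    by (simp add: k sum.lessThan_Suc_shift sum_distrib_left hd_conv_nth mult_ac del: sum.lessThan_Suc)
qed

lemma discounted_return_history:
  "discounted_return R \<gamma> \<pi> (history \<omega> n) =
    (\<Sum>t<n. \<gamma> ^ t * R (\<omega> t) (\<pi> (history \<omega> t)) (\<omega> (Suc t)))"
  unfolding discounted_return_def
proof (rule sum.cong)
  show "{..<length (history \<omega> n) - 1} = {..<n}"
    by simp
  fix t assume "t \<in> {..<n}"
  then have t: "t < n" by simp
  have "history \<omega> n ! t = \<omega> t" "history \<omega> n ! Suc t = \<omega> (Suc t)"
    using t by (subst nth_map; simp del: upt_Suc)+
  moreover have "take (Suc t) (history \<omega> n) = history \<omega> t"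
    using t by (simp add: take_map del: upt_Suc)
  ultimately show "\<gamma> ^ t * R (history \<omega> n ! t) (\<pi> (take (Suc t) (history \<omega> n))) (history \<omega> n ! Suc t) =
     \<gamma> ^ t * R (\<omega> t) (\<pi> (history \<omega> t)) (\<omega> (Suc t))"
    by (simp only:)
qed

context finite_decision_problem
begin

text \<open>The premise records \<open>hd h = s\<close> because \<open>posterior_Cons\<close> and
  \<open>discounted_return_Cons\<close> speak of the head of the shifted history.\<close>

lemma bayes_expect_cong:
  assumes "s \<in> S" "\<And>h. set h \<subseteq> S \<Longrightarrow> h \<noteq> [] \<Longrightarrow> hd h = s \<Longrightarrow> length h = Suc n \<Longrightarrow> f h = g h"
  shows "bayes_expect n \<theta> \<pi> s f = bayes_expect n \<theta> \<pi> s g"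
  using assms
proof (induction n arbitrary: \<theta> \<pi> s f g)
  case (Suc n)
  show ?case
    unfolding bayes_expect.simps using Suc.prems(1)
    by (intro sum.cong refl arg_cong[where f = "\<lambda>x. _ * x"] Suc.IH Suc.prems(2)) auto
qed simp

lemma bayes_expect_mono:
  assumes "positive_params S A \<theta>" "admissible S A \<pi>" "s \<in> S"
    and "\<And>h. set h \<subseteq> S \<Longrightarrow> h \<noteq> [] \<Longrightarrow> hd h = s \<Longrightarrow> length h = Suc n \<Longrightarrow> f h \<le> g h"
  shows "bayes_expect n \<theta> \<pi> s f \<le> bayes_expect n \<theta> \<pi> s g"
  using assms
proof (induction n arbitrary: \<theta> \<pi> s f g)
  case (Suc n)
  have a: "\<pi> [s] \<in> A"
    using admissibleD[OF Suc.prems(2), of "[s]"] Suc.prems(3) by simp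
  show ?case
    unfolding bayes_expect.simps
  proof (intro sum_mono mult_left_mono)
    fix s' assume s': "s' \<in> S"
    show "bayes_expect n (bayes_update \<theta> s (\<pi> [s]) s') (\<lambda>h. \<pi> (s # h)) s' (\<lambda>h. f (s # h)) \<le>
      bayes_expect n (bayes_update \<theta> s (\<pi> [s]) s') (\<lambda>h. \<pi> (s # h)) s' (\<lambda>h. g (s # h))"
      using Suc.prems(1-3) s'
      by (intro Suc.IH Suc.prems(4) admissible_shift positive_params_bayes_update) auto
    show "0 \<le> predictive S \<theta> s (\<pi> [s]) s'"
      by (rule predictive_nonneg[OF Suc.prems(1,3) a s'])
  qed
qed simp

lemma bayes_expect_affine:
  assumes "positive_params S A \<theta>" "admissible S A \<pi>" "s \<in> S"
  shows "bayes_expect n \<theta> \<pi> s (\<lambda>h. c + d * f h) = c + d * bayes_expect n \<theta> \<pi> s f"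
  using assms
proof (induction n arbitrary: \<theta> \<pi> s f)
  case (Suc n)
  have a: "\<pi> [s] \<in> A"
    using admissibleD[OF Suc.prems(2), of "[s]"] Suc.prems(3) by simp
  let ?F = "\<lambda>s'. bayes_expect n (bayes_update \<theta> s (\<pi> [s]) s') (\<lambda>h. \<pi> (s # h)) s' (\<lambda>h. f (s # h))"
  have "bayes_expect (Suc n) \<theta> \<pi> s (\<lambda>h. c + d * f h) =
     (\<Sum>s'\<in>S. predictive S \<theta> s (\<pi> [s]) s' * (c + d * ?F s'))"
    unfolding bayes_expect.simps using Suc.prems
    by (intro sum.cong refl arg_cong[where f = "\<lambda>x. _ * x"] Suc.IH admissible_shift positive_params_bayes_update)
  also have "\<dots> = c * (\<Sum>s'\<in>S. predictive S \<theta> s (\<pi> [s]) s') + d * bayes_expect (Suc n) \<theta> \<pi> s f"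
    by (simp add: algebra_simps sum.distrib sum_distrib_left)
  also have "(\<Sum>s'\<in>S. predictive S \<theta> s (\<pi> [s]) s') = 1"
    by (rule sum_predictive[OF Suc.prems(1,3) a])
  finally show ?case by simp
qed simp

text \<open>One-step conditional expectation given the history: the last transition is predicted by
  the posterior of the whole history. Drift inequalities enter the recursion in this form.\<close>

lemma bayes_expect_Suc_end:
  assumes "s \<in> S"
  shows "bayes_expect (Suc n) \<theta> \<pi> s f =
     bayes_expect n \<theta> \<pi> s
       (\<lambda>h. \<Sum>s'\<in>S. predictive S (posterior \<theta> \<pi> h) (last h) (\<pi> h) s' * f (h @ [s']))"
  using assms
proof (induction n arbitrary: \<theta> \<pi> s f)
  case (Suc n)
  let ?\<theta> = "\<lambda>s'. bayes_update \<theta> s (\<pi> [s]) s'" and ?\<pi> = "\<lambda>h. \<pi> (s # h)"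
  have "bayes_expect (Suc (Suc n)) \<theta> \<pi> s f =
     (\<Sum>s'\<in>S. predictive S \<theta> s (\<pi> [s]) s' * bayes_expect n (?\<theta> s') ?\<pi> s'
        (\<lambda>h. \<Sum>s''\<in>S. predictive S (posterior (?\<theta> s') ?\<pi> h) (last h) (\<pi> (s # h)) s'' * f (s # h @ [s''])))"
    unfolding bayes_expect.simps(2)[of "Suc n"]
    by (intro sum.cong refl arg_cong[where f = "\<lambda>x. _ * x"]) (rule Suc.IH)
  also have "\<dots> = (\<Sum>s'\<in>S. predictive S \<theta> s (\<pi> [s]) s' * bayes_expect n (?\<theta> s') ?\<pi> s'
        (\<lambda>h. \<Sum>s''\<in>S. predictive S (posterior \<theta> \<pi> (s # h)) (last (s # h)) (\<pi> (s # h)) s'' * f ((s # h) @ [s''])))"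
    by (intro sum.cong refl arg_cong[where f = "\<lambda>x. _ * x"] bayes_expect_cong) (auto simp: posterior_Cons)
  finally show ?case
    unfolding bayes_expect.simps .
qed simp

end

section \<open>Returns and values of policies\<close>

locale discounted_problem = finite_decision_problem S A
  for S :: "'s set" and A :: "'a set" +
  fixes R :: "'s \<Rightarrow> 'a \<Rightarrow> 's \<Rightarrow> real" and \<gamma> :: real
  assumes reward: "\<And>s a s'. s \<in> S \<Longrightarrow> a \<in> A \<Longrightarrow> s' \<in> S \<Longrightarrow> 0 \<le> R s a s' \<and> R s a s' \<le> 1"
    and discount: "0 \<le> \<gamma>" "\<gamma> < 1"
begin

lemma discounted_return_nonneg:
  assumes "admissible S A \<pi>" "set h \<subseteq> S"
  shows "0 \<le> discounted_return R \<gamma> \<pi> h"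
  unfolding discounted_return_def
proof (rule sum_nonneg)
  fix t assume t: "t \<in> {..<length h - 1}"
  then have "h ! t \<in> S" "h ! Suc t \<in> S" "take (Suc t) h \<noteq> []" "set (take (Suc t) h) \<subseteq> S"
    using assms(2) set_take_subset[of "Suc t" h] by (auto simp: subset_iff)
  then show "0 \<le> \<gamma> ^ t * R (h ! t) (\<pi> (take (Suc t) h)) (h ! Suc t)"
    using discount reward admissibleD[OF assms(1)] by simp
qed

text \<open>On every path the discounted rewards from time n on add up to a number between 0 and
  \<gamma> ^ n / (1 - \<gamma>). Values are thus limits of finite expectations, from which
  measurability in the model and the Bellman equation are read off.\<close>

lemma model_value_bounds:
  assumes \<mu>: "\<mu> \<in> space (model_space S A)" and \<pi>: "admissible S A \<pi>" and s: "s \<in> S"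
  shows "model_expect S n \<mu> \<pi> s (discounted_return R \<gamma> \<pi>) \<le> model_value S R \<gamma> \<mu> \<pi> s"
    and "model_value S R \<gamma> \<mu> \<pi> s \<le> model_expect S n \<mu> \<pi> s (discounted_return R \<gamma> \<pi>) + \<gamma> ^ n / (1 - \<gamma>)"
proof -
  interpret model_policy S A \<mu> \<pi> s by (rule model_policyI[OF \<mu> \<pi> s])
  let ?T = "trajectories S \<mu> \<pi> s"
  interpret T: prob_space ?T by (rule prob_space_trajectories)
  let ?r = "\<lambda>t \<omega>. \<gamma> ^ t * R (\<omega> t) (\<pi> (history \<omega> t)) (\<omega> (Suc t))"
  let ?D = "\<lambda>\<omega>. discounted_return R \<gamma> \<pi> (history \<omega> n)"
  have r: "0 \<le> ?r t \<omega>" "?r t \<omega> \<le> \<gamma> ^ t" if "\<omega> \<in> space ?T" for t \<omega>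
  proof -
    have \<omega>: "\<omega> t \<in> S" "\<omega> (Suc t) \<in> S" "set (history \<omega> t) \<subseteq> S"
      using that by (auto simp: space_trajectories)
    then have "0 \<le> R (\<omega> t) (\<pi> (history \<omega> t)) (\<omega> (Suc t)) \<and> R (\<omega> t) (\<pi> (history \<omega> t)) (\<omega> (Suc t)) \<le> 1"
      by (intro reward admissibleD[OF \<pi>]) auto
    then show "0 \<le> ?r t \<omega>" "?r t \<omega> \<le> \<gamma> ^ t"
      using discount by (auto simp: mult_left_le)
  qed
  have geom: "summable (\<lambda>t. \<gamma> ^ t)" "(\<Sum>t. \<gamma> ^ (t + k)) = \<gamma> ^ k / (1 - \<gamma>)" for k
    using discount by (auto simp: summable_geometric power_add suminf_mult2[symmetric] suminf_geometric)
  have sm: "summable (\<lambda>t. ?r t \<omega>)" if "\<omega> \<in> space ?T" for \<omega>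
    using r[OF that] by (intro summable_comparison_test'[OF geom(1), of 0]) auto
  have bnd: "?D \<omega> \<le> (\<Sum>t. ?r t \<omega>)" "(\<Sum>t. ?r t \<omega>) \<le> ?D \<omega> + \<gamma> ^ n / (1 - \<gamma>)" if \<omega>: "\<omega> \<in> space ?T" for \<omega>
  proof -
    have split: "(\<Sum>t. ?r t \<omega>) = (\<Sum>t. ?r (t + n) \<omega>) + ?D \<omega>"
      unfolding discounted_return_history by (rule suminf_split_initial_segment[OF sm[OF \<omega>]])
    have sm': "summable (\<lambda>t. ?r (t + n) \<omega>)"
      using sm[OF \<omega>] by (subst summable_iff_shift)
    show "?D \<omega> \<le> (\<Sum>t. ?r t \<omega>)"
      unfolding split using r[OF \<omega>] suminf_nonneg[OF sm'] by simp
    have "(\<Sum>t. ?r (t + n) \<omega>) \<le> (\<Sum>t. \<gamma> ^ (t + n))"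
      using r[OF \<omega>] geom(1) by (intro suminf_le sm') (auto simp: summable_iff_shift)
    then show "(\<Sum>t. ?r t \<omega>) \<le> ?D \<omega> + \<gamma> ^ n / (1 - \<gamma>)"
      unfolding split geom(2) by simp
  qed
  have D0: "0 \<le> ?D \<omega>" if "\<omega> \<in> space ?T" for \<omega>
    using that by (intro discounted_return_nonneg[OF \<pi>]) (auto simp: space_trajectories)
  have meas_r: "?r t \<in> borel_measurable ?T" for t
  proof -
    have "(\<lambda>\<omega>. (\<lambda>h. \<gamma> ^ t * R (h ! t) (\<pi> (take (Suc t) h)) (h ! Suc t)) (history \<omega> (Suc t))) \<in> borel_measurable ?T"
      unfolding measurable_cong_sets[OF sets_trajectories refl] by (rule measurable_history)
    moreover have "history \<omega> (Suc t) ! t = \<omega> t" "history \<omega> (Suc t) ! Suc t = \<omega> (Suc t)"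
        "take (Suc t) (history \<omega> (Suc t)) = history \<omega> t" for \<omega> :: "nat \<Rightarrow> 's"
      by (simp_all add: nth_append)
    ultimately show ?thesis by (simp only:)
  qed
  have meas: "(\<lambda>\<omega>. \<Sum>t. ?r t \<omega>) \<in> borel_measurable ?T"
    by (intro borel_measurable_suminf meas_r)
  have measD: "?D \<in> borel_measurable ?T"
    unfolding measurable_cong_sets[OF sets_trajectories refl] by (rule measurable_history)
  have "norm (\<Sum>t. ?r t \<omega>) \<le> 1 / (1 - \<gamma>)" "norm (?D \<omega>) \<le> 1 / (1 - \<gamma>)" if \<omega>: "\<omega> \<in> space ?T" for \<omega>
  proof -
    have "(\<Sum>t. ?r t \<omega>) \<le> (\<Sum>t. \<gamma> ^ t)"
      using r[OF \<omega>] geom(1) by (intro suminf_le sm[OF \<omega>]) auto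
    also have "\<dots> = 1 / (1 - \<gamma>)" using geom(2)[of 0] by simp
    finally show "norm (\<Sum>t. ?r t \<omega>) \<le> 1 / (1 - \<gamma>)" "norm (?D \<omega>) \<le> 1 / (1 - \<gamma>)"
      using bnd[OF \<omega>] D0[OF \<omega>] by auto
  qed
  then have int: "integrable ?T (\<lambda>\<omega>. \<Sum>t. ?r t \<omega>)" and intD: "integrable ?T ?D"
    using meas measD by (auto intro!: T.integrable_const_bound[where B = "1 / (1 - \<gamma>)"] AE_I2)
  have "(\<integral>\<omega>. ?D \<omega> \<partial>?T) = enn2real (\<integral>\<^sup>+\<omega>. ennreal (?D \<omega>) \<partial>?T)"
    using D0 measD by (intro integral_eq_nn_integral AE_I2) auto
  also have "\<dots> = model_expect S n \<mu> \<pi> s (discounted_return R \<gamma> \<pi>)"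
    using discounted_return_nonneg[OF \<pi>] model_expect_nonneg[OF \<mu> \<pi> s]
    by (subst nn_integral_trajectories) (auto intro!: enn2real_ennreal)
  finally have D: "(\<integral>\<omega>. ?D \<omega> \<partial>?T) = model_expect S n \<mu> \<pi> s (discounted_return R \<gamma> \<pi>)" .
  show "model_expect S n \<mu> \<pi> s (discounted_return R \<gamma> \<pi>) \<le> model_value S R \<gamma> \<mu> \<pi> s"
    unfolding D[symmetric] model_value_def using bnd(1) by (intro integral_mono intD int)
  have "(\<integral>\<omega>. (\<Sum>t. ?r t \<omega>) \<partial>?T) \<le> (\<integral>\<omega>. ?D \<omega> + \<gamma> ^ n / (1 - \<gamma>) \<partial>?T)"
    using bnd(2) intD by (intro integral_mono int) auto
  also have "\<dots> = (\<integral>\<omega>. ?D \<omega> \<partial>?T) + \<gamma> ^ n / (1 - \<gamma>)"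
    using intD by (simp add: T.prob_space)
  finally show "model_value S R \<gamma> \<mu> \<pi> s \<le> model_expect S n \<mu> \<pi> s (discounted_return R \<gamma> \<pi>) + \<gamma> ^ n / (1 - \<gamma>)"
    unfolding D model_value_def .
qed

lemma discount_tail_tendsto: "(\<lambda>n. \<gamma> ^ n / (1 - \<gamma>)) \<longlonglongrightarrow> 0"
  using tendsto_divide[OF LIMSEQ_realpow_zero[OF discount] tendsto_const[of "1 - \<gamma>"]] discount by simp

lemma tendsto_discount_tail:
  assumes "\<And>n. f n \<le> v" "\<And>n. v \<le> f n + \<gamma> ^ n / (1 - \<gamma>)"
  shows "f \<longlonglongrightarrow> v"
proof (rule tendsto_sandwich)
  show "(\<lambda>n. v - \<gamma> ^ n / (1 - \<gamma>)) \<longlonglongrightarrow> v"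
    using tendsto_diff[OF tendsto_const discount_tail_tendsto, of v] by simp
  show "\<forall>\<^sub>F n in sequentially. v - \<gamma> ^ n / (1 - \<gamma>) \<le> f n"
    using assms(2) by (simp add: diff_le_eq)
  show "\<forall>\<^sub>F n in sequentially. f n \<le> v"
    using assms(1) by simp
qed (rule tendsto_const)

lemma measurable_model_value:
  assumes \<pi>: "admissible S A \<pi>" and s: "s \<in> S"
  shows "(\<lambda>\<mu>. model_value S R \<gamma> \<mu> \<pi> s) \<in> borel_measurable (model_space S A)"
proof (rule borel_measurable_LIMSEQ_real)
  show "(\<lambda>\<mu>. model_expect S n \<mu> \<pi> s (discounted_return R \<gamma> \<pi>)) \<in> borel_measurable (model_space S A)" for n
    by (rule measurable_model_expect[OF \<pi> s])
  fix \<mu> assume \<mu>: "\<mu> \<in> space (model_space S A)"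
  show "(\<lambda>n. model_expect S n \<mu> \<pi> s (discounted_return R \<gamma> \<pi>)) \<longlonglongrightarrow> model_value S R \<gamma> \<mu> \<pi> s"
    using model_value_bounds[OF \<mu> \<pi> s] by (rule tendsto_discount_tail)
qed

abbreviation bayes_return :: "nat \<Rightarrow> ('s, 'a) params \<Rightarrow> ('s, 'a) policy \<Rightarrow> 's \<Rightarrow> real" where
  "bayes_return n \<theta> \<pi> s \<equiv> bayes_expect n \<theta> \<pi> s (discounted_return R \<gamma> \<pi>)"

lemma bayes_return_Suc:
  assumes "positive_params S A \<theta>" "admissible S A \<pi>" "s \<in> S"
  shows "bayes_return (Suc n) \<theta> \<pi> s = (\<Sum>s'\<in>S. predictive S \<theta> s (\<pi> [s]) s' *
    (R s (\<pi> [s]) s' + \<gamma> * bayes_return n (bayes_update \<theta> s (\<pi> [s]) s') (\<lambda>h. \<pi> (s # h)) s'))"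
  unfolding bayes_expect.simps
proof (intro sum.cong refl arg_cong[where f = "\<lambda>x. _ * x"])
  fix s' assume s': "s' \<in> S"
  let ?\<theta> = "bayes_update \<theta> s (\<pi> [s]) s'" and ?\<pi> = "\<lambda>h. \<pi> (s # h)"
  have "bayes_expect n ?\<theta> ?\<pi> s' (\<lambda>h. discounted_return R \<gamma> \<pi> (s # h)) =
    bayes_expect n ?\<theta> ?\<pi> s' (\<lambda>h. R s (\<pi> [s]) s' + \<gamma> * discounted_return R \<gamma> ?\<pi> h)"
    by (rule bayes_expect_cong[OF s']) (simp add: discounted_return_Cons)
  also have "\<dots> = R s (\<pi> [s]) s' + \<gamma> * bayes_return n ?\<theta> ?\<pi> s'"
    using assms s' by (intro bayes_expect_affine positive_params_bayes_update admissible_shift)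
  finally show "bayes_expect n ?\<theta> ?\<pi> s' (\<lambda>h. discounted_return R \<gamma> \<pi> (s # h)) = \<dots>" .
qed

lemma bayes_value_bounds:
  assumes \<theta>: "positive_params S A \<theta>" and \<pi>: "admissible S A \<pi>" and s: "s \<in> S"
  shows "bayes_return n \<theta> \<pi> s \<le> bayes_value S A R \<gamma> \<pi> s \<theta>"
    and "bayes_value S A R \<gamma> \<pi> s \<theta> \<le> bayes_return n \<theta> \<pi> s + \<gamma> ^ n / (1 - \<gamma>)"
proof -
  interpret prob_space "fdm S A \<theta>" by (rule prob_space_fdm[OF \<theta>])
  have V: "integrable (fdm S A \<theta>) (\<lambda>\<mu>. model_value S R \<gamma> \<mu> \<pi> s)"
  proof (rule integrable_const_bound[where B = "1 / (1 - \<gamma>)"])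
    show "AE \<mu> in fdm S A \<theta>. norm (model_value S R \<gamma> \<mu> \<pi> s) \<le> 1 / (1 - \<gamma>)"
      using model_value_bounds[OF _ \<pi> s, of _ 0] by (auto intro!: AE_I2 simp: space_fdm)
  qed (use measurable_model_value[OF \<pi> s] in \<open>simp add: measurable_cong_sets[OF sets_fdm refl]\<close>)
  have E: "integrable (fdm S A \<theta>) (\<lambda>\<mu>. model_expect S n \<mu> \<pi> s (discounted_return R \<gamma> \<pi>))"
  proof -
    obtain B where "\<And>\<mu>. \<mu> \<in> space (model_space S A) \<Longrightarrow>
        \<bar>model_expect S n \<mu> \<pi> s (discounted_return R \<gamma> \<pi>)\<bar> \<le> B"
      using model_expect_bounded[OF \<pi> s] by metis
    then show ?thesis
      using measurable_model_expect[OF \<pi> s]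
      by (intro integrable_const_bound[where B = B] AE_I2)
         (auto simp: space_fdm measurable_cong_sets[OF sets_fdm refl])
  qed
  show "bayes_return n \<theta> \<pi> s \<le> bayes_value S A R \<gamma> \<pi> s \<theta>"
    unfolding bayes_value_def integral_model_expect[OF \<theta> \<pi> s, symmetric]
    using model_value_bounds(1)[OF _ \<pi> s] by (intro integral_mono E V) (auto simp: space_fdm)
  have "bayes_value S A R \<gamma> \<pi> s \<theta> \<le>
      (\<integral>\<mu>. model_expect S n \<mu> \<pi> s (discounted_return R \<gamma> \<pi>) + \<gamma> ^ n / (1 - \<gamma>) \<partial>fdm S A \<theta>)"
    unfolding bayes_value_def
    using model_value_bounds(2)[OF _ \<pi> s] E by (intro integral_mono V) (auto simp: space_fdm)
  also have "\<dots> = bayes_return n \<theta> \<pi> s + \<gamma> ^ n / (1 - \<gamma>)"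
    using E by (simp add: integral_model_expect[OF \<theta> \<pi> s] prob_space)
  finally show "bayes_value S A R \<gamma> \<pi> s \<theta> \<le> \<dots>" .
qed

lemma bayes_value_nonneg:
  assumes "positive_params S A \<theta>" "admissible S A \<pi>" "s \<in> S"
  shows "0 \<le> bayes_value S A R \<gamma> \<pi> s \<theta>"
  using bayes_value_bounds(1)[OF assms, of 0] by simp

lemma bayes_value_le:
  assumes "positive_params S A \<theta>" "admissible S A \<pi>" "s \<in> S"
  shows "bayes_value S A R \<gamma> \<pi> s \<theta> \<le> 1 / (1 - \<gamma>)"
  using bayes_value_bounds(2)[OF assms, of 0] by simp

lemma bayes_return_tendsto:
  assumes "positive_params S A \<theta>" "admissible S A \<pi>" "s \<in> S"
  shows "(\<lambda>n. bayes_return n \<theta> \<pi> s) \<longlonglongrightarrow> bayes_value S A R \<gamma> \<pi> s \<theta>"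
  using bayes_value_bounds[OF assms] by (rule tendsto_discount_tail)

text \<open>Passing to the limit in the finite-horizon recursion avoids conditioning infinite
  trajectories on their first step.\<close>

lemma bayes_value_bellman:
  assumes "positive_params S A \<theta>" "admissible S A \<pi>" "s \<in> S"
  shows "bayes_value S A R \<gamma> \<pi> s \<theta> = (\<Sum>s'\<in>S. predictive S \<theta> s (\<pi> [s]) s' *
    (R s (\<pi> [s]) s' + \<gamma> * bayes_value S A R \<gamma> (\<lambda>h. \<pi> (s # h)) s' (bayes_update \<theta> s (\<pi> [s]) s')))"
proof (rule LIMSEQ_unique)
  show "(\<lambda>n. bayes_return (Suc n) \<theta> \<pi> s) \<longlonglongrightarrow> bayes_value S A R \<gamma> \<pi> s \<theta>"
    using bayes_return_tendsto[OF assms] by (rule LIMSEQ_Suc)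
  show "(\<lambda>n. bayes_return (Suc n) \<theta> \<pi> s) \<longlonglongrightarrow> (\<Sum>s'\<in>S. predictive S \<theta> s (\<pi> [s]) s' *
    (R s (\<pi> [s]) s' + \<gamma> * bayes_value S A R \<gamma> (\<lambda>h. \<pi> (s # h)) s' (bayes_update \<theta> s (\<pi> [s]) s')))"
    unfolding bayes_return_Suc[OF assms] using assms
    by (intro tendsto_intros bayes_return_tendsto positive_params_bayes_update admissible_shift)
qed

end

section \<open>Optimism and stability of BOLT values\<close>

context finite_decision_problem
begin

lemma sum_bolt_trans:
  assumes "\<sigma> \<in> S"
  shows "(\<Sum>s'\<in>S. bolt_trans S \<eta> \<theta> s (a, \<sigma>) s' * f s') =
    ((\<Sum>s'\<in>S. \<theta> (s, a) s' * f s') + \<eta> * f \<sigma>) / ((\<Sum>s'\<in>S. \<theta> (s, a) s') + \<eta>)"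
proof -
  have "(\<Sum>s'\<in>S. bolt_trans S \<eta> \<theta> s (a, \<sigma>) s' * f s') =
      (\<Sum>s'\<in>S. \<theta> (s, a) s' * f s' + \<eta> * (if s' = \<sigma> then f s' else 0)) / ((\<Sum>s'\<in>S. \<theta> (s, a) s') + \<eta>)"
    unfolding bolt_trans_def sum_divide_distrib by (intro sum.cong) (auto simp: algebra_simps)
  also have "(\<Sum>s'\<in>S. \<theta> (s, a) s' * f s' + \<eta> * (if s' = \<sigma> then f s' else 0)) =
      (\<Sum>s'\<in>S. \<theta> (s, a) s' * f s') + \<eta> * f \<sigma>"
    using assms finite_S by (simp add: sum.distrib sum_distrib_left[symmetric])
  finally show ?thesis .
qed

lemma sum_params_bounds:
  assumes "positive_params S A \<theta>" "s \<in> S" "a \<in> A"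
  shows "(\<And>s'. s' \<in> S \<Longrightarrow> 0 \<le> f s') \<Longrightarrow> 0 \<le> (\<Sum>s'\<in>S. \<theta> (s, a) s' * f s')"
    and "(\<And>s'. s' \<in> S \<Longrightarrow> f s' \<le> M) \<Longrightarrow> (\<Sum>s'\<in>S. \<theta> (s, a) s' * f s') \<le> (\<Sum>s'\<in>S. \<theta> (s, a) s') * M"
  using assms unfolding positive_params_def sum_distrib_right
  by (auto intro!: sum_nonneg mult_nonneg_nonneg sum_mono mult_left_mono intro: less_imp_le)

end

context discounted_problem
begin

abbreviation bolt_backup where
  "bolt_backup \<eta> \<theta> V s \<alpha> \<equiv> (\<Sum>s'\<in>S. bolt_trans S \<eta> \<theta> s \<alpha> s' * (R s (fst \<alpha>) s' + \<gamma> * V s'))"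

lemma bolt_backup_le_bolt_value:
  "\<alpha> \<in> A \<times> S \<Longrightarrow> bolt_backup \<eta> \<theta> (bolt_value S A R \<gamma> \<eta> \<theta> i) s \<alpha> \<le> bolt_value S A R \<gamma> \<eta> \<theta> (Suc i) s"
  using finite_S finite_A by (auto intro!: Max_ge)

lemma bolt_value_attained:
  obtains a \<sigma> where "a \<in> A" "\<sigma> \<in> S"
    "bolt_value S A R \<gamma> \<eta> \<theta> (Suc i) s = bolt_backup \<eta> \<theta> (bolt_value S A R \<gamma> \<eta> \<theta> i) s (a, \<sigma>)"
proof -
  have "bolt_value S A R \<gamma> \<eta> \<theta> (Suc i) s \<in> bolt_backup \<eta> \<theta> (bolt_value S A R \<gamma> \<eta> \<theta> i) s ` (A \<times> S)"
    unfolding bolt_value.simps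
    using finite_S finite_A S_nonempty A_nonempty by (intro Max_in) auto
  then show ?thesis using that by force
qed

lemma bolt_trans_nonneg':
  "positive_params S A \<theta> \<Longrightarrow> 0 \<le> \<eta> \<Longrightarrow> s \<in> S \<Longrightarrow> a \<in> A \<Longrightarrow> s' \<in> S \<Longrightarrow> 0 \<le> bolt_trans S \<eta> \<theta> s (a, \<sigma>) s'"
  by (rule bolt_trans_nonneg) (auto simp: positive_params_def intro: less_imp_le)

lemma bolt_backup_mono:
  assumes "positive_params S A \<theta>" "0 \<le> \<eta>" "s \<in> S" "a \<in> A" "\<And>s'. s' \<in> S \<Longrightarrow> V s' \<le> W s'"
  shows "bolt_backup \<eta> \<theta> V s (a, \<sigma>) \<le> bolt_backup \<eta> \<theta> W s (a, \<sigma>)"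
  using assms discount
  by (intro sum_mono mult_left_mono add_left_mono bolt_trans_nonneg') auto

text \<open>The interval from 0 to 1 / (1 - \<gamma>) is invariant under backups, since 1 + \<gamma>
  / (1 - \<gamma>) = 1 / (1 - \<gamma>).\<close>

lemma reward_plus_bounds:
  assumes "s \<in> S" "a \<in> A" "s' \<in> S" "0 \<le> v" "v \<le> 1 / (1 - \<gamma>)"
  shows "0 \<le> R s a s' + \<gamma> * v" "R s a s' + \<gamma> * v \<le> 1 / (1 - \<gamma>)"
proof -
  show "0 \<le> R s a s' + \<gamma> * v"
    using assms reward discount by simp
  have "\<gamma> * v \<le> \<gamma> * (1 / (1 - \<gamma>))"
    using assms discount by (intro mult_left_mono) auto
  then have "R s a s' + \<gamma> * v \<le> 1 + \<gamma> * (1 / (1 - \<gamma>))"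
    using assms reward by (intro add_mono) auto
  also have "\<dots> = 1 / (1 - \<gamma>)"
    using discount by (simp add: field_simps)
  finally show "R s a s' + \<gamma> * v \<le> 1 / (1 - \<gamma>)" .
qed

lemma bolt_backup_bounds:
  assumes \<theta>: "positive_params S A \<theta>" and \<eta>: "0 \<le> \<eta>" and s: "s \<in> S" "a \<in> A" "\<sigma> \<in> S"
    and V: "\<And>s'. s' \<in> S \<Longrightarrow> 0 \<le> V s' \<and> V s' \<le> 1 / (1 - \<gamma>)"
  shows "0 \<le> bolt_backup \<eta> \<theta> V s (a, \<sigma>)" "bolt_backup \<eta> \<theta> V s (a, \<sigma>) \<le> 1 / (1 - \<gamma>)"
proof -
  let ?f = "\<lambda>s'. R s a s' + \<gamma> * V s'" and ?N = "\<Sum>s'\<in>S. \<theta> (s, a) s'"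
  have f: "0 \<le> ?f s'" "?f s' \<le> 1 / (1 - \<gamma>)" if "s' \<in> S" for s'
    using reward_plus_bounds[OF s(1,2) that] V[OF that] by auto
  have N: "0 < ?N" by (rule sum_params_pos[OF \<theta> s(1,2)])
  have eq: "bolt_backup \<eta> \<theta> V s (a, \<sigma>) = ((\<Sum>s'\<in>S. \<theta> (s, a) s' * ?f s') + \<eta> * ?f \<sigma>) / (?N + \<eta>)"
    using sum_bolt_trans[OF s(3), of \<eta> \<theta> s a ?f] by simp
  show "0 \<le> bolt_backup \<eta> \<theta> V s (a, \<sigma>)"
    unfolding eq
    by (intro divide_nonneg_nonneg add_nonneg_nonneg sum_params_bounds(1)[OF \<theta> s(1,2)] f(1)
        mult_nonneg_nonneg[OF \<eta> f(1)[OF s(3)]] less_imp_le[OF N] \<eta>)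
  have "(\<Sum>s'\<in>S. \<theta> (s, a) s' * ?f s') + \<eta> * ?f \<sigma> \<le> ?N * (1 / (1 - \<gamma>)) + \<eta> * (1 / (1 - \<gamma>))"
    by (intro add_mono mult_left_mono sum_params_bounds(2)[OF \<theta> s(1,2)] f(2) s(3) \<eta>)
  also have "\<dots> = 1 / (1 - \<gamma>) * (?N + \<eta>)"
    by (simp add: algebra_simps)
  finally show "bolt_backup \<eta> \<theta> V s (a, \<sigma>) \<le> 1 / (1 - \<gamma>)"
    unfolding eq using N \<eta> by (simp only: pos_divide_le_eq add_pos_nonneg)
qed

lemma bolt_value_bounds:
  assumes "positive_params S A \<theta>" "0 \<le> \<eta>" "s \<in> S"
  shows "0 \<le> bolt_value S A R \<gamma> \<eta> \<theta> i s \<and> bolt_value S A R \<gamma> \<eta> \<theta> i s \<le> 1 / (1 - \<gamma>)"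
  using assms(3)
proof (induction i arbitrary: s)
  case 0
  then show ?case using discount by simp
next
  case (Suc i)
  obtain a \<sigma> where a: "a \<in> A" "\<sigma> \<in> S"
    and eq: "bolt_value S A R \<gamma> \<eta> \<theta> (Suc i) s = bolt_backup \<eta> \<theta> (bolt_value S A R \<gamma> \<eta> \<theta> i) s (a, \<sigma>)"
    by (rule bolt_value_attained)
  show ?case
    unfolding eq using bolt_backup_bounds[OF assms(1,2) Suc.prems a, of "bolt_value S A R \<gamma> \<eta> \<theta> i"] Suc.IH
    by blast
qed

text \<open>Rewards are nonnegative, so the first stage cannot lose, and monotone backups propagate
  this. It serves to return from H - 1 to H stages after a step of the run.\<close>

lemma bolt_value_mono_horizon:
  assumes "positive_params S A \<theta>" "0 \<le> \<eta>" "s \<in> S"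
  shows "bolt_value S A R \<gamma> \<eta> \<theta> i s \<le> bolt_value S A R \<gamma> \<eta> \<theta> (Suc i) s"
  using assms(3)
proof (induction i arbitrary: s)
  case 0
  then show ?case
    using bolt_value_bounds[OF assms(1,2) 0, of "Suc 0"] by simp
next
  case (Suc i)
  obtain a \<sigma> where a: "a \<in> A" "\<sigma> \<in> S"
    and eq: "bolt_value S A R \<gamma> \<eta> \<theta> (Suc i) s = bolt_backup \<eta> \<theta> (bolt_value S A R \<gamma> \<eta> \<theta> i) s (a, \<sigma>)"
    by (rule bolt_value_attained)
  have "\<dots> \<le> bolt_backup \<eta> \<theta> (bolt_value S A R \<gamma> \<eta> \<theta> (Suc i)) s (a, \<sigma>)"
    using Suc.IH by (intro bolt_backup_mono assms(1,2) Suc.prems a)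
  also have "\<dots> \<le> bolt_value S A R \<gamma> \<eta> \<theta> (Suc (Suc i)) s"
    using a by (intro bolt_backup_le_bolt_value) auto
  finally show ?case unfolding eq .
qed

text \<open>
  A belief reached by \<open>k \<le> \<eta>\<close> further observations of \<open>(s, a)\<close> predicts no better than the same
  prior with \<open>\<eta>\<close> artificial observations of the best successor.
\<close>

lemma optimistic_average:
  fixes X j \<eta> \<Theta> g :: real
  assumes "0 < \<Theta>" "0 \<le> j" "j \<le> \<eta>" "X \<le> \<Theta> * g"
  shows "(X + j * g) / (\<Theta> + j) \<le> (X + \<eta> * g) / (\<Theta> + \<eta>)"
proof -
  have "0 \<le> (\<eta> - j) * (\<Theta> * g - X)"
    using assms by (intro mult_nonneg_nonneg) auto
  then have "(X + j * g) * (\<Theta> + \<eta>) \<le> (X + \<eta> * g) * (\<Theta> + j)"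
    by (simp add: algebra_simps)
  then show ?thesis
    using assms by (simp add: divide_le_eq le_divide_eq)
qed

text \<open>BOLT freezes the belief \<theta> while the Bayesian value lets it move to \<phi>. The
  induction carries a bound k on the observations that separate the two: a step trades one stage of
  i for one unit of k, so i + k \<le> \<eta> persists. At best all extra observations fall on the
  most valuable successor \<sigma>, and \<eta> artificial observations of \<sigma> do at least as
  well.\<close>

lemma bayes_return_le_bolt_value:
  assumes "positive_params S A \<theta>" "positive_params S A \<phi>" "admissible S A \<pi>" "s \<in> S"
    and "\<And>s a s'. \<theta> (s, a) s' \<le> \<phi> (s, a) s'"
    and "\<And>s a. (\<Sum>s'\<in>S. \<phi> (s, a) s') \<le> (\<Sum>s'\<in>S. \<theta> (s, a) s') + k"
    and "real i + k \<le> \<eta>" "0 \<le> \<eta>"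
  shows "bayes_return i \<phi> \<pi> s \<le> bolt_value S A R \<gamma> \<eta> \<theta> i s"
  using assms
proof (induction i arbitrary: \<phi> \<pi> s k)
  case (Suc i)
  define a where "a = \<pi> [s]"
  have a: "a \<in> A"
    using admissibleD[OF Suc.prems(3), of "[s]"] Suc.prems(4) by (simp add: a_def)
  let ?V = "bolt_value S A R \<gamma> \<eta> \<theta> i"
  let ?g = "\<lambda>s'. R s a s' + \<gamma> * ?V s'"
  have IH: "bayes_return i (bayes_update \<phi> s a s') (\<lambda>h. \<pi> (s # h)) s' \<le> ?V s'" if s': "s' \<in> S" for s'
  proof (rule Suc.IH)
    show "(\<Sum>x\<in>S. bayes_update \<phi> s a s' (t, b) x) \<le> (\<Sum>x\<in>S. \<theta> (t, b) x) + (k + 1)" for t b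
    proof -
      have "(\<Sum>x\<in>S. bayes_update \<phi> s a s' (t, b) x) \<le> (\<Sum>x\<in>S. \<phi> (t, b) x + (if x = s' then 1 else 0))"
        by (intro sum_mono) (auto simp: bayes_update_def)
      also have "\<dots> \<le> (\<Sum>x\<in>S. \<theta> (t, b) x) + (k + 1)"
        using Suc.prems(6)[of t b] finite_S by (simp add: sum.distrib)
      finally show ?thesis .
    qed
    show "\<theta> (t, b) x \<le> bayes_update \<phi> s a s' (t, b) x" for t b x
      using Suc.prems(5)[of t b x] by (auto simp: bayes_update_def)
  qed (use Suc.prems s' in \<open>auto intro: positive_params_bayes_update admissible_shift\<close>)
  obtain \<sigma> where \<sigma>: "\<sigma> \<in> S" and max: "\<And>s'. s' \<in> S \<Longrightarrow> ?g s' \<le> ?g \<sigma>"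
  proof -
    have "Max (?g ` S) \<in> ?g ` S"
      using finite_S S_nonempty by (intro Max_in) auto
    then obtain \<sigma> where \<sigma>: "Max (?g ` S) = ?g \<sigma>" "\<sigma> \<in> S" by (rule imageE)
    have "?g s' \<le> ?g \<sigma>" if "s' \<in> S" for s'
      unfolding \<sigma>(1)[symmetric] using that finite_S by (intro Max_ge finite_imageI imageI)
    with \<sigma>(2) show ?thesis by (rule that)
  qed
  let ?\<Theta> = "\<Sum>s'\<in>S. \<theta> (s, a) s'" and ?\<Phi> = "\<Sum>s'\<in>S. \<phi> (s, a) s'"
  let ?X = "\<Sum>s'\<in>S. \<theta> (s, a) s' * ?g s'"
  have \<Theta>: "0 < ?\<Theta>" by (rule sum_params_pos[OF Suc.prems(1,4) a])
  have \<Phi>: "0 < ?\<Phi>" by (rule sum_params_pos[OF Suc.prems(2,4) a])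
  have j: "0 \<le> ?\<Phi> - ?\<Theta>" "?\<Phi> - ?\<Theta> \<le> \<eta>"
    using Suc.prems(5) Suc.prems(6)[of s a] Suc.prems(7) by (auto intro!: sum_mono)
  have "bayes_return (Suc i) \<phi> \<pi> s \<le> (\<Sum>s'\<in>S. predictive S \<phi> s a s' * ?g s')"
    unfolding bayes_return_Suc[OF Suc.prems(2,3,4)] a_def[symmetric]
    using IH discount Suc.prems a
    by (intro sum_mono mult_left_mono add_left_mono predictive_nonneg) auto
  also have "\<dots> = (\<Sum>s'\<in>S. \<phi> (s, a) s' * ?g s') / ?\<Phi>"
    by (simp add: predictive_def sum_divide_distrib)
  \<comment> \<open>Moves the whole excess of \<phi> over \<theta> onto the best successor. With j =
    \<open>?\<Phi> - ?\<Theta>\<close> the denominator is \<open>?\<Theta> + j\<close>, the form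
    required by \<open>optimistic_average\<close>.\<close>
  also have "\<dots> \<le> (?X + (?\<Phi> - ?\<Theta>) * ?g \<sigma>) / ?\<Phi>"
  proof -
    have "(\<Sum>s'\<in>S. (\<phi> (s, a) s' - \<theta> (s, a) s') * ?g s') \<le> (\<Sum>s'\<in>S. (\<phi> (s, a) s' - \<theta> (s, a) s') * ?g \<sigma>)"
      using max Suc.prems(5) by (intro sum_mono mult_left_mono) auto
    then have "(\<Sum>s'\<in>S. \<phi> (s, a) s' * ?g s') - ?X \<le> (?\<Phi> - ?\<Theta>) * ?g \<sigma>"
      by (simp only: sum_subtractf left_diff_distrib sum_distrib_right)
    then show ?thesis
      using \<Phi> by (intro divide_right_mono) auto
  qed
  also have "\<dots> \<le> (?X + \<eta> * ?g \<sigma>) / (?\<Theta> + \<eta>)"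
    using optimistic_average[OF \<Theta> j, of ?X "?g \<sigma>"] sum_params_bounds(2)[OF Suc.prems(1,4) a, of ?g "?g \<sigma>"] max
    by simp
  also have "\<dots> = bolt_backup \<eta> \<theta> ?V s (a, \<sigma>)"
    using sum_bolt_trans[OF \<sigma>, of \<eta> \<theta> s a ?g] by simp
  also have "\<dots> \<le> bolt_value S A R \<gamma> \<eta> \<theta> (Suc i) s"
    using a \<sigma> by (intro bolt_backup_le_bolt_value) auto
  finally show ?case .
qed simp

text \<open>A constant policy ensures that the supremum is not taken over the empty set, where its
  value would be unspecified.\<close>

lemma opt_bayes_value_le:
  assumes "\<And>\<pi>. \<pi> \<in> policies S A \<Longrightarrow> bayes_value S A R \<gamma> \<pi> s \<theta> \<le> v"
  shows "opt_bayes_value S A R \<gamma> s \<theta> \<le> v"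
proof -
  obtain a where "a \<in> A" using A_nonempty by blast
  then have "(\<lambda>_. a) \<in> policies S A" by (simp add: policies_def)
  then show ?thesis
    unfolding opt_bayes_value_def using assms by (intro cSUP_least) auto
qed

lemma bolt_value_optimistic:
  assumes \<theta>: "positive_params S A \<theta>" and s: "s \<in> S"
  shows "opt_bayes_value S A R \<gamma> s \<theta> \<le> bolt_value S A R \<gamma> (real H) \<theta> H s + \<gamma> ^ H / (1 - \<gamma>)"
proof (rule opt_bayes_value_le)
  fix \<pi> assume "\<pi> \<in> policies S A"
  then have \<pi>: "admissible S A \<pi>" by (rule admissible_policies)
  have "bayes_value S A R \<gamma> \<pi> s \<theta> \<le> bayes_return H \<theta> \<pi> s + \<gamma> ^ H / (1 - \<gamma>)"
    by (rule bayes_value_bounds(2)[OF \<theta> \<pi> s])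
  \<comment> \<open>The induction is entered with no extra observation, k = 0 and i = H. This is
    where \<eta> = H is used: H steps bring at most H observations.\<close>
  also have "bayes_return H \<theta> \<pi> s \<le> bolt_value S A R \<gamma> (real H) \<theta> H s"
    by (rule bayes_return_le_bolt_value[OF \<theta> \<theta> \<pi> s, of 0]) auto
  finally show "bayes_value S A R \<gamma> \<pi> s \<theta> \<le> bolt_value S A R \<gamma> (real H) \<theta> H s + \<gamma> ^ H / (1 - \<gamma>)"
    by simp
qed

lemma sum_bayes_update:
  assumes "s' \<in> S"
  shows "(\<Sum>x\<in>S. bayes_update \<theta> s a s' sa x * f x) =
    (\<Sum>x\<in>S. \<theta> sa x * f x) + (if sa = (s, a) then f s' else 0)"
proof (cases "sa = (s, a)")
  case True
  have "(\<Sum>x\<in>S. bayes_update \<theta> s a s' sa x * f x) = (\<Sum>x\<in>S. \<theta> sa x * f x + (if x = s' then f s' else 0))"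
    by (intro sum.cong) (auto simp: bayes_update_def True algebra_simps)
  then show ?thesis
    using assms finite_S True by (simp add: sum.distrib)
qed (simp add: bayes_update_def)

text \<open>An observation touches only the backups at (s, a). There the weighted sum Z gains a
  nonnegative term and its total weight D grows by 1, so Z / D \<le> 1 / (1 - \<gamma>) loses at
  most Z / D - Z / (D + 1) \<le> 1 / ((1 - \<gamma>) * D). Over i stages these losses add up, with
  the discount on the inherited part estimated by 1.\<close>

lemma bolt_value_bayes_update:
  assumes \<theta>: "positive_params S A \<theta>" and \<eta>: "0 \<le> \<eta>" and s: "s \<in> S" "a \<in> A" "s' \<in> S" and x: "x \<in> S"
  shows "bolt_value S A R \<gamma> \<eta> \<theta> i x \<le> bolt_value S A R \<gamma> \<eta> (bayes_update \<theta> s a s') i x +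
    real i / ((1 - \<gamma>) * ((\<Sum>x\<in>S. \<theta> (s, a) x) + \<eta>))"
  using x
proof (induction i arbitrary: x)
  case (Suc i)
  let ?\<theta>' = "bayes_update \<theta> s a s'"
  let ?N = "\<Sum>x\<in>S. \<theta> (s, a) x"
  define c where "c = 1 / ((1 - \<gamma>) * (?N + \<eta>))"
  have N: "0 < ?N" by (rule sum_params_pos[OF \<theta> s(1,2)])
  have c: "0 \<le> c" using N \<eta> discount by (simp add: c_def)
  note \<theta>' = positive_params_bayes_update[OF \<theta>, of s a s']
  let ?V = "bolt_value S A R \<gamma> \<eta> \<theta> i" and ?V' = "bolt_value S A R \<gamma> \<eta> ?\<theta>' i"
  obtain b \<sigma> where b: "b \<in> A" "\<sigma> \<in> S"
    and eq: "bolt_value S A R \<gamma> \<eta> \<theta> (Suc i) x = bolt_backup \<eta> \<theta> ?V x (b, \<sigma>)"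
    by (rule bolt_value_attained)
  let ?f = "\<lambda>y. R x b y + \<gamma> * ?V' y"
  have f: "0 \<le> ?f y" "?f y \<le> 1 / (1 - \<gamma>)" if "y \<in> S" for y
    using reward_plus_bounds[OF Suc.prems b(1) that] bolt_value_bounds[OF \<theta>' \<eta> that, of i] by auto
  let ?Y = "\<Sum>y\<in>S. \<theta> (x, b) y * ?f y" and ?M = "\<Sum>y\<in>S. \<theta> (x, b) y"
  have M: "0 < ?M" by (rule sum_params_pos[OF \<theta> Suc.prems b(1)])
  have "bolt_backup \<eta> \<theta> ?V x (b, \<sigma>) \<le> (\<Sum>y\<in>S. bolt_trans S \<eta> \<theta> x (b, \<sigma>) y * (?f y + real i * c))"
  proof (intro sum_mono mult_left_mono bolt_trans_nonneg'[OF \<theta> \<eta> Suc.prems b(1)])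
    fix y assume y: "y \<in> S"
    have "\<gamma> * ?V y \<le> \<gamma> * (?V' y + real i * c)"
      using Suc.IH[OF y] discount by (intro mult_left_mono) (auto simp: c_def)
    also have "\<dots> \<le> \<gamma> * ?V' y + 1 * (real i * c)"
      unfolding distrib_left using discount c by (intro add_left_mono mult_right_mono) auto
    finally show "R x (fst (b, \<sigma>)) y + \<gamma> * ?V y \<le> ?f y + real i * c"
      by simp
  qed
  also have "\<dots> = (?Y + \<eta> * ?f \<sigma> + real i * c * (?M + \<eta>)) / (?M + \<eta>)"
    unfolding sum_bolt_trans[OF b(2)] by (simp add: algebra_simps sum.distrib sum_distrib_left)
  also have "\<dots> = (?Y + \<eta> * ?f \<sigma>) / (?M + \<eta>) + real i * c"
    using M \<eta> by (simp add: add_divide_distrib)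
  also have "(?Y + \<eta> * ?f \<sigma>) / (?M + \<eta>) \<le> bolt_backup \<eta> ?\<theta>' ?V' x (b, \<sigma>) + c"
  proof -
    have eq': "bolt_backup \<eta> ?\<theta>' ?V' x (b, \<sigma>) =
      ((?Y + (if (x, b) = (s, a) then ?f s' else 0)) + \<eta> * ?f \<sigma>) / (?M + (if (x, b) = (s, a) then 1 else 0) + \<eta>)"
      using sum_bolt_trans[OF b(2), of \<eta> ?\<theta>' x b ?f] sum_bayes_update[OF s(3), of \<theta> s a "(x, b)" ?f]
        sum_bayes_update[OF s(3), of \<theta> s a "(x, b)" "\<lambda>_. 1"]
      by simp
    show ?thesis
    proof (cases "(x, b) = (s, a)")
      case True
      define Z where "Z = ?Y + \<eta> * ?f \<sigma>"
      define D where "D = ?M + \<eta>"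
      have D: "0 < D" using M \<eta> by (simp add: D_def)
      have Z0: "0 \<le> Z"
        unfolding Z_def
        by (intro add_nonneg_nonneg sum_params_bounds(1)[OF \<theta> Suc.prems b(1)] f(1)
            mult_nonneg_nonneg[OF \<eta> f(1)[OF b(2)]])
      have "Z \<le> ?M * (1 / (1 - \<gamma>)) + \<eta> * (1 / (1 - \<gamma>))"
        unfolding Z_def
        by (intro add_mono mult_left_mono sum_params_bounds(2)[OF \<theta> Suc.prems b(1)] f(2) b(2) \<eta>)
      then have ZD: "Z \<le> D * (1 / (1 - \<gamma>))"
        by (simp add: D_def algebra_simps)
      have "Z / D - Z / (D + 1) = Z / D * (1 / (D + 1))"
        using D by (simp add: field_simps)
      also have "\<dots> \<le> (1 / (1 - \<gamma>)) * (1 / D)"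
        using D ZD Z0 discount by (intro mult_mono) (auto simp: field_simps)
      also have "\<dots> = c"
        using True by (simp add: c_def D_def)
      finally have "Z / D \<le> Z / (D + 1) + c" by simp
      also have "Z / (D + 1) \<le> (Z + ?f s') / (D + 1)"
        using D f(1)[OF s(3)] by (intro divide_right_mono) auto
      finally show ?thesis
        unfolding eq' using True by (simp add: Z_def D_def add_ac)
    next
      case False
      then show ?thesis
        unfolding eq' using c by auto
    qed
  qed
  also have "bolt_backup \<eta> ?\<theta>' ?V' x (b, \<sigma>) \<le> bolt_value S A R \<gamma> \<eta> ?\<theta>' (Suc i) x"
    using b by (intro bolt_backup_le_bolt_value) auto
  finally have "bolt_value S A R \<gamma> \<eta> \<theta> (Suc i) x \<le> bolt_value S A R \<gamma> \<eta> ?\<theta>' (Suc i) x + c + real i * c"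
    unfolding eq by simp
  also have "\<dots> = bolt_value S A R \<gamma> \<eta> ?\<theta>' (Suc i) x + real (Suc i) * c"
    by (simp add: algebra_simps)
  finally show ?case by (simp only: c_def times_divide_eq_right mult_1_right)
qed simp

end

section \<open>One step of a BOLT run\<close>

context finite_decision_problem
begin

lemma positive_params_posterior:
  assumes "positive_params S A \<theta>"
  shows "positive_params S A (posterior \<theta> \<pi> h)"
proof (induction h rule: rev_induct)
  case Nil
  then show ?case using assms by (simp add: posterior_def)
next
  case (snoc s' h)
  then show ?case
    using assms by (cases "h = []") (simp_all add: posterior_snoc positive_params_bayes_update)
qed

lemma admissible_policy_after:
  assumes "admissible S A \<pi>" "set h \<subseteq> S"
  shows "admissible S A (policy_after \<pi> h)"
  unfolding admissible_def policy_after_def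
proof (intro allI impI admissibleD[OF assms(1)])
  fix h' :: "'s list" assume "h' \<noteq> []" "set h' \<subseteq> S"
  then show "butlast h @ h' \<noteq> []" "set (butlast h @ h') \<subseteq> S"
    using assms(2) by (auto dest: in_set_butlastD)
qed

end

context discounted_problem
begin

abbreviation value_after :: "('s, 'a) params \<Rightarrow> ('s, 'a) policy \<Rightarrow> 's list \<Rightarrow> real" where
  "value_after \<theta> \<pi> h \<equiv> bayes_value S A R \<gamma> (policy_after \<pi> h) (last h) (posterior \<theta> \<pi> h)"

lemma value_after_bellman:
  assumes "positive_params S A \<theta>" "admissible S A \<pi>" "h \<noteq> []" "set h \<subseteq> S"
  shows "value_after \<theta> \<pi> h = (\<Sum>s'\<in>S. predictive S (posterior \<theta> \<pi> h) (last h) (\<pi> h) s' *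
    (R (last h) (\<pi> h) s' + \<gamma> * value_after \<theta> \<pi> (h @ [s'])))"
proof -
  have first: "policy_after \<pi> h [last h] = \<pi> h"
    using assms by (simp add: policy_after_def)
  \<comment> \<open>As h = butlast h @ [last h], both sides evaluate \<pi> at h @ h'.\<close>
  have shift: "(\<lambda>h'. policy_after \<pi> h (last h # h')) = policy_after \<pi> (h @ [s'])" for s'
    using assms(3) append_butlast_last_id[of h] unfolding policy_after_def
    by (intro ext) (metis append.assoc append_Cons append_Nil butlast_snoc)
  show ?thesis
    using bayes_value_bellman[OF positive_params_posterior[OF assms(1)] admissible_policy_after[OF assms(2,4)],
        of "last h" \<pi> h] assms
    by (simp add: first shift[symmetric] posterior_snoc subset_iff)
qed

lemma bolt_policy_admissible:
  assumes "bolt_planner S A R \<gamma> \<eta> H \<theta> pl"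
  shows "admissible S A (bolt_policy H pl)"
  unfolding admissible_def
proof (intro allI impI)
  fix h :: "'s list" assume h: "h \<noteq> []" "set h \<subseteq> S"
  then have "pl h \<in> plans S A"
    using assms by (auto simp: bolt_planner_def bolt_plan_def is_arg_max_def)
  moreover have "last h \<in> S"
    using h by auto
  ultimately show "bolt_policy H pl h \<in> A"
    by (auto simp: plans_def bolt_policy_def mem_Times_iff)
qed

text \<open>The error consists of two losses in units of 1 / ((1 - \<gamma>) * (N + H)): at most H
  units for the artificial observations, which have weight H / (N + H) and value at most 1 / (1 -
  \<gamma>), and H - 1 units for the passage to the updated belief.\<close>

lemma bolt_value_along_run:
  assumes \<theta>: "positive_params S A \<theta>" and planner: "bolt_planner S A R \<gamma> (real H) H \<theta> pl"
    and \<pi>: "\<pi> = bolt_policy H pl" and H: "0 < H" and h: "h \<noteq> []" "set h \<subseteq> S"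
  defines "V \<equiv> \<lambda>h. bolt_value S A R \<gamma> (real H) (posterior \<theta> \<pi> h) H (last h)"
    and "N \<equiv> \<Sum>s'\<in>S. posterior \<theta> \<pi> h (last h, \<pi> h) s'"
  shows "V h \<le> (\<Sum>s'\<in>S. predictive S (posterior \<theta> \<pi> h) (last h) (\<pi> h) s' *
      (R (last h) (\<pi> h) s' + \<gamma> * V (h @ [s']))) + 2 * real H / ((1 - \<gamma>) * (N + real H))"
proof -
  obtain i where i: "H = Suc i"
    using H by (cases H) auto
  define s where "s = last h"
  define \<phi> where "\<phi> = posterior \<theta> \<pi> h"
  define a where "a = \<pi> h"
  obtain \<sigma> where \<alpha>: "pl h H s = (a, \<sigma>)"
    by (cases "pl h H s") (auto simp: a_def \<pi> bolt_policy_def s_def)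
  have s: "s \<in> S"
    using h by (auto simp: s_def)
  have \<phi>: "positive_params S A \<phi>"
    unfolding \<phi>_def by (rule positive_params_posterior[OF \<theta>])
  have nonneg: "0 \<le> \<phi> (x, b) y" if "x \<in> S" "b \<in> A" "y \<in> S" for x b y
    using \<phi> that by (auto simp: positive_params_def intro: less_imp_le)
  have plan: "bolt_plan S A R \<gamma> (real H) H s \<phi> (pl h)"
    using planner h by (simp add: bolt_planner_def s_def \<phi>_def \<pi>)
  have pl: "pl h \<in> plans S A"
    and opt: "plan_value S R \<gamma> (real H) \<phi> (pl h) H s = bolt_value S A R \<gamma> (real H) \<phi> H s"
    using plan \<phi> s finite_S finite_A A_nonempty discount
    by (subst (asm) bolt_plan_iff; auto simp: positive_params_def intro: less_imp_le)+
  have a: "a \<in> A" "\<sigma> \<in> S"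
  proof -
    have "pl h H s \<in> A \<times> S"
      using pl s by (simp add: plans_def)
    then show "a \<in> A" "\<sigma> \<in> S" by (simp_all add: \<alpha>)
  qed
  have N: "0 < N" "N = (\<Sum>s'\<in>S. \<phi> (s, a) s')"
    using sum_params_pos[OF \<phi> s a(1)] by (simp_all add: N_def \<phi>_def s_def a_def)
  define c where "c = 1 / ((1 - \<gamma>) * (N + real H))"
  have c: "0 \<le> c" using N discount by (simp add: c_def)
  let ?V = "bolt_value S A R \<gamma> (real H) \<phi> i"
  let ?f = "\<lambda>s'. R s a s' + \<gamma> * ?V s'"
  have f: "0 \<le> ?f s'" "?f s' \<le> 1 / (1 - \<gamma>)" if "s' \<in> S" for s'
    using reward_plus_bounds[OF s a(1) that] bolt_value_bounds[OF \<phi> _ that, of "real H" i] by auto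
  have "V h = plan_value S R \<gamma> (real H) \<phi> (pl h) (Suc i) s"
    unfolding V_def using opt by (simp add: i \<phi>_def s_def)
  also have "\<dots> = bolt_backup (real H) \<phi> (plan_value S R \<gamma> (real H) \<phi> (pl h) i) s (a, \<sigma>)"
    using \<alpha> by (simp add: i)
  \<comment> \<open>Optimality of the plan is available only at s with H steps to go; for its
    continuation the upper bound by value iteration is enough.\<close>
  also have "\<dots> \<le> bolt_backup (real H) \<phi> ?V s (a, \<sigma>)"
    by (intro bolt_backup_mono[OF \<phi> _ s a(1)] plan_value_le_bolt_value[OF finite_S finite_A discount(1) _ _ pl])
       (auto intro: nonneg)
  also have "\<dots> = ((\<Sum>s'\<in>S. \<phi> (s, a) s' * ?f s') + real H * ?f \<sigma>) / (N + real H)"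
    using sum_bolt_trans[OF a(2), of "real H" \<phi> s a ?f] by (simp add: N)
  also have "\<dots> \<le> (\<Sum>s'\<in>S. \<phi> (s, a) s' * ?f s') / N + real H * c"
  proof -
    \<comment> \<open>Removing the artificial weight from the denominator only raises this
      nonnegative term and turns it into the predictive mean.\<close>
    have "(\<Sum>s'\<in>S. \<phi> (s, a) s' * ?f s') / (N + real H) \<le> (\<Sum>s'\<in>S. \<phi> (s, a) s' * ?f s') / N"
      using N by (intro divide_left_mono sum_params_bounds(1)[OF \<phi> s a(1)] f) auto
    moreover have "real H * ?f \<sigma> / (N + real H) \<le> real H * (1 / (1 - \<gamma>)) / (N + real H)"
      using N(1) by (intro divide_right_mono mult_left_mono f a) auto
    ultimately show ?thesis
      by (simp add: add_divide_distrib c_def)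
  qed
  also have "(\<Sum>s'\<in>S. \<phi> (s, a) s' * ?f s') / N = (\<Sum>s'\<in>S. predictive S \<phi> s a s' * ?f s')"
    by (simp add: predictive_def N(2) sum_divide_distrib)
  also have "\<dots> \<le> (\<Sum>s'\<in>S. predictive S \<phi> s a s' * (R s a s' + \<gamma> * V (h @ [s']) + real i * c))"
  proof (intro sum_mono mult_left_mono predictive_nonneg[OF \<phi> s a(1)])
    fix s' assume s': "s' \<in> S"
    let ?\<phi>' = "bayes_update \<phi> s a s'"
    have V': "V (h @ [s']) = bolt_value S A R \<gamma> (real H) ?\<phi>' (Suc i) s'"
      using h by (simp add: V_def posterior_snoc \<phi>_def s_def a_def i del: bolt_value.simps)
    \<comment> \<open>The belief is updated at H - 1 stages, for i units, and then a stage is added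
      for free, because the next plan looks H steps ahead again.\<close>
    have "?V s' \<le> bolt_value S A R \<gamma> (real H) ?\<phi>' i s' + real i * c"
      using bolt_value_bayes_update[OF \<phi> _ s a(1) s' s', of "real H" i] by (simp add: N c_def)
    also have "bolt_value S A R \<gamma> (real H) ?\<phi>' i s' \<le> V (h @ [s'])"
      unfolding V' by (rule bolt_value_mono_horizon[OF positive_params_bayes_update[OF \<phi>] _ s']) simp
    finally have "\<gamma> * ?V s' \<le> \<gamma> * (V (h @ [s']) + real i * c)"
      using discount by (intro mult_left_mono) auto
    also have "\<dots> \<le> \<gamma> * V (h @ [s']) + 1 * (real i * c)"
      unfolding distrib_left using discount c by (intro add_left_mono mult_right_mono) auto
    finally show "?f s' \<le> R s a s' + \<gamma> * V (h @ [s']) + real i * c" by simp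
  qed
  also have "\<dots> = (\<Sum>s'\<in>S. predictive S \<phi> s a s' * (R s a s' + \<gamma> * V (h @ [s']))) +
      real i * c * (\<Sum>s'\<in>S. predictive S \<phi> s a s')"
    by (simp add: algebra_simps sum.distrib sum_distrib_left)
  also have "(\<Sum>s'\<in>S. predictive S \<phi> s a s') = 1"
    by (rule sum_predictive[OF \<phi> s a(1)])
  finally have "V h \<le> (\<Sum>s'\<in>S. predictive S \<phi> s a s' * (R s a s' + \<gamma> * V (h @ [s']))) + (real i + real H) * c"
    by (simp add: algebra_simps)
  also have "(real i + real H) * c \<le> 2 * real H * c"
    using c by (intro mult_right_mono) (auto simp: i)
  finally show ?thesis
    by (simp add: c_def s_def \<phi>_def a_def)
qed

end

section \<open>Tail bound from a potential\<close>

text \<open>Reduces an event about the whole set of bad times, possibly infinite, to countably many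
  events about prefixes.\<close>

lemma emeasure_count_le_iff:
  fixes T :: "nat set" and K :: real
  assumes "0 \<le> K"
  shows "emeasure (count_space UNIV) T \<le> ennreal K \<longleftrightarrow> (\<forall>n. real (card (T \<inter> {..<n})) \<le> K)"
proof (cases "finite T")
  case True
  obtain m where m: "T \<subseteq> {..<m}"
    using True finite_nat_bounded by blast
  have "emeasure (count_space UNIV) T = ennreal (real (card T))"
    using True by (simp add: emeasure_count_space ennreal_of_nat_eq_real_of_nat)
  moreover have "(\<forall>n. real (card (T \<inter> {..<n})) \<le> K) \<longleftrightarrow> real (card T) \<le> K"
  proof
    assume "\<forall>n. real (card (T \<inter> {..<n})) \<le> K"
    then show "real (card T) \<le> K"
      using m by (metis inf.absorb1)
  next
    assume "real (card T) \<le> K"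
    moreover have "card (T \<inter> {..<n}) \<le> card T" for n
      using True by (intro card_mono) auto
    ultimately show "\<forall>n. real (card (T \<inter> {..<n})) \<le> K"
      by (meson le_trans of_nat_le_iff order_trans)
  qed
  ultimately show ?thesis
    using assms by simp
next
  case False
  obtain k where k: "K < real k"
    using reals_Archimedean2 by blast
  obtain B where B: "B \<subseteq> T" "finite B" "card B = k"
    using infinite_arbitrarily_large[OF False] by metis
  obtain m where "B \<subseteq> {..<m}"
    using B(2) finite_nat_bounded by blast
  then have "k \<le> card (T \<inter> {..<m})"
    using B by (auto intro!: card_mono)
  then have "\<not> (\<forall>n. real (card (T \<inter> {..<n})) \<le> K)"
    using k by (meson leD le_less_trans not_le of_nat_le_iff order.strict_trans2)
  then show ?thesis
    using False by (simp add: emeasure_count_space top_unique)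
qed

text \<open>The last state of h is left out: its badness is charged when the next state is appended,
  in the same step in which the potential pays for it.\<close>

definition bad_count :: "('s list \<Rightarrow> bool) \<Rightarrow> 's list \<Rightarrow> nat" where
  "bad_count bad h = card {t. t < length h - 1 \<and> bad (take (Suc t) h)}"

lemma bad_count_singleton [simp]: "bad_count bad [s] = 0"
  by (simp add: bad_count_def)

lemma bad_count_snoc:
  assumes "h \<noteq> []"
  shows "bad_count bad (h @ [s']) = bad_count bad h + of_bool (bad h)"
proof -
  obtain k where k: "length h = Suc k"
    using assms by (cases h) auto
  let ?T = "{t. t < k \<and> bad (take (Suc t) h)}"
  have "{t. t < length (h @ [s']) - 1 \<and> bad (take (Suc t) (h @ [s']))} =
      (if bad h then insert k ?T else ?T)"
    using k by (auto simp: less_Suc_eq)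
  then show ?thesis
    unfolding bad_count_def using k by simp
qed

lemma bad_count_history:
  "bad_count bad (history \<omega> n) = card ({t. bad (history \<omega> t)} \<inter> {..<n})"
proof -
  have "take (Suc t) (history \<omega> n) = history \<omega> t" if "t < n" for t
    using that by (simp add: take_map del: upt_Suc)
  then have "{t. t < length (history \<omega> n) - 1 \<and> bad (take (Suc t) (history \<omega> n))} = {t. bad (history \<omega> t)} \<inter> {..<n}"
    by (auto simp del: upt_Suc)
  then show ?thesis by (simp only: bad_count_def)
qed

context finite_decision_problem
begin

text \<open>
  With \<open>\<lambda> = 1 / (2 * M)\<close>, the process \<open>(1 + \<lambda>) ^ bad_count h * (1 + \<Psi> h / M)\<close> is a
  supermartingale: the potential drops by \<open>1\<close> at each bad step, which pays for the factor
  \<open>1 + \<lambda>\<close> because \<open>1 + \<Psi> / M \<le> 2\<close>.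
\<close>

lemma bayes_expect_bad_count:
  assumes \<theta>: "positive_params S A \<theta>" and \<pi>: "admissible S A \<pi>" and s: "s \<in> S" and M: "0 < M"
    and \<Psi>: "\<And>h. h \<noteq> [] \<Longrightarrow> set h \<subseteq> S \<Longrightarrow> 0 \<le> \<Psi> h \<and> \<Psi> h \<le> M"
    and drift: "\<And>h. h \<noteq> [] \<Longrightarrow> set h \<subseteq> S \<Longrightarrow>
      (\<Sum>s'\<in>S. predictive S (posterior \<theta> \<pi> h) (last h) (\<pi> h) s' * \<Psi> (h @ [s'])) \<le> \<Psi> h - of_bool (bad h)"
    and pos: "\<And>h. positive_params S A (posterior \<theta> \<pi> h)"
  shows "bayes_expect n \<theta> \<pi> s (\<lambda>h. (1 + 1 / (2 * M)) ^ bad_count bad h) \<le> 2"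
proof -
  define l where "l = 1 + 1 / (2 * M)"
  have l: "0 < l" "1 \<le> l" using M by (simp_all add: l_def add_pos_pos)
  define W where "W = (\<lambda>h. l ^ bad_count bad h * (1 + \<Psi> h / M))"
  have W: "bayes_expect n \<theta> \<pi> s W \<le> 2"
  proof (induction n)
    case 0
    have "\<Psi> [s] / M \<le> 1" using \<Psi>[of "[s]"] s M by simp
    then show ?case by (simp add: W_def)
  next
    case (Suc n)
    have "bayes_expect (Suc n) \<theta> \<pi> s W \<le> bayes_expect n \<theta> \<pi> s W"
      unfolding bayes_expect_Suc_end[OF s]
    proof (rule bayes_expect_mono[OF \<theta> \<pi> s])
      fix h assume h: "set h \<subseteq> S" "h \<noteq> []"
      let ?p = "\<lambda>s'. predictive S (posterior \<theta> \<pi> h) (last h) (\<pi> h) s'"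
      define d where "d = (of_bool (bad h) :: real)"
      have last: "last h \<in> S" using h by auto
      have sum1: "(\<Sum>s'\<in>S. ?p s') = 1"
        by (rule sum_predictive[OF pos last admissibleD[OF \<pi> h(2,1)]])
      have "(\<Sum>s'\<in>S. ?p s' * W (h @ [s'])) =
          (\<Sum>s'\<in>S. l ^ (bad_count bad h + of_bool (bad h)) * (?p s' + ?p s' * \<Psi> (h @ [s']) / M))"
        using h by (intro sum.cong) (simp_all add: W_def bad_count_snoc algebra_simps)
      also have "\<dots> = l ^ (bad_count bad h + of_bool (bad h)) *
          (1 + (\<Sum>s'\<in>S. ?p s' * \<Psi> (h @ [s'])) / M)"
        by (simp add: sum_distrib_left[symmetric] sum.distrib sum1 sum_divide_distrib)
      also have "\<dots> \<le> l ^ (bad_count bad h + of_bool (bad h)) * (1 + (\<Psi> h - d) / M)"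
        using drift[OF h(2,1)] M l by (intro mult_left_mono add_left_mono divide_right_mono) (auto simp: d_def)
      also have "\<dots> \<le> W h"
      proof (cases "bad h")
        case True
        have "l * (1 + (\<Psi> h - 1) / M) \<le> 1 + \<Psi> h / M"
        proof -
          have "\<Psi> h \<le> M" using \<Psi>[OF h(2,1)] by simp
          then have "1 + (\<Psi> h - 1) / M \<le> 2" using M by (simp add: field_simps)
          then have "1 / (2 * M) * (1 + (\<Psi> h - 1) / M) \<le> 1 / (2 * M) * 2"
            using M by (intro mult_left_mono) auto
          then show ?thesis
            unfolding l_def using M by (simp add: field_simps)
        qed
        then have "l ^ bad_count bad h * (l * (1 + (\<Psi> h - 1) / M)) \<le> l ^ bad_count bad h * (1 + \<Psi> h / M)"
          using l by (intro mult_left_mono) auto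
        then show ?thesis
          using True by (simp add: W_def d_def mult_ac)
      qed (simp add: W_def d_def)
      finally show "(\<Sum>s'\<in>S. ?p s' * W (h @ [s'])) \<le> W h" .
    qed
    then show ?case using Suc.IH by simp
  qed
  have "bayes_expect n \<theta> \<pi> s (\<lambda>h. l ^ bad_count bad h) \<le> bayes_expect n \<theta> \<pi> s W"
  proof (rule bayes_expect_mono[OF \<theta> \<pi> s])
    fix h assume "set h \<subseteq> S" "h \<noteq> []"
    then have "1 \<le> 1 + \<Psi> h / M" using \<Psi>[of h] M by simp
    then have "l ^ bad_count bad h * 1 \<le> l ^ bad_count bad h * (1 + \<Psi> h / M)"
      using l by (intro mult_left_mono) auto
    then show "l ^ bad_count bad h \<le> W h" by (simp add: W_def)
  qed
  with W show ?thesis unfolding l_def[symmetric] by simp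
qed

text \<open>Markov's inequality for \<open>l ^ bad_count bad h\<close>, whose mean is at most 2: the
  count exceeds K with probability at most 2 * l powr (- K). As ln l \<ge> 1 / (4 * M), the
  assumption on K makes this at most \<delta>. Counts grow with n, so the bound passes to the limit
  by continuity from below, without a union bound.\<close>

lemma bad_count_tail:
  assumes \<theta>: "positive_params S A \<theta>" and \<pi>: "admissible S A \<pi>" and s: "s \<in> S" and M: "1 \<le> M"
    and \<Psi>: "\<And>h. h \<noteq> [] \<Longrightarrow> set h \<subseteq> S \<Longrightarrow> 0 \<le> \<Psi> h \<and> \<Psi> h \<le> M"
    and drift: "\<And>h. h \<noteq> [] \<Longrightarrow> set h \<subseteq> S \<Longrightarrow>
      (\<Sum>s'\<in>S. predictive S (posterior \<theta> \<pi> h) (last h) (\<pi> h) s' * \<Psi> (h @ [s'])) \<le> \<Psi> h - of_bool (bad h)"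
    and pos: "\<And>h. positive_params S A (posterior \<theta> \<pi> h)"
    and \<delta>: "0 < \<delta>" "\<delta> < 1" and K: "4 * M * ln (2 / \<delta>) \<le> K"
  shows "1 - \<delta> \<le> measure (bayes_law S A \<theta> \<pi> s)
    {\<omega> \<in> space (bayes_law S A \<theta> \<pi> s). emeasure (count_space UNIV) {t. bad (history \<omega> t)} \<le> ennreal K}"
proof -
  let ?P = "bayes_law S A \<theta> \<pi> s"
  interpret prob_space ?P by (rule prob_space_bayes_law[OF \<theta> \<pi> s])
  define l where "l = 1 + 1 / (2 * M)"
  have l: "1 < l" using M by (simp add: l_def)
  have K0: "0 \<le> K"
  proof -
    have "0 \<le> 4 * M * ln (2 / \<delta>)" using M \<delta> by (intro mult_nonneg_nonneg ln_ge_zero) auto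
    then show ?thesis using K by simp
  qed
  \<comment> \<open>From ln l \<ge> 1 - 1 / l = 1 / (2 * M + 1), where 2 * M + 1 \<le> 4 * M because
    M \<ge> 1.\<close>
  have ln_l: "1 / (4 * M) \<le> ln l"
  proof -
    have "ln (1 / l) \<le> 1 / l - 1" using l by (intro ln_le_minus_one) auto
    then have "1 - 1 / l \<le> ln l" using l by (simp add: ln_div)
    moreover have "1 / (4 * M) \<le> 1 - 1 / l"
    proof -
      have "1 / l = 2 * M / (2 * M + 1)" using M by (simp add: l_def field_simps)
      then have "1 - 1 / l = 1 / (2 * M + 1)" using M by (simp add: field_simps)
      then show ?thesis using M by (simp add: frac_le)
    qed
    ultimately show ?thesis by simp
  qed
  define q where "q = l powr (- K)"
  have q: "2 * q \<le> \<delta>"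
  proof -
    have "ln (2 / \<delta>) = 4 * M * ln (2 / \<delta>) * (1 / (4 * M))" using M by simp
    also have "\<dots> \<le> K * ln l"
      using K ln_l K0 M by (intro mult_mono) auto
    finally have "exp (- (K * ln l)) \<le> exp (- ln (2 / \<delta>))" by simp
    also have "\<dots> = \<delta> / 2" using \<delta> by (simp add: exp_minus exp_ln)
    finally show ?thesis using l by (simp add: q_def powr_def)
  qed
  have q0: "0 < q" using l by (simp add: q_def)
  define E where "E n = {\<omega> \<in> space ?P. K < real (bad_count bad (history \<omega> n))}" for n
  have E: "E n \<in> sets ?P" for n
  proof -
    have "(\<lambda>\<omega>. real (bad_count bad (history \<omega> n))) \<in> borel_measurable ?P"
      unfolding measurable_cong_sets[OF sets_bayes_law[OF \<theta> \<pi> s] refl] by (rule measurable_history)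
    then show ?thesis unfolding E_def by measurable
  qed
  have mono: "incseq E"
  proof (rule incseq_SucI, rule subsetI)
    fix n \<omega> assume "\<omega> \<in> E n"
    moreover have "bad_count bad (history \<omega> n) \<le> bad_count bad (history \<omega> (Suc n))"
      unfolding bad_count_history by (intro card_mono) auto
    ultimately show "\<omega> \<in> E (Suc n)"
      unfolding E_def by (auto simp del: upt_Suc)
  qed
  have le: "prob (E n) \<le> \<delta>" for n
  proof -
    have "emeasure ?P (E n) = (\<integral>\<^sup>+\<omega>. indicator (E n) \<omega> \<partial>?P)"
      using E by simp
    \<comment> \<open>The summand 0 gives the integrand the affine form that
      \<open>bayes_expect_affine\<close> expects.\<close>
    also have "\<dots> \<le> (\<integral>\<^sup>+\<omega>. ennreal ((\<lambda>h. 0 + q * l ^ bad_count bad h) (history \<omega> n)) \<partial>?P)"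
    proof (rule nn_integral_mono)
      fix \<omega>
      show "indicator (E n) \<omega> \<le> ennreal ((\<lambda>h. 0 + q * l ^ bad_count bad h) (history \<omega> n))"
      proof (cases "\<omega> \<in> E n")
        case True
        let ?b = "bad_count bad (history \<omega> n)"
        have "K < real ?b" using True by (simp add: E_def del: upt_Suc)
        then have "1 \<le> l powr (real ?b - K)" using l by (intro ge_one_powr_ge_zero) auto
        also have "\<dots> = q * l ^ ?b"
          using l by (simp add: q_def powr_diff powr_minus powr_realpow field_simps del: upt_Suc)
        finally show ?thesis using True by (simp del: upt_Suc)
      qed simp
    qed
    also have "\<dots> = ennreal (bayes_expect n \<theta> \<pi> s (\<lambda>h. 0 + q * l ^ bad_count bad h))"
      using l q0 by (intro nn_integral_bayes_law[OF \<theta> \<pi> s]) auto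
    also have "\<dots> \<le> ennreal \<delta>"
    proof (rule ennreal_leI)
      have "bayes_expect n \<theta> \<pi> s (\<lambda>h. 0 + q * l ^ bad_count bad h) =
          0 + q * bayes_expect n \<theta> \<pi> s (\<lambda>h. l ^ bad_count bad h)"
        by (rule bayes_expect_affine[OF \<theta> \<pi> s])
      also have "\<dots> \<le> q * 2"
        using bayes_expect_bad_count[OF \<theta> \<pi> s _ \<Psi> drift pos, of n] M q0
        by (simp add: l_def)
      finally show "bayes_expect n \<theta> \<pi> s (\<lambda>h. 0 + q * l ^ bad_count bad h) \<le> \<delta>"
        using q by simp
    qed
    finally show ?thesis
      using \<delta> by (simp add: emeasure_eq_measure)
  qed
  have "(\<lambda>n. prob (E n)) \<longlonglongrightarrow> prob (\<Union>n. E n)"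
    using E mono by (intro finite_Lim_measure_incseq) auto
  then have "prob (\<Union>n. E n) \<le> \<delta>"
    using le by (intro LIMSEQ_le_const2) auto
  moreover have "{\<omega> \<in> space ?P. emeasure (count_space UNIV) {t. bad (history \<omega> t)} \<le> ennreal K} =
      space ?P - (\<Union>n. E n)"
    unfolding emeasure_count_le_iff[OF K0] E_def bad_count_history by (auto simp: linorder_not_less[symmetric] simp del: upt_Suc)
  moreover have "prob (space ?P - (\<Union>n. E n)) = 1 - prob (\<Union>n. E n)"
    using E by (intro prob_compl) auto
  ultimately show ?thesis by simp
qed

end

section \<open>The number of suboptimal steps\<close>

lemma log_potential_drop:
  fixes c q y :: real
  assumes "0 \<le> c" "0 < q" "1 \<le> y"
  shows "max 0 (c / (2 * y) - c / (2 * q)) \<le>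
    c * max 0 (ln ((q + 1) / y)) - c * max 0 (ln ((q + 1) / (y + 1)))"
proof (cases "y < q")
  case True
  have "0 \<le> ln ((q + 1) / y)" "0 \<le> ln ((q + 1) / (y + 1))"
    using True assms by (auto intro!: ln_ge_zero simp: le_divide_eq)
  then have "c * max 0 (ln ((q + 1) / y)) - c * max 0 (ln ((q + 1) / (y + 1))) = c * ln ((y + 1) / y)"
    using assms by (simp add: ln_div algebra_simps)
  moreover have "c * (1 / (2 * y)) \<le> c * ln ((y + 1) / y)"
  proof (rule mult_left_mono[OF _ assms(1)])
    have "ln (y / (y + 1)) \<le> y / (y + 1) - 1"
      using assms by (intro ln_le_minus_one) auto
    then have "1 - y / (y + 1) \<le> ln ((y + 1) / y)"
      using assms by (simp add: ln_div)
    moreover have "1 - y / (y + 1) = 1 / (y + 1)"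
      using assms by (simp add: field_simps)
    moreover have "1 / (2 * y) \<le> 1 / (y + 1)"
      using assms by (intro frac_le) auto
    ultimately show "1 / (2 * y) \<le> ln ((y + 1) / y)" by simp
  qed
  moreover have "0 \<le> c * (1 / (2 * y))" "0 \<le> c / (2 * q)"
    using assms by auto
  ultimately show ?thesis by simp
next
  case False
  have "c / (2 * y) \<le> c / (2 * q)"
    using False assms by (intro divide_left_mono) auto
  moreover have "c * max 0 (ln ((q + 1) / (y + 1))) \<le> c * max 0 (ln ((q + 1) / y))"
  proof (intro mult_left_mono max.mono order_refl assms(1))
    show "ln ((q + 1) / (y + 1)) \<le> ln ((q + 1) / y)"
      using assms by (intro ln_mono divide_left_mono divide_pos_pos mult_pos_pos) auto
  qed
  ultimately show ?thesis by simp
qed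

context discounted_problem
begin

definition suboptimal :: "real \<Rightarrow> ('s, 'a) params \<Rightarrow> ('s, 'a) policy \<Rightarrow> 's list \<Rightarrow> bool" where
  "suboptimal \<epsilon> \<theta> \<pi> h \<longleftrightarrow>
     \<not> value_after \<theta> \<pi> h \<ge> opt_bayes_value S A R \<gamma> (last h) (posterior \<theta> \<pi> h) - \<epsilon>"

text \<open>Upper bound of the potential \<Psi>, hence of the expected number of bad steps: one
  logarithmic term for each state-action pair, an offset 1 / (1 - \<gamma>) that keeps \<Psi>
  nonnegative, and the factor that scales the drop at a bad step to 1.\<close>

definition expected_bad_bound :: "real \<Rightarrow> nat \<Rightarrow> real" where
  "expected_bad_bound \<epsilon> H =
     (real (card S) * real (card A) * (4 * real H / (1 - \<gamma>) * ln (1 + 8 / (\<epsilon> * (1 - \<gamma>)\<^sup>2))) + 1 / (1 - \<gamma>)) *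
     (4 / ((1 - \<gamma>) * \<epsilon>))"

lemma bolt_suboptimal_tail:
  assumes \<theta>: "positive_params S A \<theta>" and planner: "bolt_planner S A R \<gamma> (real H) H \<theta> pl"
    and \<pi>: "\<pi> = bolt_policy H pl" and H: "0 < H" and s: "s \<in> S"
    and \<epsilon>: "0 < \<epsilon>" "\<epsilon> * (1 - \<gamma>) \<le> 1" and horizon: "\<gamma> ^ H / (1 - \<gamma>) \<le> \<epsilon> / 2"
    and \<delta>: "0 < \<delta>" "\<delta> < 1" and K: "4 * expected_bad_bound \<epsilon> H * ln (2 / \<delta>) \<le> K"
  shows "1 - \<delta> \<le> measure (bayes_law S A \<theta> \<pi> s)
    {\<omega> \<in> space (bayes_law S A \<theta> \<pi> s).
      emeasure (count_space UNIV) {t. suboptimal \<epsilon> \<theta> \<pi> (history \<omega> t)} \<le> ennreal K}"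
proof -
  define u where "u = 1 / (1 - \<gamma>)"
  have u: "1 \<le> u" using discount by (simp add: u_def)
  \<comment> \<open>With y = N + H these make c / (2 * y) the error 2 * H / ((1 - \<gamma>) * y),
    and q the value of y at which that error has fallen to (1 - \<gamma>) * \<epsilon> / 4.\<close>
  define c where "c = 4 * real H * u"
  define q where "q = 8 * real H / (\<epsilon> * (1 - \<gamma>)\<^sup>2)"
  define G where "G x = c * max 0 (ln ((q + 1) / (x + real H)))" for x
  define e where "e x = max 0 (2 * real H / ((1 - \<gamma>) * (x + real H)) - (1 - \<gamma>) * (\<epsilon> / 4))" for x
  define N where "N h sa = (\<Sum>s'\<in>S. posterior \<theta> \<pi> h sa s')" for h sa
  define Pot where "Pot h = (\<Sum>sa\<in>S \<times> A. G (N h sa))" for h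
  define V where "V h = bolt_value S A R \<gamma> (real H) (posterior \<theta> \<pi> h) H (last h)" for h
  \<comment> \<open>A bad step has a gap above \<epsilon> / 2; half of this is given up to absorb
    the errors that never die out, and \<epsilon> / 4 remains as a lower bound for Z.\<close>
  define Z where "Z h = max 0 (V h - value_after \<theta> \<pi> h - \<epsilon> / 4)" for h
  define \<kappa> where "\<kappa> = 4 / ((1 - \<gamma>) * \<epsilon>)"
  define \<Psi> where "\<Psi> h = (Pot h - \<gamma> * Z h + u) * \<kappa>" for h
  have H1: "1 \<le> real H" using H by simp
  have c: "0 \<le> c" using u by (simp add: c_def)
  have q: "0 < q" using H1 \<epsilon> discount by (simp add: q_def)
  have \<kappa>: "0 < \<kappa>" using \<epsilon> discount by (simp add: \<kappa>_def)
  have adm: "admissible S A \<pi>"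
    unfolding \<pi> by (rule bolt_policy_admissible[OF planner])
  have post: "positive_params S A (posterior \<theta> \<pi> h)" for h
    by (rule positive_params_posterior[OF \<theta>])
  have N0: "0 < N h sa" if "sa \<in> S \<times> A" for h sa
    using that sum_params_pos[OF post[of h], of "fst sa" "snd sa"] by (auto simp: N_def)
  have G_drop: "e x \<le> G x - G (x + 1)" if "0 < x" for x
  proof -
    have eq: "c / (2 * z) = 2 * real H / ((1 - \<gamma>) * z)" for z
      by (simp add: c_def u_def)
    have eq': "c / (2 * q) = (1 - \<gamma>) * (\<epsilon> / 4)"
      using H1 \<epsilon> discount by (simp add: c_def u_def q_def power2_eq_square field_simps)
    have "1 \<le> x + real H" and shift: "x + 1 + real H = x + real H + 1"
      using that H1 by simp_all
    from log_potential_drop[OF c q this(1)] show ?thesis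
      unfolding e_def G_def shift eq' unfolding eq .
  qed
  have G_bounds: "0 \<le> G x" "G x \<le> c * ln (1 + 8 / (\<epsilon> * (1 - \<gamma>)\<^sup>2))" if "0 < x" for x
  proof -
    show "0 \<le> G x" using c by (simp add: G_def)
    have B: "0 < 8 / (\<epsilon> * (1 - \<gamma>)\<^sup>2)" using \<epsilon> discount by simp
    have "(q + 1) / (x + real H) \<le> (q + 1) / real H"
      using that H1 q by (intro divide_left_mono) auto
    also have "\<dots> \<le> 1 + 8 / (\<epsilon> * (1 - \<gamma>)\<^sup>2)"
      using H1 by (simp add: q_def add_divide_distrib)
    finally have "ln ((q + 1) / (x + real H)) \<le> ln (1 + 8 / (\<epsilon> * (1 - \<gamma>)\<^sup>2))"
      using that q H1 B by (intro ln_mono) (auto intro!: divide_pos_pos)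
    then show "G x \<le> c * ln (1 + 8 / (\<epsilon> * (1 - \<gamma>)\<^sup>2))"
      unfolding G_def using c B by (intro mult_left_mono) auto
  qed
  have Pot_bounds: "0 \<le> Pot h"
    "Pot h \<le> real (card S) * real (card A) * (c * ln (1 + 8 / (\<epsilon> * (1 - \<gamma>)\<^sup>2)))" for h
  proof -
    show "0 \<le> Pot h"
      unfolding Pot_def using N0 by (intro sum_nonneg G_bounds)
    have "Pot h \<le> (\<Sum>sa\<in>S \<times> A. c * ln (1 + 8 / (\<epsilon> * (1 - \<gamma>)\<^sup>2)))"
      unfolding Pot_def using N0 by (intro sum_mono G_bounds)
    then show "Pot h \<le> real (card S) * real (card A) * (c * ln (1 + 8 / (\<epsilon> * (1 - \<gamma>)\<^sup>2)))"
      by (simp add: card_cartesian_product)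
  qed
  have Z_bounds: "0 \<le> Z h" "\<gamma> * Z h \<le> u" if h: "h \<noteq> []" "set h \<subseteq> S" for h
  proof -
    have last: "last h \<in> S" using h by auto
    show "0 \<le> Z h" by (simp add: Z_def)
    have "V h \<le> u"
      unfolding V_def u_def using bolt_value_bounds[OF post _ last] by simp
    moreover have "0 \<le> value_after \<theta> \<pi> h"
      by (rule bayes_value_nonneg[OF post admissible_policy_after[OF adm h(2)] last])
    ultimately have "Z h \<le> u" using u \<epsilon> by (simp add: Z_def)
    then have "\<gamma> * Z h \<le> 1 * u"
      using discount \<open>0 \<le> Z h\<close> u by (intro mult_mono) auto
    then show "\<gamma> * Z h \<le> u" by simp
  qed
  have M_eq: "expected_bad_bound \<epsilon> H =
      (real (card S) * real (card A) * (c * ln (1 + 8 / (\<epsilon> * (1 - \<gamma>)\<^sup>2))) + u) * \<kappa>"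
    by (simp add: expected_bad_bound_def c_def u_def \<kappa>_def)
  have \<Psi>_bounds: "0 \<le> \<Psi> h \<and> \<Psi> h \<le> expected_bad_bound \<epsilon> H" if h: "h \<noteq> []" "set h \<subseteq> S" for h
  proof
    show "0 \<le> \<Psi> h"
      unfolding \<Psi>_def using Z_bounds[OF h] Pot_bounds(1)[of h] \<kappa> by simp
    have "0 \<le> \<gamma> * Z h" using Z_bounds[OF h] discount by simp
    then show "\<Psi> h \<le> expected_bad_bound \<epsilon> H"
      unfolding \<Psi>_def M_eq using Pot_bounds(2)[of h] \<kappa> by (intro mult_right_mono) auto
  qed
  have M1: "1 \<le> expected_bad_bound \<epsilon> H"
  proof -
    have "1 \<le> u * \<kappa>"
    proof -
      have "1 * 4 \<le> u * \<kappa>"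
        using u \<epsilon> discount by (intro mult_mono) (auto simp: \<kappa>_def le_divide_eq mult.commute)
      then show ?thesis by simp
    qed
    also have "\<dots> \<le> expected_bad_bound \<epsilon> H"
      unfolding M_eq using Pot_bounds[of "[]"] \<kappa> by (intro mult_right_mono) auto
    finally show ?thesis .
  qed
  have drift: "(\<Sum>s'\<in>S. predictive S (posterior \<theta> \<pi> h) (last h) (\<pi> h) s' * \<Psi> (h @ [s'])) \<le>
      \<Psi> h - of_bool (suboptimal \<epsilon> \<theta> \<pi> h)" if h: "h \<noteq> []" "set h \<subseteq> S" for h
  proof -
    define sa where "sa = (last h, \<pi> h)"
    have last: "last h \<in> S" and a: "\<pi> h \<in> A"
      using h admissibleD[OF adm h] by auto
    let ?p = "\<lambda>s'. predictive S (posterior \<theta> \<pi> h) (last h) (\<pi> h) s'"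
    have p0: "0 \<le> ?p s'" if "s' \<in> S" for s'
      by (rule predictive_nonneg[OF post last a that])
    have p1: "(\<Sum>s'\<in>S. ?p s') = 1"
      by (rule sum_predictive[OF post last a])
    have avg: "(\<Sum>s'\<in>S. ?p s' * (x + y * f s')) = x + y * (\<Sum>s'\<in>S. ?p s' * f s')" for x y f
    proof -
      have "(\<Sum>s'\<in>S. ?p s' * (x + y * f s')) = x * (\<Sum>s'\<in>S. ?p s') + y * (\<Sum>s'\<in>S. ?p s' * f s')"
        by (simp add: algebra_simps sum.distrib sum_distrib_left)
      then show ?thesis by (simp add: p1)
    qed
    have Pot_step: "Pot (h @ [s']) \<le> Pot h - e (N h sa)" if s': "s' \<in> S" for s'
    proof -
      have sa: "sa \<in> S \<times> A" "finite (S \<times> A)"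
        using last a finite_S finite_A by (auto simp: sa_def)
      have N': "N (h @ [s']) x = N h x + (if x = sa then 1 else 0)" for x
        using sum_bayes_update[OF s', of "posterior \<theta> \<pi> h" "last h" "\<pi> h" x "\<lambda>_. 1"] h
        by (simp add: N_def posterior_snoc sa_def)
      have "Pot (h @ [s']) = G (N h sa + 1) + (\<Sum>x\<in>S \<times> A - {sa}. G (N h x))"
        unfolding Pot_def using sa by (subst sum.remove[of _ sa]) (auto simp: N' intro!: sum.cong)
      moreover have "Pot h = G (N h sa) + (\<Sum>x\<in>S \<times> A - {sa}. G (N h x))"
        unfolding Pot_def using sa by (subst sum.remove[of _ sa]) auto
      ultimately show ?thesis
        using G_drop[OF N0[OF sa(1), of h]] by simp
    qed
    have Z_step: "Z h \<le> e (N h sa) + \<gamma> * (\<Sum>s'\<in>S. ?p s' * Z (h @ [s']))"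
    proof -
      have "V h - value_after \<theta> \<pi> h \<le>
          (\<Sum>s'\<in>S. ?p s' * (R (last h) (\<pi> h) s' + \<gamma> * V (h @ [s']))) + 2 * real H / ((1 - \<gamma>) * (N h sa + real H)) -
          (\<Sum>s'\<in>S. ?p s' * (R (last h) (\<pi> h) s' + \<gamma> * value_after \<theta> \<pi> (h @ [s'])))"
        using bolt_value_along_run[OF \<theta> planner \<pi> H h] value_after_bellman[OF \<theta> adm h]
        unfolding V_def N_def sa_def by linarith
      also have "\<dots> = 2 * real H / ((1 - \<gamma>) * (N h sa + real H)) +
          (\<Sum>s'\<in>S. ?p s' * (0 + \<gamma> * (V (h @ [s']) - value_after \<theta> \<pi> (h @ [s']))))"
        by (simp add: algebra_simps sum.distrib sum_subtractf)
      also have "(\<Sum>s'\<in>S. ?p s' * (0 + \<gamma> * (V (h @ [s']) - value_after \<theta> \<pi> (h @ [s'])))) \<le>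
          (\<Sum>s'\<in>S. ?p s' * (\<gamma> * (\<epsilon> / 4) + \<gamma> * Z (h @ [s'])))"
        unfolding distrib_left[symmetric] add_0
        using discount p0 by (intro sum_mono mult_left_mono) (auto simp: Z_def)
      also have "\<dots> = \<gamma> * (\<epsilon> / 4) + \<gamma> * (\<Sum>s'\<in>S. ?p s' * Z (h @ [s']))"
        by (rule avg)
      finally have "V h - value_after \<theta> \<pi> h \<le> 2 * real H / ((1 - \<gamma>) * (N h sa + real H)) +
          (\<gamma> * (\<epsilon> / 4) + \<gamma> * (\<Sum>s'\<in>S. ?p s' * Z (h @ [s'])))"
        by simp
      \<comment> \<open>Of the \<epsilon> / 4 subtracted on the left, \<gamma> * \<epsilon> / 4
        returns through the successors. The difference is what may be taken off the error, hence the
        constant in e.\<close>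
      moreover have "(1 - \<gamma>) * (\<epsilon> / 4) = \<epsilon> / 4 - \<gamma> * (\<epsilon> / 4)"
        by (simp add: left_diff_distrib)
      ultimately have "V h - value_after \<theta> \<pi> h - \<epsilon> / 4 \<le>
          (2 * real H / ((1 - \<gamma>) * (N h sa + real H)) - (1 - \<gamma>) * (\<epsilon> / 4)) + \<gamma> * (\<Sum>s'\<in>S. ?p s' * Z (h @ [s']))"
        by linarith
      \<comment> \<open>Since e is nonnegative as well, the right side is nonnegative and bounds the
        positive part Z, not just the difference.\<close>
      moreover have "0 \<le> \<gamma> * (\<Sum>s'\<in>S. ?p s' * Z (h @ [s']))"
        using discount p0 by (intro mult_nonneg_nonneg sum_nonneg) (auto simp: Z_def)
      ultimately show ?thesis
        unfolding Z_def[of h] e_def by (auto simp: max_def)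
    qed
    have bad: "\<epsilon> / 4 * of_bool (suboptimal \<epsilon> \<theta> \<pi> h) \<le> Z h"
    proof (cases "suboptimal \<epsilon> \<theta> \<pi> h")
      case True
      then have "value_after \<theta> \<pi> h < V h + \<epsilon> / 2 - \<epsilon>"
        using bolt_value_optimistic[OF post last, of h H] horizon
        unfolding suboptimal_def V_def by linarith
      then have "\<epsilon> / 4 \<le> Z h"
        unfolding Z_def by (intro max.coboundedI2) simp
      then show ?thesis using True by simp
    qed (simp add: Z_def)
    have "(\<Sum>s'\<in>S. ?p s' * \<Psi> (h @ [s'])) \<le>
        (\<Sum>s'\<in>S. ?p s' * ((Pot h - e (N h sa) + u) * \<kappa> + (- \<gamma> * \<kappa>) * Z (h @ [s'])))"
    proof (intro sum_mono mult_left_mono p0)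
      fix s' assume "s' \<in> S"
      from mult_right_mono[OF Pot_step[OF this] less_imp_le[OF \<kappa>]]
      show "\<Psi> (h @ [s']) \<le> (Pot h - e (N h sa) + u) * \<kappa> + (- \<gamma> * \<kappa>) * Z (h @ [s'])"
        unfolding \<Psi>_def by (simp add: algebra_simps)
    qed
    also have "\<dots> = (Pot h - (e (N h sa) + \<gamma> * (\<Sum>s'\<in>S. ?p s' * Z (h @ [s']))) + u) * \<kappa>"
      unfolding avg by (simp add: algebra_simps)
    also have "\<dots> \<le> (Pot h - Z h + u) * \<kappa>"
      using Z_step \<kappa> by (intro mult_right_mono) auto
    also have "\<dots> = \<Psi> h - (1 - \<gamma>) * \<kappa> * Z h"
      by (simp add: \<Psi>_def algebra_simps)
    also have "\<dots> \<le> \<Psi> h - of_bool (suboptimal \<epsilon> \<theta> \<pi> h)"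
    proof -
      have "(1 - \<gamma>) * \<kappa> * (\<epsilon> / 4 * of_bool (suboptimal \<epsilon> \<theta> \<pi> h)) \<le> (1 - \<gamma>) * \<kappa> * Z h"
        using bad \<kappa> discount by (intro mult_left_mono) auto
      moreover have "(1 - \<gamma>) * \<kappa> * (\<epsilon> / 4) = 1"
        using \<epsilon> discount by (simp add: \<kappa>_def)
      ultimately show ?thesis by (simp add: mult.assoc[symmetric])
    qed
    finally show ?thesis .
  qed
  show ?thesis
    by (rule bad_count_tail[OF \<theta> adm s M1 \<Psi>_bounds drift post \<delta> K])
qed

end

text \<open>The potential bound is of order n * H * u * y up to a logarithm, with u = 1 / (1 -
  \<gamma>) and y = 1 / (\<epsilon> * (1 - \<gamma>)). Exchanging u for 2 * H and using y \<ge> 1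
  once more gives g. The constant is 704 = 64 * 10 + 16 * 4.\<close>

lemma expected_bad_bound_soft:
  fixes \<gamma> \<epsilon> n :: real and H :: nat
  assumes \<gamma>: "0 \<le> \<gamma>" "\<gamma> < 1" and \<epsilon>: "0 < \<epsilon>" "\<epsilon> * (1 - \<gamma>) \<le> 1"
    and H: "1 \<le> H" and horizon: "\<gamma> ^ H / (1 - \<gamma>) \<le> \<epsilon> / 2" and n: "1 \<le> n"
  defines "g \<equiv> n * (real H)\<^sup>2 / (\<epsilon>\<^sup>2 * (1 - \<gamma>)\<^sup>2)"
  shows "4 * ((n * (4 * real H / (1 - \<gamma>) * ln (1 + 8 / (\<epsilon> * (1 - \<gamma>)\<^sup>2))) + 1 / (1 - \<gamma>)) * (4 / ((1 - \<gamma>) * \<epsilon>)))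
    \<le> 704 * g * ln (2 + g)" and "1 \<le> g"
proof -
  define u where "u = 1 / (1 - \<gamma>)"
  define y where "y = 1 / (\<epsilon> * (1 - \<gamma>))"
  have u: "1 \<le> u" and y: "1 \<le> y"
    using \<gamma> \<epsilon> by (simp_all add: u_def y_def)
  have H1: "1 \<le> real H" using H by simp
  have g: "g = n * (real H)\<^sup>2 * y\<^sup>2"
    by (simp add: g_def y_def power_mult_distrib power_divide)
  \<comment> \<open>Bernoulli gives 1 - H * (1 - \<gamma>) \<le> \<gamma> ^ H \<le> 1 / 2: a horizon
    that halves the discount is at least half of 1 / (1 - \<gamma>).\<close>
  have uH: "u \<le> 2 * real H"
  proof -
    have "\<gamma> ^ H \<le> 1 / 2"
    proof -
      have "\<gamma> ^ H \<le> \<epsilon> / 2 * (1 - \<gamma>)" using horizon \<gamma> by (simp add: divide_le_eq)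
      then show ?thesis using \<epsilon> by simp
    qed
    moreover have "1 + real H * (- (1 - \<gamma>)) \<le> (1 + - (1 - \<gamma>)) ^ H"
      using \<gamma> by (intro Bernoulli_inequality) auto
    ultimately have "1 / 2 \<le> real H * (1 - \<gamma>)" by (simp add: algebra_simps)
    then show ?thesis using \<gamma> by (simp add: u_def divide_le_eq)
  qed
  have Hy: "1 \<le> real H * y" using mult_mono[OF H1 y] by simp
  have Hyg: "real H * y \<le> g"
  proof -
    have "real H * y * 1 \<le> real H * y * (real H * y)"
      using Hy by (intro mult_left_mono) auto
    also have "\<dots> = 1 * ((real H)\<^sup>2 * y\<^sup>2)" by (simp add: power2_eq_square)
    also have "\<dots> \<le> n * ((real H)\<^sup>2 * y\<^sup>2)"
      using n by (intro mult_right_mono) auto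
    finally show ?thesis by (simp add: g)
  qed
  show g1: "1 \<le> g" using Hy Hyg by simp
  define l where "l = ln (2 + g)"
  have l: "1 / 2 \<le> l"
  proof -
    have "1 / 2 \<le> ln (2 :: real)" using ln2_ge_two_thirds by simp
    also have "\<dots> \<le> l" unfolding l_def using g1 by (intro ln_mono) auto
    finally show ?thesis .
  qed
  have eq: "8 / (\<epsilon> * (1 - \<gamma>)\<^sup>2) = 8 * (u * y)"
    by (simp add: u_def y_def power2_eq_square)
  have uy: "u * y \<le> 2 * (real H * y)"
    using uH y by (simp add: mult_right_mono flip: mult.assoc)
  \<comment> \<open>The argument is at most 16 * (2 + g) \<le> (2 + g) ^ 5, so the logarithm of the
    potential is absorbed by the logarithm of g in the soft bound.\<close>
  have L: "ln (1 + 8 * (u * y)) \<le> 5 * l"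
  proof -
    have "1 + 8 * (u * y) \<le> 16 * (2 + g)" using uy Hyg by simp
    also have "(16 :: real) \<le> (2 + g) ^ 4"
      using power_mono[of 2 "2 + g" 4] g1 by simp
    then have "16 * (2 + g) \<le> (2 + g) ^ 4 * (2 + g)"
      using g1 by (intro mult_right_mono) auto
    also have "\<dots> = (2 + g) ^ 5" by (simp add: power_numeral_reduce)
    finally have "ln (1 + 8 * (u * y)) \<le> ln ((2 + g) ^ 5)"
      using u y by (intro ln_mono) (auto intro!: add_pos_nonneg)
    also have "\<dots> = 5 * l" using g1 by (simp add: l_def ln_realpow)
    finally show ?thesis .
  qed
  have "4 * ((n * (4 * real H / (1 - \<gamma>) * ln (1 + 8 / (\<epsilon> * (1 - \<gamma>)\<^sup>2))) + 1 / (1 - \<gamma>)) * (4 / ((1 - \<gamma>) * \<epsilon>))) =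
     4 * ((n * (4 * real H * u * ln (1 + 8 * (u * y))) + u) * (4 * y))"
    unfolding eq by (simp add: u_def y_def mult.commute)
  also have "\<dots> = 64 * (n * real H * (u * y) * ln (1 + 8 * (u * y))) + 16 * (u * y)"
    by (simp add: algebra_simps)
  also have "\<dots> \<le> 64 * (10 * (g * l)) + 16 * (4 * (g * l))"
  proof (intro add_mono mult_left_mono)
    have "n * real H * (u * y) \<le> n * real H * (2 * (real H * y))"
      using n H1 by (intro mult_left_mono uy) auto
    moreover have "0 \<le> n * real H * (2 * (real H * y))" "0 \<le> ln (1 + 8 * (u * y))"
      using n H1 y u by auto
    ultimately have "n * real H * (u * y) * ln (1 + 8 * (u * y)) \<le> n * real H * (2 * (real H * y)) * (5 * l)"
      by (rule mult_mono[OF _ L])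
    also have "\<dots> = 10 * (n * (real H)\<^sup>2 * y) * l"
      by (simp add: power2_eq_square)
    also have "\<dots> \<le> 10 * g * l"
    proof (intro mult_right_mono mult_left_mono)
      have "n * (real H)\<^sup>2 * (y * 1) \<le> n * (real H)\<^sup>2 * (y * y)"
        using n y by (intro mult_left_mono) auto
      then show "n * (real H)\<^sup>2 * y \<le> g" by (simp add: g power2_eq_square)
    qed (use l in auto)
    finally show "n * real H * (u * y) * ln (1 + 8 * (u * y)) \<le> 10 * (g * l)" by simp
    have "g * (1 / 2) \<le> g * l" using l g1 by (intro mult_left_mono) auto
    then show "u * y \<le> 4 * (g * l)" using uy Hyg by simp
  qed auto
  also have "\<dots> = 704 * g * ln (2 + g)" by (simp add: l_def)
  finally show "4 * ((n * (4 * real H / (1 - \<gamma>) * ln (1 + 8 / (\<epsilon> * (1 - \<gamma>)\<^sup>2))) + 1 / (1 - \<gamma>)) * (4 / ((1 - \<gamma>) * \<epsilon>)))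
    \<le> 704 * g * ln (2 + g)" .
qed

section \<open>Degenerate cases and the final count\<close>

context discounted_problem
begin

text \<open>Admissible policies may still differ on lists that leave S, hence the recursion over
  histories in S. The case is set apart because for |S||A| = 1 the confidence logarithm ln (1 /
  \<delta>) is smaller than ln (2 / \<delta>) from the tail bound.\<close>

lemma bayes_value_single_action:
  assumes "card A = 1" "positive_params S A \<theta>" "admissible S A \<pi>" "admissible S A \<rho>" "s \<in> S"
  shows "bayes_value S A R \<gamma> \<pi> s \<theta> = bayes_value S A R \<gamma> \<rho> s \<theta>"
proof -
  obtain a where A: "A = {a}"
    using assms(1) by (rule card_1_singletonE)
  have "bayes_return n \<theta> \<pi> s = bayes_return n \<theta> \<rho> s" for n
    using assms(2-5)
  proof (induction n arbitrary: \<theta> \<pi> \<rho> s)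
    case (Suc n)
    have a: "\<pi> [s] = a" "\<rho> [s] = a"
      using admissibleD[OF Suc.prems(2), of "[s]"] admissibleD[OF Suc.prems(3), of "[s]"] Suc.prems(4) A
      by auto
    have IH: "bayes_return n (bayes_update \<theta> s a s') (\<lambda>h. \<pi> (s # h)) s' =
        bayes_return n (bayes_update \<theta> s a s') (\<lambda>h. \<rho> (s # h)) s'" if "s' \<in> S" for s'
      using Suc.prems that by (intro Suc.IH positive_params_bayes_update admissible_shift)
    show ?case
      unfolding bayes_return_Suc[OF Suc.prems(1,2,4)] bayes_return_Suc[OF Suc.prems(1,3,4)] a
      using IH by (intro sum.cong) auto
  qed simp
  then show ?thesis
    using bayes_return_tendsto[OF assms(2,3,5)] bayes_return_tendsto[OF assms(2,4,5)]
    by (simp add: LIMSEQ_unique)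
qed

text \<open>Either \<epsilon> covers the whole range of values, or all policies have the same
  value.\<close>

lemma not_suboptimal:
  assumes \<theta>: "positive_params S A \<theta>" and \<pi>: "admissible S A \<pi>" and h: "h \<noteq> []" "set h \<subseteq> S"
    and \<epsilon>: "0 < \<epsilon>" and trivial: "1 \<le> \<epsilon> * (1 - \<gamma>) \<or> card A = 1"
  shows "\<not> suboptimal \<epsilon> \<theta> \<pi> h"
proof -
  have last: "last h \<in> S" using h by auto
  note post = positive_params_posterior[OF \<theta>, of \<pi> h]
  note after = admissible_policy_after[OF \<pi> h(2)]
  have "opt_bayes_value S A R \<gamma> (last h) (posterior \<theta> \<pi> h) \<le> value_after \<theta> \<pi> h + \<epsilon>"
  proof (rule opt_bayes_value_le)
    fix \<rho> assume "\<rho> \<in> policies S A"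
    then have \<rho>: "admissible S A \<rho>" by (rule admissible_policies)
    show "bayes_value S A R \<gamma> \<rho> (last h) (posterior \<theta> \<pi> h) \<le> value_after \<theta> \<pi> h + \<epsilon>"
    proof (cases "card A = 1")
      case True
      then show ?thesis
        using bayes_value_single_action[OF True post \<rho> after last] \<epsilon> by simp
    next
      case False
      then have "1 / (1 - \<gamma>) \<le> \<epsilon>"
        using trivial discount by (simp add: divide_le_eq)
      then show ?thesis
        using bayes_value_le[OF post \<rho> last] bayes_value_nonneg[OF post after last] by simp
    qed
  qed
  then show ?thesis by (simp add: suboptimal_def)
qed

lemma horizon_tail: "0 < \<epsilon> \<Longrightarrow> \<gamma> ^ horizon \<gamma> \<epsilon> / (1 - \<gamma>) \<le> \<epsilon> / 2"
  unfolding horizon_def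
proof (rule LeastI_ex)
  assume "0 < \<epsilon>"
  then have "\<forall>\<^sub>F n in sequentially. \<gamma> ^ n / (1 - \<gamma>) < \<epsilon> / 2"
    using order_tendstoD(2)[OF discount_tail_tendsto, of "\<epsilon> / 2"] by simp
  then show "\<exists>n. \<gamma> ^ n / (1 - \<gamma>) \<le> \<epsilon> / 2"
    by (auto simp: eventually_sequentially intro: less_imp_le)
qed

lemma bolt_soft_bound:
  assumes \<theta>: "positive_params S A \<theta>" and planner: "bolt_planner S A R \<gamma> (real H) H \<theta> pl"
    and \<pi>: "\<pi> = bolt_policy H pl" and H: "H = horizon \<gamma> \<epsilon>" and s: "s \<in> S"
    and \<epsilon>: "0 < \<epsilon>" and \<delta>: "0 \<le> \<delta>" "\<delta> < 1"
  defines "n \<equiv> real (card S) * real (card A)"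
  defines "g \<equiv> n * (real H)\<^sup>2 / (\<epsilon>\<^sup>2 * (1 - \<gamma>)\<^sup>2)"
  shows "1 - \<delta> \<le> measure (bayes_law S A \<theta> \<pi> s)
    {\<omega> \<in> space (bayes_law S A \<theta> \<pi> s).
      emeasure (count_space UNIV) {t. suboptimal \<epsilon> \<theta> \<pi> (history \<omega> t)} \<le> soft_bound 704 g n \<delta>}"
    (is "_ \<le> measure ?P ?good")
proof -
  have adm: "admissible S A \<pi>"
    unfolding \<pi> by (rule bolt_policy_admissible[OF planner])
  interpret P: prob_space ?P by (rule prob_space_bayes_law[OF \<theta> adm s])
  have whole: ?thesis if "?good = space ?P"
    unfolding that using \<delta> by (simp add: P.prob_space)
  have hist: "history \<omega> t \<noteq> []" "set (history \<omega> t) \<subseteq> S" if "\<omega> \<in> space ?P" for \<omega> t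
    using that by (auto simp: space_bayes_law[OF \<theta> adm s])
  have cards: "0 < card S" "0 < card A"
    using finite_S S_nonempty finite_A A_nonempty by (auto simp: card_gt_0_iff)
  have "0 < card S * card A" using cards by simp
  \<comment> \<open>In the first case there is no bad step at all, and nothing weaker would do: the
    bound can be 0, namely when H = 0. In the second case H \<ge> 1, g \<ge> 1 and n \<ge>
    2.\<close>
  then have "(1 \<le> \<epsilon> * (1 - \<gamma>) \<or> card S * card A = 1) \<or> \<epsilon> * (1 - \<gamma>) < 1 \<and> 2 \<le> card S * card A"
    by linarith
  then consider "1 \<le> \<epsilon> * (1 - \<gamma>) \<or> card S * card A = 1" | "\<epsilon> * (1 - \<gamma>) < 1" "2 \<le> card S * card A"
    by blast
  then show ?thesis
  proof cases
    case 1
    then have triv: "1 \<le> \<epsilon> * (1 - \<gamma>) \<or> card A = 1" by auto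
    have "{t. suboptimal \<epsilon> \<theta> \<pi> (history \<omega> t)} = {}" if "\<omega> \<in> space ?P" for \<omega>
      using not_suboptimal[OF \<theta> adm hist[OF that] \<epsilon> triv] by blast
    then show ?thesis
      by (intro whole) (auto simp del: upt_Suc)
  next
    case 2
    have n: "2 \<le> n"
    proof -
      have "real 2 \<le> real (card S * card A)" using 2(2) by (rule of_nat_mono)
      then show ?thesis by (simp add: n_def)
    qed
    note horizon = horizon_tail[OF \<epsilon>, folded H]
    have H1: "1 \<le> H"
    proof (rule ccontr)
      assume "\<not> 1 \<le> H"
      then have "H = 0" by simp
      then have "1 / (1 - \<gamma>) \<le> \<epsilon> / 2" using horizon by simp
      then have "1 \<le> \<epsilon> / 2 * (1 - \<gamma>)" using discount by (simp add: divide_le_eq)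
      then show False using 2(1) by simp
    qed
    have M: "4 * expected_bad_bound \<epsilon> H \<le> 704 * g * ln (2 + g)" and g: "1 \<le> g"
      using expected_bad_bound_soft[OF discount \<epsilon> less_imp_le[OF 2(1)] H1 horizon, of n] n
      unfolding expected_bad_bound_def g_def n_def by simp_all
    have l: "0 < 704 * g * ln (2 + g)"
      using g by (intro mult_pos_pos ln_gt_zero) auto
    show ?thesis
    proof (cases "\<delta> = 0")
      case True
      \<comment> \<open>In \<open>ennreal\<close> the product 0 * top is 0, so the bound is infinite
        at \<delta> = 0 only because this factor is positive.\<close>
      have "ennreal (704 * g * ln (2 + g)) \<noteq> 0"
        unfolding ennreal_eq_0_iff using l by linarith
      then have "soft_bound 704 g n \<delta> = top"
        using True by (simp only: soft_bound_def confidence_log_def ennreal_mult_top simp_thms if_True if_False)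
      then show ?thesis by (intro whole) auto
    next
      case False
      then have \<delta>': "0 < \<delta>" using \<delta> by simp
      \<comment> \<open>The 2 stems from the initial value of the supermartingale; n \<ge> 2 lets ln
        (n / \<delta>) absorb it.\<close>
      have ln2: "0 \<le> ln (2 / \<delta>)" "ln (2 / \<delta>) \<le> ln (n / \<delta>)"
        using \<delta> \<delta>' n by (auto intro!: ln_ge_zero ln_mono divide_right_mono)
      have "soft_bound 704 g n \<delta> = ennreal (704 * g * ln (2 + g) * ln (n / \<delta>))"
        unfolding soft_bound_def confidence_log_def using False l ln2 by (simp add: ennreal_mult)
      moreover have "4 * expected_bad_bound \<epsilon> H * ln (2 / \<delta>) \<le> 704 * g * ln (2 + g) * ln (n / \<delta>)"
        by (rule mult_mono[OF M ln2(2) less_imp_le[OF l] ln2(1)])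
      ultimately show ?thesis
        using bolt_suboptimal_tail[OF \<theta> planner \<pi> _ s \<epsilon> less_imp_le[OF 2(1)] horizon \<delta>' \<delta>(2)] H1
        by simp
    qed
  qed
qed

end

theorem theorem5p1:
  shows "\<exists>C::real. 0 < C \<and>
    (\<forall>(S :: 's set) (A :: 'a set) (R :: 's \<Rightarrow> 'a \<Rightarrow> 's \<Rightarrow> real) (\<gamma> :: real) (\<epsilon> :: real) (\<delta> :: real)
       (\<theta>\<^sub>0 :: ('s, 'a) params) (s\<^sub>0 :: 's) (pl :: 's list \<Rightarrow> ('s, 'a) plan)
       (H :: nat) (\<eta> :: real) (\<pi> :: ('s, 'a) policy).
       finite S \<longrightarrow> S \<noteq> {} \<longrightarrow> finite A \<longrightarrow> A \<noteq> {} \<longrightarrow>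
       (\<forall>s\<in>S. \<forall>a\<in>A. \<forall>s'\<in>S. 0 \<le> R s a s' \<and> R s a s' \<le> 1) \<longrightarrow>
       0 \<le> \<gamma> \<longrightarrow> \<gamma> < 1 \<longrightarrow> 0 < \<epsilon> \<longrightarrow> 0 \<le> \<delta> \<longrightarrow> \<delta> < 1 \<longrightarrow>
       (\<forall>s\<in>S. \<forall>a\<in>A. \<forall>s'\<in>S. 0 < \<theta>\<^sub>0 (s, a) s') \<longrightarrow> s\<^sub>0 \<in> S \<longrightarrow>
       H = horizon \<gamma> \<epsilon> \<longrightarrow> \<eta> = real H \<longrightarrow>
       bolt_planner S A R \<gamma> \<eta> H \<theta>\<^sub>0 pl \<longrightarrow> \<pi> = bolt_policy H pl \<longrightarrow>
       measure (bayes_law S A \<theta>\<^sub>0 \<pi> s\<^sub>0)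
         {\<omega> \<in> space (bayes_law S A \<theta>\<^sub>0 \<pi> s\<^sub>0).
            emeasure (count_space UNIV)
              {t. \<not> bayes_value S A R \<gamma> (policy_after \<pi> (history \<omega> t)) (\<omega> t) (posterior \<theta>\<^sub>0 \<pi> (history \<omega> t))
                    \<ge> opt_bayes_value S A R \<gamma> (\<omega> t) (posterior \<theta>\<^sub>0 \<pi> (history \<omega> t)) - \<epsilon>}
            \<le> soft_bound C (real (card S) * real (card A) * \<eta>\<^sup>2 / (\<epsilon>\<^sup>2 * (1 - \<gamma>)\<^sup>2))
                 (real (card S) * real (card A)) \<delta>}
       \<ge> 1 - \<delta>)"
\<comment> \<open>The witness is the constant of \<open>expected_bad_bound_soft\<close>, fixed
  before S, A and all other parameters.\<close>
proof (intro exI[of _ 704] conjI allI impI)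
  fix S :: "'s set" and A :: "'a set" and R :: "'s \<Rightarrow> 'a \<Rightarrow> 's \<Rightarrow> real" and \<gamma> \<epsilon> \<delta> :: real
    and \<theta>\<^sub>0 :: "('s, 'a) params" and s\<^sub>0 :: 's and pl :: "'s list \<Rightarrow> ('s, 'a) plan"
    and H :: nat and \<eta> :: real and \<pi> :: "('s, 'a) policy"
  assume fin: "finite S" "S \<noteq> {}" "finite A" "A \<noteq> {}"
    and R: "\<forall>s\<in>S. \<forall>a\<in>A. \<forall>s'\<in>S. 0 \<le> R s a s' \<and> R s a s' \<le> 1"
    and \<gamma>: "0 \<le> \<gamma>" "\<gamma> < 1" and \<epsilon>: "0 < \<epsilon>" and \<delta>: "0 \<le> \<delta>" "\<delta> < 1"
    and \<theta>: "\<forall>s\<in>S. \<forall>a\<in>A. \<forall>s'\<in>S. 0 < \<theta>\<^sub>0 (s, a) s'" and s: "s\<^sub>0 \<in> S"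
    and H: "H = horizon \<gamma> \<epsilon>" and \<eta>: "\<eta> = real H"
    and planner: "bolt_planner S A R \<gamma> \<eta> H \<theta>\<^sub>0 pl" and \<pi>: "\<pi> = bolt_policy H pl"
  interpret discounted_problem S A R \<gamma>
    using fin R \<gamma> by unfold_locales auto
  have last: "last (history \<omega> t) = \<omega> t" for \<omega> :: "nat \<Rightarrow> 's" and t
    by simp
  have "positive_params S A \<theta>\<^sub>0"
    using \<theta> by (simp add: positive_params_def)
  from bolt_soft_bound[OF this planner[unfolded \<eta>] \<pi> H s \<epsilon> \<delta>]
  show "measure (bayes_law S A \<theta>\<^sub>0 \<pi> s\<^sub>0)
         {\<omega> \<in> space (bayes_law S A \<theta>\<^sub>0 \<pi> s\<^sub>0).
            emeasure (count_space UNIV)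
              {t. \<not> bayes_value S A R \<gamma> (policy_after \<pi> (history \<omega> t)) (\<omega> t) (posterior \<theta>\<^sub>0 \<pi> (history \<omega> t))
                    \<ge> opt_bayes_value S A R \<gamma> (\<omega> t) (posterior \<theta>\<^sub>0 \<pi> (history \<omega> t)) - \<epsilon>}
            \<le> soft_bound 704 (real (card S) * real (card A) * \<eta>\<^sup>2 / (\<epsilon>\<^sup>2 * (1 - \<gamma>)\<^sup>2))
                 (real (card S) * real (card A)) \<delta>}
       \<ge> 1 - \<delta>"
    unfolding suboptimal_def last \<eta> .
qed simp

end
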